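(* Let $n\ge2$ and let $E\subseteq\mathbb{R}^n$ have positive and finite $s$-dimensional Hausdorff measure. Let $A\subseteq\mathbb{R}^n$ (the vantage set) be a piecewise smooth $(n-1)$-dimensional surface, disjoint from $E$, equipped with the Hausdorff measure $\mathcal H^{n-1}$. Assume there is a constant $M$ with $|a-e|\le M$ for all $a\in A$, $e\in E$, and that there is $\rho>0$ such that for $\mathcal H^{n-1}$-almost every $a\in A$ the tangent plane to $A$ based at $a$ does not pass within distance $\rho$ of $E$. Then: (i) the family of radial projections $\{P_a:E\to\mathbb{S}^{n-1}\}_{a\in A}$ is $(n-1)$-transversal; (ii) if $s<n-1$, there is a constant $c>0$ such that for all sufficiently small $r>0$, $\displaystyle\int_A \operatorname{vis}(a,E(r))\,d\mathcal H^{n-1}(a)\ge c\,r^{n-1-s}$; (iii) if $s=n-1$, there is a constant $c>0$ such that for all sufficiently small $r>0$, $\displaystyle\int_A \operatorname{vis}(a,E(r))\,d\mathcal H^{n-1}(a)\ge c\,(\log r^{-1})^{-1}$.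
   Context: For $a\in\mathbb{R}^n$ the radial projection $P_a:\mathbb{R}^n\setminus\{a\}\to\mathbb{S}^{n-1}$ is $P_a(x)=\frac{x-a}{|x-a|}$, and the visibility of a set $S$ from $a$ is $\operatorname{vis}(a,S)=|P_a(S)|$, where $|\cdot|$ is $(n-1)$-dimensional Hausdorff measure on $\mathbb{S}^{n-1}$. $E(r)=\{x:\operatorname{dist}(x,E)<r\}$. A piecewise smooth $(n-1)$-dimensional surface is understood as a nonempty finite union of compact smooth embedded $(n-1)$-dimensional hypersurfaces (possibly with boundary). Let $\psi$ be $\mathcal H^{n-1}$ restricted to $A$, normalized to a probability measure. The family $\{P_a\}_{a\in A}$ with domain $E$ is $(n-1)$-transversal if there are constants $c>0$, $\delta_0>0$ such that for all distinct $x,y\in E$ and $0<\delta\le\delta_0$, $$\psi\{a\in A:|P_a(x)-P_a(y)|\le\delta\}<c\,\frac{\delta^{n-1}}{|x-y|^{n-1}}.$$ *)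

theory Defs
  imports "HOL-Analysis.Analysis"
begin

section \<open>Hausdorff measure\<close>

text \<open>The factor that would make the \<open>n\<close>-dimensional measure on \<open>\<real>\<^sup>n\<close> agree with
  Lebesgue measure is omitted. Points count 1 when \<open>s = 0\<close>, where \<open>0 powr 0 = 0\<close> would be
  wrong. Covering sets are required to be bounded because the library's
  \<^const>\<open>diameter\<close> is meaningless on unbounded sets.\<close>

definition hausdorff_gauge :: "real \<Rightarrow> 'a::metric_space set \<Rightarrow> ennreal" where
  "hausdorff_gauge s U =
     (if U = {} then 0 else if s = 0 then 1 else ennreal (diameter U powr s))"

definition hausdorff_content :: "real \<Rightarrow> real \<Rightarrow> 'a::metric_space set \<Rightarrow> ennreal" where
  "hausdorff_content s d S =
     (INF C \<in> {C :: nat \<Rightarrow> 'a set. S \<subseteq> (\<Union>i. C i) \<and> (\<forall>i. bounded (C i) \<and> diameter (C i) \<le> d)}.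
        \<Sum>i. hausdorff_gauge s (C i))"

definition hausdorff_outer :: "real \<Rightarrow> 'a::metric_space set \<Rightarrow> ennreal" where
  "hausdorff_outer s S = (SUP d \<in> {0<..}. hausdorff_content s d S)"

text \<open>For \<open>s \<ge> 0\<close>, \<^const>\<open>hausdorff_outer\<close> is a metric outer measure, hence countably
  additive on the Borel sets, so \<^const>\<open>measure_of\<close> does not fall back to the zero measure here.\<close>

definition hausdorff_measure :: "real \<Rightarrow> 'a::metric_space measure" where
  "hausdorff_measure s = measure_of UNIV (sets borel) (hausdorff_outer s)"

section \<open>Smooth hypersurfaces with boundary\<close>

text \<open>Meant for open \<open>U\<close>; only the values of \<open>f\<close> on \<open>U\<close> matter then.\<close>

primrec Ck_on :: "nat \<Rightarrow> 'a::real_normed_vector set \<Rightarrow> ('a \<Rightarrow> 'b::real_normed_vector) \<Rightarrow> bool" where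
  "Ck_on 0 U f \<longleftrightarrow> continuous_on U f"
| "Ck_on (Suc k) U f \<longleftrightarrow>
     (\<forall>x\<in>U. f differentiable (at x)) \<and> (\<forall>v. Ck_on k U (\<lambda>x. frechet_derivative f (at x) v))"

definition smooth_on :: "'a::real_normed_vector set \<Rightarrow> ('a \<Rightarrow> 'b::real_normed_vector) \<Rightarrow> bool" where
  "smooth_on U f \<longleftrightarrow> (\<forall>k. Ck_on k U f)"

definition diffeomorphism_on ::
    "'a::real_normed_vector set \<Rightarrow> 'b::real_normed_vector set \<Rightarrow> ('a \<Rightarrow> 'b) \<Rightarrow> ('b \<Rightarrow> 'a) \<Rightarrow> bool" where
  "diffeomorphism_on U V f g \<longleftrightarrow>
     open U \<and> open V \<and> homeomorphism U V f g \<and> smooth_on U f \<and> smooth_on V g"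

text \<open>A chart of the ambient space that flattens \<open>S \<inter> U\<close> to a piece of the hyperplane
  orthogonal to the unit vector \<open>u\<close> (interior chart) or of a closed half of that
  hyperplane (boundary chart).\<close>

definition slice_chart ::
    "'a::euclidean_space set \<Rightarrow> 'a set \<Rightarrow> ('a \<Rightarrow> 'a) \<Rightarrow> 'a \<Rightarrow> bool" where
  "slice_chart S U \<phi> u \<longleftrightarrow>
     norm u = 1 \<and>
     (\<exists>V g. diffeomorphism_on U V \<phi> g \<and>
        (\<phi> ` (S \<inter> U) = {y \<in> V. y \<bullet> u = 0} \<or>
         (\<exists>w. norm w = 1 \<and> w \<bullet> u = 0 \<and> \<phi> ` (S \<inter> U) = {y \<in> V. y \<bullet> u = 0 \<and> y \<bullet> w \<ge> 0})))"

definition smooth_hypersurface :: "'a::euclidean_space set \<Rightarrow> bool" where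
  "smooth_hypersurface S \<longleftrightarrow> (\<forall>a\<in>S. \<exists>U \<phi> u. a \<in> U \<and> slice_chart S U \<phi> u)"

text \<open>The kernel below does not depend on the chart, at boundary points either; there it
  is the full hyperplane, not a half-space.\<close>

definition tangent_space :: "'a::euclidean_space set \<Rightarrow> 'a \<Rightarrow> 'a set" where
  "tangent_space S a =
     {v. \<exists>U \<phi> u. a \<in> S \<inter> U \<and> slice_chart S U \<phi> u \<and> frechet_derivative \<phi> (at a) v \<bullet> u = 0}"

definition piecewise_smooth_surface :: "'a::euclidean_space set \<Rightarrow> bool" where
  "piecewise_smooth_surface A \<longleftrightarrow>
     A \<noteq> {} \<and> (\<exists>F. finite F \<and> A = \<Union>F \<and> (\<forall>S\<in>F. compact S \<and> smooth_hypersurface S))"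

text \<open>The affine tangent planes at \<open>a\<close> of the smooth pieces of \<open>A\<close> through \<open>a\<close>. If \<open>A\<close> is
  piecewise smooth, this is a singleton, the tangent plane of \<open>A\<close>, for almost every \<open>a \<in> A\<close>:
  pieces with different tangent planes meet in a null set.\<close>

definition tangent_planes :: "'a::euclidean_space set \<Rightarrow> 'a \<Rightarrow> 'a set set" where
  "tangent_planes A a =
     {(+) a ` tangent_space S a | S. compact S \<and> smooth_hypersurface S \<and> S \<subseteq> A \<and> a \<in> S}"

section \<open>Radial projections, visibility, transversality\<close>

text \<open>Only used for \<open>x \<noteq> a\<close>.\<close>

definition radial_proj :: "'a::real_normed_vector \<Rightarrow> 'a \<Rightarrow> 'a" where
  "radial_proj a x = (x - a) /\<^sub>R norm (x - a)"

definition vis :: "'a::euclidean_space \<Rightarrow> 'a set \<Rightarrow> ennreal" where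
  "vis a S = hausdorff_outer (real (DIM('a) - 1)) (radial_proj a ` (S - {a}))"

definition nbhd :: "'a::metric_space set \<Rightarrow> real \<Rightarrow> 'a set" where
  "nbhd E r = {x. infdist x E < r}"

definition transversal ::
    "nat \<Rightarrow> 'p measure \<Rightarrow> 'p set \<Rightarrow> 'a::metric_space set \<Rightarrow> ('p \<Rightarrow> 'a \<Rightarrow> 'b::metric_space) \<Rightarrow> bool" where
  "transversal k \<psi> A E P \<longleftrightarrow>
     (\<exists>c>0. \<exists>\<delta>\<^sub>0>0. \<forall>x\<in>E. \<forall>y\<in>E. x \<noteq> y \<longrightarrow>
        (\<forall>\<delta>. 0 < \<delta> \<and> \<delta> \<le> \<delta>\<^sub>0 \<longrightarrow>
           emeasure \<psi> {a \<in> A. dist (P a x) (P a y) \<le> \<delta>} < ennreal (c * (\<delta> ^ k / dist x y ^ k))))"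

end

theory Submission
  imports Defs
begin

text \<open>Nearby points \<open>a\<close> of the surface from which \<open>x\<close> and \<open>y\<close> are seen in almost the same direction
  lie in a thin tube around the line \<open>xy\<close>. As that line is uniformly transverse to the
  tangent planes of \<open>A\<close>, the tube meets each of finitely many almost flat patches covering \<open>A\<close> in a
  set of diameter \<open>O(\<delta>/|x - y|)\<close>, which gives transversality.

  For the visibility bounds, a discrete measure \<open>\<mu>\<close> on \<open>E\<close> at scale \<open>r\<close> with
  \<open>\<mu>(B(x,t)) \<le> C t\<^sup>s\<close> for \<open>t \<ge> r\<close> replaces a Frostman measure, so no measurability of \<open>E\<close> enters.
  By Cauchy--Schwarz the number of \<open>r\<close>-separated directions in which the support of \<open>\<mu>\<close> is seen
  from \<open>a\<close> is at least the square of its mass divided by the \<open>\<mu> \<times> \<mu>\<close>-measure of the pairs seen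
  within \<open>O(r)\<close>. Transversality bounds the integral of the latter over \<open>A\<close> by an energy
  of \<open>\<mu>\<close>, and Markov's inequality turns this into a lower bound on a large part of \<open>A\<close>.\<close>

section \<open>Hausdorff measure\<close>

text \<open>Hausdorff measures are compared with volume only through Lipschitz tubes: sweeping a set
  of dimension \<open>n - 1\<close> along one more bounded parameter produces volume at most a
  constant times its measure. The cone over a spherical set turns this into a lower bound for
  visibility, and the thickening of a chart image into positivity of the measure of
  \<open>A\<close>.

  The rates in (ii) and (iii) come from one sum. If \<open>r\<close> is about
  \<open>2 ^ (-m)\<close>, the scale \<open>2 ^ (-j)\<close> with \<open>j \<le> m\<close>
  contributes to the energy a term proportional to \<open>(2 ^ j) powr (n - 1 - s)\<close>, and the
  visibility is bounded below by the reciprocal of the sum of these powers. For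
  \<open>s < n - 1\<close> the last term dominates and is of order
  \<open>r powr (s - (n - 1))\<close>; for \<open>s = n - 1\<close> all terms are equal and their
  number is of order \<open>ln (1 / r)\<close>.\<close>

lemma hausdorff_gauge_empty [simp]: "hausdorff_gauge s {} = 0"
  by (simp add: hausdorff_gauge_def)

lemma hausdorff_gauge_mono:
  assumes "U \<subseteq> V" "bounded V" "0 \<le> s"
  shows "hausdorff_gauge s U \<le> hausdorff_gauge s V"
  using assms diameter_subset[OF assms(1,2)] diameter_ge_0[OF bounded_subset[OF assms(2,1)]]
  by (auto simp: hausdorff_gauge_def intro!: ennreal_leI powr_mono2)

lemma hausdorff_content_le:
  assumes "S \<subseteq> (\<Union>i. C i)" "\<And>i. bounded (C i)" "\<And>i. diameter (C i) \<le> d"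
  shows "hausdorff_content s d S \<le> (\<Sum>i. hausdorff_gauge s (C i))"
  unfolding hausdorff_content_def using assms by (intro INF_lower) auto

lemma hausdorff_content_less:
  assumes "hausdorff_content s d S < e"
  obtains C :: "nat \<Rightarrow> 'a::metric_space set" where "S \<subseteq> (\<Union>i. C i)" "\<And>i. bounded (C i)"
    "\<And>i. diameter (C i) \<le> d" "(\<Sum>i. hausdorff_gauge s (C i)) < e"
  using assms unfolding hausdorff_content_def INF_less_iff by auto

lemma hausdorff_content_mono: "S \<subseteq> T \<Longrightarrow> hausdorff_content s d S \<le> hausdorff_content s d T"
  unfolding hausdorff_content_def by (rule INF_superset_mono) auto

lemma hausdorff_content_antimono:
  "d \<le> d' \<Longrightarrow> hausdorff_content s d' S \<le> hausdorff_content s d S"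
  unfolding hausdorff_content_def by (rule INF_superset_mono) (auto intro: order_trans)

lemma hausdorff_content_empty: "0 \<le> d \<Longrightarrow> hausdorff_content s d {} = 0"
  using hausdorff_content_le[of "{}" "\<lambda>_. {}" d s] by simp

lemma hausdorff_content_le_finite:
  assumes I: "finite I" and cov: "S \<subseteq> (\<Union>i\<in>I. C i)" and bd: "\<And>i. i \<in> I \<Longrightarrow> bounded (C i)"
    and d: "\<And>i. i \<in> I \<Longrightarrow> diameter (C i) \<le> d" "0 \<le> d"
  shows "hausdorff_content s d S \<le> (\<Sum>i\<in>I. hausdorff_gauge s (C i))"
proof -
  obtain h where h: "bij_betw h {..<card I} I"
    using ex_bij_betw_nat_finite[OF I] atLeast0LessThan by metis
  let ?D = "\<lambda>i. if i < card I then C (h i) else {}"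
  have hI: "i < card I \<Longrightarrow> h i \<in> I" for i using h by (auto simp: bij_betw_def)
  have "S \<subseteq> (\<Union>i. ?D i)"
  proof
    fix x assume "x \<in> S"
    with cov obtain i where "i \<in> I" "x \<in> C i" by auto
    with h obtain j where "j < card I" "h j = i" unfolding bij_betw_def by (metis imageE lessThan_iff)
    with \<open>x \<in> C i\<close> show "x \<in> (\<Union>i. ?D i)" by auto
  qed
  then have "hausdorff_content s d S \<le> (\<Sum>i. hausdorff_gauge s (?D i))"
    by (rule hausdorff_content_le) (use bd d hI in auto)
  also have "\<dots> = (\<Sum>i<card I. hausdorff_gauge s (?D i))"
    by (rule suminf_finite) auto
  also have "\<dots> = (\<Sum>i<card I. hausdorff_gauge s (C (h i)))" by simp
  also have "\<dots> = (\<Sum>i\<in>I. hausdorff_gauge s (C i))"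
    using h by (rule sum.reindex_bij_betw)
  finally show ?thesis .
qed

lemma hausdorff_content_countably_subadditive:
  "hausdorff_content s d (\<Union>i. S i) \<le> (\<Sum>i. hausdorff_content s d (S i))"
proof (rule ennreal_le_epsilon)
  fix e :: real
  assume fin: "(\<Sum>i. hausdorff_content s d (S i)) < top" and e: "0 < e"
  have "hausdorff_content s d (S i) < hausdorff_content s d (S i) + e * (1/2)^Suc i" for i
    using fin e by (auto simp: less_top dest!: ennreal_suminf_lessD)
  then have "\<exists>C. S i \<subseteq> (\<Union>j. C j) \<and> (\<forall>j. bounded (C j) \<and> diameter (C j) \<le> d) \<and>
      (\<Sum>j. hausdorff_gauge s (C j)) < hausdorff_content s d (S i) + e * (1/2)^Suc i" for i
    by (rule hausdorff_content_less) blast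
  then obtain C where C: "\<And>i. S i \<subseteq> (\<Union>j. C i j)" "\<And>i j. bounded (C i j)"
      "\<And>i j. diameter (C i j) \<le> d"
      "\<And>i. (\<Sum>j. hausdorff_gauge s (C i j)) < hausdorff_content s d (S i) + e * (1/2)^Suc i"
    by metis
  define D where "D = (\<lambda>p. case_prod C (prod_decode p))"
  have D: "bounded (D p)" "diameter (D p) \<le> d" for p
    using C(2,3) by (simp_all add: D_def split_beta)
  have "(\<Union>i. S i) \<subseteq> (\<Union>p. D p)"
  proof
    fix x assume "x \<in> (\<Union>i. S i)"
    then obtain i j where "x \<in> C i j" using C(1) by blast
    then have "x \<in> D (prod_encode (i, j))" by (simp add: D_def)
    then show "x \<in> (\<Union>p. D p)" by blast
  qed
  then have "hausdorff_content s d (\<Union>i. S i) \<le> (\<Sum>p. hausdorff_gauge s (D p))"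
    using D by (rule hausdorff_content_le)
  also have "\<dots> = (\<Sum>p. (\<lambda>(i, j). hausdorff_gauge s (C i j)) (prod_decode p))"
    by (simp add: D_def split_beta)
  also have "\<dots> = (\<Sum>i. \<Sum>j. hausdorff_gauge s (C i j))"
    by (rule suminf_ennreal_2dimen) simp
  also have "\<dots> \<le> (\<Sum>i. hausdorff_content s d (S i) + e * (1/2)^Suc i)"
    using C(4) by (intro suminf_le) (auto intro: less_imp_le)
  also have "\<dots> = (\<Sum>i. hausdorff_content s d (S i)) + (\<Sum>i. ennreal e * ennreal ((1/2) ^ Suc i))"
    using e by (subst suminf_add[symmetric]) (auto simp del: power_Suc simp: ennreal_mult'')
  also have "\<dots> = (\<Sum>i. hausdorff_content s d (S i)) + e"
    unfolding ennreal_suminf_cmult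
    by (subst suminf_ennreal_eq[OF zero_le_power power_half_series]) auto
  finally show "hausdorff_content s d (\<Union>i. S i) \<le> (\<Sum>i. hausdorff_content s d (S i)) + e" .
qed

lemma hausdorff_content_le_outer: "0 < d \<Longrightarrow> hausdorff_content s d S \<le> hausdorff_outer s S"
  unfolding hausdorff_outer_def by (rule SUP_upper) auto

lemma hausdorff_outer_mono: "S \<subseteq> T \<Longrightarrow> hausdorff_outer s S \<le> hausdorff_outer s T"
  unfolding hausdorff_outer_def by (rule SUP_mono') (rule hausdorff_content_mono)

lemma hausdorff_outer_empty [simp]: "hausdorff_outer s {} = 0"
  by (simp add: hausdorff_outer_def hausdorff_content_empty)

lemma hausdorff_outer_countably_subadditive:
  "hausdorff_outer s (\<Union>i. S i) \<le> (\<Sum>i. hausdorff_outer s (S i))"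
  unfolding hausdorff_outer_def[of s "\<Union>i. S i"]
proof (rule SUP_least)
  fix d :: real assume "d \<in> {0<..}"
  then show "hausdorff_content s d (\<Union>i. S i) \<le> (\<Sum>i. hausdorff_outer s (S i))"
    by (intro order_trans[OF hausdorff_content_countably_subadditive] suminf_le)
       (auto intro: hausdorff_content_le_outer)
qed

lemma outer_measure_space_hausdorff_outer: "outer_measure_space UNIV (hausdorff_outer s)"
  using hausdorff_outer_countably_subadditive
  by (auto simp: outer_measure_space_def positive_def increasing_def countably_subadditive_def
      hausdorff_outer_mono)

lemma hausdorff_outer_Un: "hausdorff_outer s (S \<union> T) \<le> hausdorff_outer s S + hausdorff_outer s T"
proof -
  have "(\<Union>i. binaryset S T i) = S \<union> T" by (rule UN_binaryset_eq)
  then have "hausdorff_outer s (S \<union> T) \<le> (\<Sum>i. hausdorff_outer s (binaryset S T i))"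
    using hausdorff_outer_countably_subadditive[of s "binaryset S T"] by simp
  also have "\<dots> = hausdorff_outer s S + hausdorff_outer s T"
    by (rule suminf_binaryset_eq) simp
  finally show ?thesis .
qed

lemma hausdorff_outer_UN_finite:
  "finite I \<Longrightarrow> hausdorff_outer s (\<Union>i\<in>I. S i) \<le> (\<Sum>i\<in>I. hausdorff_outer s (S i))"
proof (induction I rule: finite_induct)
  case (insert i I)
  then show ?case
    using hausdorff_outer_Un[of s "S i" "\<Union>i\<in>I. S i"] by (auto intro: order_trans add_left_mono)
qed simp

section \<open>Additivity over separated sets and Caratheodory measurability of Borel sets\<close>

lemma hausdorff_content_separated:
  fixes S T :: "'a::metric_space set"
  assumes s: "0 \<le> s" and d: "d < \<eta>" "0 \<le> d" and sep: "\<And>x y. x \<in> S \<Longrightarrow> y \<in> T \<Longrightarrow> \<eta> \<le> dist x y"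
  shows "hausdorff_content s d S + hausdorff_content s d T \<le> hausdorff_content s d (S \<union> T)"
proof (rule ccontr)
  assume "\<not> ?thesis"
  then have "hausdorff_content s d (S \<union> T) < hausdorff_content s d S + hausdorff_content s d T"
    by simp
  then obtain C where C: "S \<union> T \<subseteq> (\<Union>i. C i)" "\<And>i. bounded (C i)" "\<And>i. diameter (C i) \<le> d"
    "(\<Sum>i. hausdorff_gauge s (C i)) < hausdorff_content s d S + hausdorff_content s d T"
    by (rule hausdorff_content_less) blast
  have part: "hausdorff_content s d R \<le> (\<Sum>i. hausdorff_gauge s (if C i \<inter> R = {} then {} else C i))"
    if "R \<subseteq> (\<Union>i. C i)" for R
    by (rule hausdorff_content_le) (use C(2,3) d that in \<open>auto 4 4\<close>)
  \<comment> \<open>A covering set of diameter at most \<open>d < \<eta>\<close> is too small to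
    meet both \<open>S\<close> and \<open>T\<close>, so the cover splits without double
    counting.\<close>
  have disj: "C i \<inter> S = {} \<or> C i \<inter> T = {}" for i
  proof (rule ccontr)
    assume "\<not> ?thesis"
    then obtain x y where "x \<in> C i" "x \<in> S" "y \<in> C i" "y \<in> T" by blast
    then show False
      using sep[of x y] diameter_bounded_bound[OF C(2), of x i y] C(3)[of i] d by simp
  qed
  have "hausdorff_content s d S + hausdorff_content s d T \<le>
     (\<Sum>i. hausdorff_gauge s (if C i \<inter> S = {} then {} else C i)) +
     (\<Sum>i. hausdorff_gauge s (if C i \<inter> T = {} then {} else C i))"
    using C(1) by (intro add_mono part) auto
  also have "\<dots> = (\<Sum>i. hausdorff_gauge s (if C i \<inter> S = {} then {} else C i) +
     hausdorff_gauge s (if C i \<inter> T = {} then {} else C i))"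
    by (rule suminf_add) auto
  also have "\<dots> \<le> (\<Sum>i. hausdorff_gauge s (C i))"
    using disj by (intro suminf_le) auto
  finally show False using C(4) by simp
qed

lemma hausdorff_outer_separated:
  fixes S T :: "'a::metric_space set"
  assumes s: "0 \<le> s" and \<eta>: "0 < \<eta>" and sep: "\<And>x y. x \<in> S \<Longrightarrow> y \<in> T \<Longrightarrow> \<eta> \<le> dist x y"
  shows "hausdorff_outer s S + hausdorff_outer s T \<le> hausdorff_outer s (S \<union> T)"
proof -
  have "hausdorff_content s d S + hausdorff_content s d' T \<le> hausdorff_outer s (S \<union> T)"
    if "0 < d" "0 < d'" for d d'
  proof -
    \<comment> \<open>Contents only grow as the scale shrinks, so both scales may be replaced by a
      common one below the gap. Keeping \<open>d\<close> and \<open>d'\<close> independent allows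
      the two suprema to be taken one after the other.\<close>
    define m where "m = min (min d d') (\<eta>/2)"
    have m: "0 < m" "m \<le> d" "m \<le> d'" "m < \<eta>" using that \<eta> by (auto simp: m_def)
    have "hausdorff_content s d S + hausdorff_content s d' T
        \<le> hausdorff_content s m S + hausdorff_content s m T"
      using m by (intro add_mono hausdorff_content_antimono)
    also have "\<dots> \<le> hausdorff_content s m (S \<union> T)"
      using m sep by (intro hausdorff_content_separated[OF s]) auto
    also have "\<dots> \<le> hausdorff_outer s (S \<union> T)"
      using m by (intro hausdorff_content_le_outer)
    finally show ?thesis .
  qed
  then have "hausdorff_content s d S + hausdorff_outer s T \<le> hausdorff_outer s (S \<union> T)"
    if "0 < d" for d
    unfolding hausdorff_outer_def[of s T]
    using that by (subst ennreal_SUP_add_right) (auto intro!: SUP_least)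
  then show ?thesis
    unfolding hausdorff_outer_def[of s S]
    by (subst ennreal_SUP_add_left[symmetric]) (auto intro!: SUP_least)
qed

lemma hausdorff_outer_separated_sum:
  fixes D :: "nat \<Rightarrow> 'a::metric_space set"
  assumes s: "0 \<le> s"
    and sep: "\<And>j. \<exists>\<eta>>0. \<forall>i<j. \<forall>x\<in>D i. \<forall>y\<in>D j. \<eta> \<le> dist x y"
  shows "(\<Sum>i<n. hausdorff_outer s (D i)) \<le> hausdorff_outer s (\<Union>i<n. D i)"
proof (induction n)
  case (Suc n)
  obtain \<eta> where \<eta>: "0 < \<eta>" "\<And>i x y. i < n \<Longrightarrow> x \<in> D i \<Longrightarrow> y \<in> D n \<Longrightarrow> \<eta> \<le> dist x y"
    using sep[of n] by blast
  have "(\<Sum>i<Suc n. hausdorff_outer s (D i)) \<le> hausdorff_outer s (\<Union>i<n. D i) + hausdorff_outer s (D n)"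
    using Suc by (simp add: add_right_mono)
  also have "\<dots> \<le> hausdorff_outer s ((\<Union>i<n. D i) \<union> D n)"
    using \<eta> by (intro hausdorff_outer_separated[OF s \<eta>(1)]) auto
  also have "(\<Union>i<n. D i) \<union> D n = (\<Union>i<Suc n. D i)" by (auto simp: less_Suc_eq)
  finally show ?case .
qed simp

text \<open>The part \<open>G n\<close> of \<open>T\<close> at distance at least
  \<open>1 / (n + 1)\<close> from \<open>F\<close> is separated from \<open>T \<inter> F\<close>, so
  the measure is additive on these two. What is left of \<open>T - F\<close> lies in the shells
  \<open>D i\<close> with \<open>i \<ge> n\<close>, whose measures have a finite sum and hence small
  tails.\<close>

lemma hausdorff_outer_closed_split:
  fixes F T :: "'a::metric_space set"
  assumes s: "0 \<le> s" and F: "closed F"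
  shows "hausdorff_outer s (T \<inter> F) + hausdorff_outer s (T - F) \<le> hausdorff_outer s T"
proof (cases "F = {} \<or> hausdorff_outer s T = top")
  case False
  then have F0: "F \<noteq> {}" and fin: "hausdorff_outer s T < top" by (auto simp: less_top)
  define G where "G = (\<lambda>n. {x \<in> T. 1 / real (Suc n) \<le> infdist x F})"
  define D where "D = (\<lambda>n. {x \<in> T. 1 / real (n + 2) \<le> infdist x F \<and> infdist x F < 1 / real (Suc n)})"
  \<comment> \<open>\<open>c\<close> selects the parity. Consecutive shells may touch, but between
    two different shells of equal parity a whole shell is skipped, which leaves a gap.\<close>
  have half: "(\<Sum>i<n. hausdorff_outer s (D (2 * i + c))) \<le> hausdorff_outer s T" for n c
  proof -
    have "\<exists>\<eta>>0. \<forall>i<j. \<forall>x\<in>D (2 * i + c). \<forall>y\<in>D (2 * j + c). \<eta> \<le> dist x y" for j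
    proof (cases "j = 0")
      case False
      let ?\<eta> = "1 / real (2 * j + c) - 1 / real (2 * j + c + 1)"
      have "?\<eta> \<le> dist x y" if "i < j" "x \<in> D (2 * i + c)" "y \<in> D (2 * j + c)" for i x y
      proof -
        have "1 / real (2 * j + c) \<le> 1 / real (2 * i + c + 2)"
          using that(1) by (intro divide_left_mono) auto
        moreover have "infdist x F \<le> infdist y F + dist x y" by (rule infdist_triangle)
        ultimately show ?thesis using that(2,3) by (auto simp: D_def)
      qed
      moreover have "0 < ?\<eta>"
        using False divide_strict_left_mono[of "real (2 * j + c)" "real (2 * j + c + 1)" 1] by simp
      ultimately show ?thesis by blast
    qed (auto intro: exI[of _ 1])
    from hausdorff_outer_separated_sum[OF s this]
    have "(\<Sum>i<n. hausdorff_outer s (D (2 * i + c))) \<le> hausdorff_outer s (\<Union>i<n. D (2 * i + c))" .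
    also have "\<dots> \<le> hausdorff_outer s T" by (rule hausdorff_outer_mono) (auto simp: D_def)
    finally show ?thesis .
  qed
  have split2: "(\<Sum>i<2 * n. f i) = (\<Sum>i<n. f (2 * i + 0)) + (\<Sum>i<n. f (2 * i + 1))"
    for f :: "nat \<Rightarrow> ennreal" and n
    by (induction n) (auto simp: algebra_simps)
  have "(\<Sum>i. hausdorff_outer s (D i)) \<le> hausdorff_outer s T + hausdorff_outer s T"
    unfolding suminf_eq_SUP
  proof (rule SUP_least)
    fix n
    have "(\<Sum>i<n. hausdorff_outer s (D i)) \<le> (\<Sum>i<2 * n. hausdorff_outer s (D i))"
      by (intro sum_mono2) auto
    also have "\<dots> \<le> hausdorff_outer s T + hausdorff_outer s T"
      unfolding split2 by (intro add_mono half)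
    finally show "(\<Sum>i<n. hausdorff_outer s (D i)) \<le> hausdorff_outer s T + hausdorff_outer s T" .
  qed
  also have "\<dots> < top" using fin by simp
  finally have sumfin: "(\<Sum>i. hausdorff_outer s (D i)) < top" .
  show ?thesis
  proof (rule ennreal_le_epsilon)
    fix e :: real assume e: "0 < e"
    let ?S = "\<lambda>n. \<Sum>i<n. hausdorff_outer s (D i)"
    have "\<exists>n. (\<Sum>i. hausdorff_outer s (D i)) \<le> ?S n + e"
    proof (cases "(\<Sum>i. hausdorff_outer s (D i)) \<le> e")
      case False
      have "(\<Sum>i. hausdorff_outer s (D i)) < (\<Sum>i. hausdorff_outer s (D i)) + e"
        using sumfin e by (cases "\<Sum>i. hausdorff_outer s (D i)")
          (auto simp: ennreal_plus[symmetric] ennreal_less_iff simp del: ennreal_plus)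
      with False have "(\<Sum>i. hausdorff_outer s (D i)) - e < (\<Sum>i. hausdorff_outer s (D i))"
        by (subst minus_less_iff_ennreal) auto
      then obtain n where "(\<Sum>i. hausdorff_outer s (D i)) - e < (\<Sum>i<n. hausdorff_outer s (D i))"
        by (subst (asm) (2) suminf_eq_SUP) (auto simp: less_SUP_iff)
      then show ?thesis
        by (metis add.commute ennreal_minus_le_iff less_imp_le)
    qed (auto intro: exI[of _ 0])
    then obtain n where n: "(\<Sum>i. hausdorff_outer s (D i)) \<le> ?S n + e" by blast
    have "(\<Sum>i. hausdorff_outer s (D i)) = (\<Sum>i. hausdorff_outer s (D (i + n))) + ?S n"
      by (rule suminf_offset) simp
    with n have "?S n + (\<Sum>i. hausdorff_outer s (D (i + n))) \<le> ?S n + e"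
      by (simp add: add.commute)
    moreover have "b \<le> c" if "a + b \<le> a + c" "a < top" for a b c :: ennreal
      using that by (auto simp: ennreal_add_left_cancel_le)
    moreover have "?S n < top" by (rule le_less_trans[OF sum_le_suminf sumfin]) auto
    ultimately have tail: "(\<Sum>i. hausdorff_outer s (D (i + n))) \<le> e"
      by blast
    have "T - F \<subseteq> G n \<union> (\<Union>i. D (i + n))"
    proof
      fix x assume x: "x \<in> T - F"
      then have "infdist x F \<noteq> 0"
        using F F0 in_closed_iff_infdist_zero by blast
      then have pos: "0 < infdist x F" using infdist_nonneg[of x F] by simp
      show "x \<in> G n \<union> (\<Union>i. D (i + n))"
      proof (cases "x \<in> G n")
        case False
        define m where "m = (LEAST m. 1 / real (Suc m) \<le> infdist x F)"
        obtain m0 where "inverse (real (Suc m0)) < infdist x F"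
          using reals_Archimedean[OF pos] by blast
        then have "1 / real (Suc m0) \<le> infdist x F" by (simp add: inverse_eq_divide)
        then have m: "1 / real (Suc m) \<le> infdist x F"
          unfolding m_def by (rule LeastI)
        have lt: "infdist x F < 1 / real (Suc k)" if "k < m" for k
          using not_less_Least[OF that[unfolded m_def]] by simp
        have "n < m"
        proof (rule ccontr)
          assume "\<not> n < m"
          then have "1 / real (Suc n) \<le> 1 / real (Suc m)" by (intro divide_left_mono) auto
          with m False x show False by (auto simp: G_def)
        qed
        then obtain i where i: "m = Suc (i + n)"
          by (metis add.commute less_iff_Suc_add)
        then have "x \<in> D (i + n)"
          using m lt[of "i + n"] x by (auto simp: D_def)
        then show ?thesis by blast
      qed simp
    qed
    then have "hausdorff_outer s (T - F) \<le> hausdorff_outer s (G n) + hausdorff_outer s (\<Union>i. D (i + n))"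
      by (meson hausdorff_outer_mono hausdorff_outer_Un order_trans)
    also have "\<dots> \<le> hausdorff_outer s (G n) + e"
      using tail hausdorff_outer_countably_subadditive[of s "\<lambda>i. D (i + n)"]
      by (intro add_left_mono) (auto intro: order_trans)
    finally have "hausdorff_outer s (T \<inter> F) + hausdorff_outer s (T - F) \<le>
        hausdorff_outer s (T \<inter> F) + hausdorff_outer s (G n) + e"
      by (metis add.assoc add_left_mono)
    also have "hausdorff_outer s (T \<inter> F) + hausdorff_outer s (G n) \<le> hausdorff_outer s (T \<inter> F \<union> G n)"
    proof (rule hausdorff_outer_separated[OF s, of "1 / real (Suc n)"])
      fix x y assume "x \<in> T \<inter> F" "y \<in> G n"
      then show "1 / real (Suc n) \<le> dist x y"
        using infdist_le[of x F y] by (auto simp: G_def dist_commute)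
    qed simp
    also have "\<dots> \<le> hausdorff_outer s T" by (rule hausdorff_outer_mono) (auto simp: G_def)
    finally show "hausdorff_outer s (T \<inter> F) + hausdorff_outer s (T - F) \<le> hausdorff_outer s T + e"
      by (simp add: add_right_mono)
  qed
qed auto

text \<open>By Caratheodory's theorem the sets that split every test set additively form a
  sigma-algebra on which the outer measure is a measure. It contains the closed sets by the
  preceding split, hence all Borel sets.\<close>

lemma measure_space_hausdorff_outer:
  assumes s: "0 \<le> s"
  shows "measure_space UNIV (sets borel) (hausdorff_outer s :: 'a::metric_space set \<Rightarrow> ennreal)"
proof -
  interpret sigma_algebra "UNIV :: 'a set" "Pow UNIV" by (rule sigma_algebra_Pow)
  let ?L = "lambda_system UNIV UNIV (hausdorff_outer s :: 'a set \<Rightarrow> ennreal)"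
  have L: "measure_space UNIV ?L (hausdorff_outer s)"
    using caratheodory_lemma[OF outer_measure_space_hausdorff_outer[of s, folded Pow_UNIV]]
    unfolding Pow_UNIV .
  then have "sigma_algebra UNIV ?L" by (simp add: measure_space_def)
  moreover have "F \<in> ?L" if "closed F" for F :: "'a set"
  proof -
    have "hausdorff_outer s (F \<inter> T) + hausdorff_outer s ((UNIV - F) \<inter> T) = hausdorff_outer s T" for T
    proof -
      have eq: "(UNIV - F) \<inter> T = T - F" "F \<inter> T = T \<inter> F" "T \<inter> F \<union> (T - F) = T" by auto
      show ?thesis
        unfolding eq using hausdorff_outer_Un[of s "T \<inter> F" "T - F"]
        by (intro antisym hausdorff_outer_closed_split[OF s that]) (simp only: eq(3))
    qed
    then show ?thesis by (simp only: lambda_system_def) blast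
  qed
  ultimately have "sigma_sets UNIV (Collect closed) \<subseteq> ?L"
    using sigma_algebra.sigma_sets_subset[of UNIV ?L "Collect closed"] by blast
  moreover have "sets (borel :: 'a measure) = sigma_sets UNIV (Collect closed)"
    by (simp add: borel_eq_closed)
  ultimately show ?thesis
    using measure_down[OF L] sets.sigma_algebra_axioms[of "borel :: 'a measure"] by simp
qed

lemma sets_hausdorff_measure [simp, measurable_cong]:
  "sets (hausdorff_measure s :: 'a::metric_space measure) = sets borel"
  unfolding hausdorff_measure_def
  using sets.sets_measure_of_eq[of "borel :: 'a measure" "hausdorff_outer s"] by (metis space_borel)

lemma space_hausdorff_measure [simp]: "space (hausdorff_measure s) = UNIV"
  by (simp add: hausdorff_measure_def space_measure_of_conv)

lemma emeasure_hausdorff_measure: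
  fixes X :: "'a::metric_space set"
  assumes s: "0 \<le> s" and X: "X \<in> sets borel"
  shows "emeasure (hausdorff_measure s) X = hausdorff_outer s X"
proof -
  have ms: "measure_space UNIV (sets borel) (hausdorff_outer s :: 'a set \<Rightarrow> ennreal)"
    by (rule measure_space_hausdorff_outer[OF s])
  show ?thesis
    by (rule emeasure_measure_of[OF hausdorff_measure_def])
       (use ms X in \<open>auto simp: measure_space_def\<close>)
qed

section \<open>Comparison with Lebesgue measure\<close>

text \<open>Serves for tubes over arbitrary sets, which may fail to be measurable; each
  \<open>A i\<close> is replaced by a measurable hull of the same measure.\<close>

lemma outer_measure_of_countably_subadditive:
  assumes "\<And>i. A i \<subseteq> space M"
  shows "outer_measure_of M (\<Union>i::nat. A i) \<le> (\<Sum>i. outer_measure_of M (A i))"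
proof -
  from outer_measure_of_attain[OF assms] obtain B where
    B: "\<And>i. B i \<in> sets M" "\<And>i. A i \<subseteq> B i" "\<And>i. outer_measure_of M (A i) = emeasure M (B i)"
    by metis
  have "outer_measure_of M (\<Union>i. A i) \<le> outer_measure_of M (\<Union>i. B i)"
    using B(2) by (intro outer_measure_of_mono) blast
  also have "\<dots> = emeasure M (\<Union>i. B i)" using B(1) by (intro outer_measure_of_eq) auto
  also have "\<dots> \<le> (\<Sum>i. emeasure M (B i))" using B(1) by (intro emeasure_subadditive_countably) auto
  finally show ?thesis by (simp add: B(3))
qed

text \<open>The image is covered by \<open>2/\<eta>\<close> balls of radius \<open>2L\<eta>\<close>.\<close>

lemma outer_measure_of_tube_le:
  fixes G :: "real \<Rightarrow> 'b::metric_space \<Rightarrow> 'a::euclidean_space"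
  assumes Lip: "\<And>t t' x x'. t \<in> {0..1} \<Longrightarrow> t' \<in> {0..1} \<Longrightarrow> x \<in> U \<Longrightarrow> x' \<in> U \<Longrightarrow>
      dist (G t x) (G t' x') \<le> L * (\<bar>t - t'\<bar> + dist x x')"
    and L: "0 < L" and U: "bounded U" "diameter U \<le> \<eta>" and \<eta>: "0 < \<eta>" "\<eta> \<le> 1"
  shows "outer_measure_of lborel (\<Union>t\<in>{0..1}. G t ` U) \<le>
    ennreal (2 * unit_ball_vol DIM('a) * (2 * L) ^ DIM('a) * \<eta> ^ (DIM('a) - 1))"
proof (cases "U = {}")
  case False
  then obtain x0 where x0: "x0 \<in> U" by blast
  define m where "m = nat \<lfloor>1 / \<eta>\<rfloor>"
  let ?B = "\<lambda>i. cball (G (real i * \<eta>) x0) (2 * L * \<eta>)"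
  have m1: "real m \<le> 1 / \<eta>" using \<eta> by (simp add: m_def)
  have "(\<Union>t\<in>{0..1}. G t ` U) \<subseteq> (\<Union>i\<in>{..m}. ?B i)"
  proof clarify
    fix t x assume t: "t \<in> {0..1::real}" and x: "x \<in> U"
    define i where "i = nat \<lfloor>t / \<eta>\<rfloor>"
    have fl: "0 \<le> \<lfloor>t / \<eta>\<rfloor>" using t \<eta> by simp
    have i1: "real i \<le> t / \<eta>" "t / \<eta> < real i + 1"
      using fl by (simp_all add: i_def)
    then have i: "real i * \<eta> \<le> t" "t < real i * \<eta> + \<eta>"
      using \<eta> by (simp_all add: field_simps)
    have "i \<le> m"
      unfolding i_def m_def using t \<eta> by (intro nat_mono floor_mono divide_right_mono) auto
    have "dist (G (real i * \<eta>) x0) (G t x) \<le> L * (\<bar>real i * \<eta> - t\<bar> + dist x0 x)"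
      by (rule Lip) (use i t x x0 \<eta> in auto)
    also have "\<dots> \<le> L * (\<eta> + \<eta>)"
      using i U diameter_bounded_bound[OF U(1) x0 x] L by (intro mult_left_mono add_mono) auto
    finally show "G t x \<in> (\<Union>i\<in>{..m}. ?B i)"
      using \<open>i \<le> m\<close> by (auto simp: mult_ac)
  qed
  then have "outer_measure_of lborel (\<Union>t\<in>{0..1}. G t ` U) \<le> outer_measure_of lborel (\<Union>i\<in>{..m}. ?B i)"
    by (rule outer_measure_of_mono)
  also have "\<dots> = emeasure lborel (\<Union>i\<in>{..m}. ?B i)"
    by (rule outer_measure_of_eq) auto
  also have "\<dots> \<le> (\<Sum>i\<in>{..m}. emeasure lborel (?B i))"
    by (rule emeasure_subadditive_finite) auto
  also have "\<dots> = (\<Sum>i\<in>{..m}. ennreal (unit_ball_vol DIM('a) * (2 * L * \<eta>) ^ DIM('a)))"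
    using L \<eta> by (simp add: emeasure_cball)
  also have "\<dots> = ennreal (real (Suc m)) * ennreal (unit_ball_vol DIM('a) * (2 * L * \<eta>) ^ DIM('a))"
    by (simp add: ennreal_of_nat_eq_real_of_nat)
  also have "\<dots> = ennreal (real (Suc m) * (unit_ball_vol DIM('a) * (2 * L * \<eta>) ^ DIM('a)))"
    by (rule ennreal_mult[symmetric]) (use L \<eta> in auto)
  also have "\<dots> \<le> ennreal (2 / \<eta> * (unit_ball_vol DIM('a) * (2 * L * \<eta>) ^ DIM('a)))"
  proof (intro ennreal_leI mult_right_mono)
    have "1 \<le> 1 / \<eta>" using \<eta> by simp
    then show "real (Suc m) \<le> 2 / \<eta>" using m1 by (simp add: field_simps)
  qed (use L \<eta> in auto)
  also have "2 / \<eta> * (unit_ball_vol DIM('a) * (2 * L * \<eta>) ^ DIM('a)) =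
      2 * unit_ball_vol DIM('a) * (2 * L) ^ DIM('a) * \<eta> ^ (DIM('a) - 1)"
  proof -
    have "\<eta> ^ DIM('a) = \<eta> * \<eta> ^ (DIM('a) - 1)" by (simp add: power_eq_if)
    then show ?thesis using \<eta> by (simp add: power_mult_distrib field_simps)
  qed
  finally show ?thesis .
qed (simp add: outer_measure_of_eq)

text \<open>The previous bound asks for a positive \<open>\<eta>\<close>, while
  \<open>diameter U\<close> may be \<open>0\<close>; so \<open>\<eta>\<close> decreases to
  \<open>diameter U\<close>, and the bound \<open>1 / 2\<close> leaves room for
  \<open>\<eta> < 1\<close>. As \<open>DIM('a) - 1\<close> is positive, the gauge of a nonempty set
  is the plain power of its diameter.\<close>

lemma outer_measure_of_tube_le_gauge:
  fixes G :: "real \<Rightarrow> 'b::metric_space \<Rightarrow> 'a::euclidean_space"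
  assumes Lip: "\<And>t t' x x'. t \<in> {0..1} \<Longrightarrow> t' \<in> {0..1} \<Longrightarrow> x \<in> U \<Longrightarrow> x' \<in> U \<Longrightarrow>
      dist (G t x) (G t' x') \<le> L * (\<bar>t - t'\<bar> + dist x x')"
    and L: "0 < L" and U: "bounded U" "diameter U \<le> 1 / 2" and n: "2 \<le> DIM('a)"
  shows "outer_measure_of lborel (\<Union>t\<in>{0..1}. G t ` U) \<le>
    ennreal (2 * unit_ball_vol DIM('a) * (2 * L) ^ DIM('a)) * hausdorff_gauge (real (DIM('a) - 1)) U"
proof (cases "U = {}")
  case False
  let ?K = "2 * unit_ball_vol DIM('a) * (2 * L) ^ DIM('a)"
  have "outer_measure_of lborel (\<Union>t\<in>{0..1}. G t ` U) \<le> ennreal (?K * diameter U ^ (DIM('a) - 1))"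
  proof (rule tendsto_lowerbound)
    show "((\<lambda>\<eta>. ennreal (?K * \<eta> ^ (DIM('a) - 1))) \<longlongrightarrow> ennreal (?K * diameter U ^ (DIM('a) - 1)))
        (at_right (diameter U))"
      by (intro tendsto_ennrealI tendsto_intros)
    have "\<forall>\<^sub>F \<eta> in at_right (diameter U). \<eta> \<in> {diameter U<..<1}"
      using U by (intro eventually_at_right_real) auto
    then show "\<forall>\<^sub>F \<eta> in at_right (diameter U).
        outer_measure_of lborel (\<Union>t\<in>{0..1}. G t ` U) \<le> ennreal (?K * \<eta> ^ (DIM('a) - 1))"
    proof eventually_elim
      case (elim \<eta>)
      then have "diameter U \<le> \<eta>" "\<eta> \<le> 1" "0 < \<eta>" using diameter_ge_0[OF U(1)] by auto
      then show ?case using outer_measure_of_tube_le[OF Lip L U(1)] by blast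
    qed
  qed simp
  also have "\<dots> = ennreal ?K * ennreal (diameter U ^ (DIM('a) - 1))"
    by (rule ennreal_mult) (use L diameter_ge_0[OF U(1)] in auto)
  also have "ennreal (diameter U ^ (DIM('a) - 1)) = hausdorff_gauge (real (DIM('a) - 1)) U"
  proof -
    have "diameter U powr real (DIM('a) - 1) = diameter U ^ (DIM('a) - 1)"
      using n diameter_ge_0[OF U(1)] by (intro powr_realpow') auto
    then show ?thesis using n False by (simp add: hausdorff_gauge_def)
  qed
  finally show ?thesis .
qed (simp add: outer_measure_of_eq)

text \<open>Sums the tube bound over a cover of \<open>S\<close> at scale \<open>1 / 2\<close>, each
  covering set being cut down to \<open>S\<close>, where the Lipschitz bound holds. Applied to cones
  over subsets of the sphere and to thickened chart images of a hypersurface.\<close>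

lemma emeasure_lipschitz_tube_le:
  fixes G :: "real \<Rightarrow> 'b::metric_space \<Rightarrow> 'a::euclidean_space"
  assumes Lip: "\<And>t t' x x'. t \<in> {0..1} \<Longrightarrow> t' \<in> {0..1} \<Longrightarrow> x \<in> S \<Longrightarrow> x' \<in> S \<Longrightarrow>
      dist (G t x) (G t' x') \<le> L * (\<bar>t - t'\<bar> + dist x x')"
    and L: "0 < L" and n: "2 \<le> DIM('a)"
    and Z: "Z \<in> sets borel" "Z \<subseteq> (\<Union>t\<in>{0..1}. G t ` S)"
  shows "emeasure lborel Z \<le>
    ennreal (2 * unit_ball_vol DIM('a) * (2 * L) ^ DIM('a)) * hausdorff_outer (real (DIM('a) - 1)) S"
    (is "_ \<le> ennreal ?K * _")
proof -
  let ?k = "real (DIM('a) - 1)"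
  have K: "0 < ?K" using L by simp
  have "emeasure lborel Z \<le> ennreal ?K * (\<Sum>i. hausdorff_gauge ?k (C i))"
    if C: "S \<subseteq> (\<Union>i. C i)" "\<And>i::nat. bounded (C i)" "\<And>i. diameter (C i) \<le> 1 / 2" for C
  proof -
    let ?U = "\<lambda>i. C i \<inter> S"
    have "emeasure lborel Z = outer_measure_of lborel Z" using Z by simp
    also have "\<dots> \<le> outer_measure_of lborel (\<Union>i. \<Union>t\<in>{0..1}. G t ` ?U i)"
    proof (rule outer_measure_of_mono, rule subsetI)
      fix z assume "z \<in> Z"
      then obtain t x where tx: "t \<in> {0..1}" "x \<in> S" "z = G t x" using Z(2) by blast
      with C(1) obtain i where "x \<in> C i" by blast
      then show "z \<in> (\<Union>i. \<Union>t\<in>{0..1}. G t ` ?U i)" using tx by blast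
    qed
    also have "\<dots> \<le> (\<Sum>i. outer_measure_of lborel (\<Union>t\<in>{0..1}. G t ` ?U i))"
      by (rule outer_measure_of_countably_subadditive) simp
    also have "\<dots> \<le> (\<Sum>i. ennreal ?K * hausdorff_gauge ?k (C i))"
    proof (rule suminf_le)
      fix i
      have "outer_measure_of lborel (\<Union>t\<in>{0..1}. G t ` ?U i) \<le> ennreal ?K * hausdorff_gauge ?k (?U i)"
      proof (rule outer_measure_of_tube_le_gauge[OF Lip L _ _ n])
        show "bounded (?U i)" using C(2)[of i] by (rule bounded_Int[OF disjI1])
        show "diameter (?U i) \<le> 1 / 2"
          using diameter_subset[of "?U i" "C i"] C(2,3)[of i] by force
      qed auto
      also have "\<dots> \<le> ennreal ?K * hausdorff_gauge ?k (C i)"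
        by (intro mult_left_mono hausdorff_gauge_mono C) auto
      finally show "outer_measure_of lborel (\<Union>t\<in>{0..1}. G t ` ?U i) \<le> ennreal ?K * hausdorff_gauge ?k (C i)" .
    qed auto
    finally show ?thesis by simp
  qed
  then have "emeasure lborel Z / ennreal ?K \<le> hausdorff_content ?k (1 / 2) S"
    unfolding hausdorff_content_def
    by (intro INF_greatest divide_le_posI_ennreal) (use K in \<open>auto simp: mult.commute\<close>)
  also have "\<dots> \<le> hausdorff_outer ?k S" by (rule hausdorff_content_le_outer) simp
  finally have "ennreal ?K * (emeasure lborel Z / ennreal ?K) \<le> ennreal ?K * hausdorff_outer ?k S"
    by (rule mult_left_mono) simp
  moreover have "ennreal ?K * (emeasure lborel Z / ennreal ?K) = emeasure lborel Z"
  proof -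
    have "c * (x / c) = x" if "0 < c" "c < top" for c x :: ennreal
      using that by (simp add: mult.commute[of c] ennreal_divide_times)
    then show ?thesis using K by (metis ennreal_less_top ennreal_less_zero_iff)
  qed
  ultimately show ?thesis by simp
qed

text \<open>Both the vector and its norm move by less than \<open>\<delta> / 8\<close>, so
  \<open>norm z *\<^sub>R p\<close> and \<open>z\<close> differ by less than
  \<open>\<delta> / 4\<close>. Since \<open>norm z\<close> is at least \<open>7 / 16\<close>,
  division by it still leaves less than \<open>\<delta>\<close>.\<close>

lemma radial_image_ball:
  fixes p z :: "'a::real_normed_vector"
  assumes p: "norm p = 1" and z: "dist (t *\<^sub>R p) z < \<delta> / 8"
    and t: "1 / 2 \<le> t" "t \<le> 3 / 4" and \<delta>: "\<delta> \<le> 1 / 2"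
  shows "norm z \<in> {0<..1}" "dist p (z /\<^sub>R norm z) < \<delta>"
proof -
  have \<delta>0: "0 < \<delta>" using z le_less_trans[OF zero_le_dist z] by simp
  have d: "norm (t *\<^sub>R p - z) < \<delta> / 8" using z by (simp add: dist_norm)
  have nt: "norm (t *\<^sub>R p) = t" using p t by simp
  have zt: "\<bar>norm z - t\<bar> < \<delta> / 8"
    using d norm_triangle_ineq3[of "t *\<^sub>R p" z] unfolding nt by (simp add: abs_minus_commute)
  then have nz: "7 / 16 \<le> norm z" "norm z \<le> 1" using t \<delta> by linarith+
  then show "norm z \<in> {0<..1}" by auto
  have "norm (norm z *\<^sub>R p - z) \<le> norm ((norm z - t) *\<^sub>R p) + norm (t *\<^sub>R p - z)"
    using norm_triangle_ineq[of "(norm z - t) *\<^sub>R p" "t *\<^sub>R p - z"] by (simp add: algebra_simps)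
  also have "\<dots> < \<delta> / 4" using d zt p by simp
  also have "\<dots> < \<delta> * norm z" using nz \<delta>0 mult_left_mono[of "7/16" "norm z" \<delta>] by simp
  finally have "norm (norm z *\<^sub>R p - z) < \<delta> * norm z" .
  moreover have "dist p (z /\<^sub>R norm z) * norm z = norm (norm z *\<^sub>R p - z)"
  proof -
    have "norm z *\<^sub>R p - z = norm z *\<^sub>R (p - z /\<^sub>R norm z)"
      using nz by (cases "z = 0") (auto simp: scaleR_diff_right)
    then show ?thesis by (metis abs_norm_cancel dist_norm mult.commute norm_scaleR)
  qed
  ultimately have "dist p (z /\<^sub>R norm z) * norm z < \<delta> * norm z" by simp
  then show "dist p (z /\<^sub>R norm z) < \<delta>" using nz by (simp add: mult_less_cancel_right)
qed

text \<open>Proved by comparing the volume of the cone over \<open>W\<close> with that of disjoint balls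
  placed along the rays through the points of \<open>P\<close>.\<close>

lemma hausdorff_outer_caps_lower:
  fixes P W :: "'a::euclidean_space set"
  assumes n: "2 \<le> DIM('a)" and \<delta>: "0 < \<delta>" "\<delta> \<le> 1 / 2" and P: "finite P" "\<And>p. p \<in> P \<Longrightarrow> norm p = 1"
    and sep: "\<And>p q. p \<in> P \<Longrightarrow> q \<in> P \<Longrightarrow> p \<noteq> q \<Longrightarrow> 2 * \<delta> \<le> dist p q"
    and W: "\<And>p. p \<in> P \<Longrightarrow> sphere 0 1 \<inter> ball p \<delta> \<subseteq> W"
  shows "ennreal (1 / (4 * 16 ^ DIM('a)) * \<delta> ^ (DIM('a) - 1) * card P)
    \<le> hausdorff_outer (real (DIM('a) - 1)) W"
proof -
  \<comment> \<open>Each ray carries \<open>m + 1\<close> balls at heights between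
    \<open>1 / 2\<close> and \<open>3 / 4\<close>, whose spacing \<open>\<delta> / 2\<close> exceeds
    their diameter \<open>\<delta> / 4\<close>. Balls on different rays are disjoint because they
    are seen from the origin inside disjoint caps of radius \<open>\<delta>\<close>.\<close>
  define m where "m = nat \<lfloor>1 / (2 * \<delta>)\<rfloor>"
  define t where "t i = 1 / 2 + real i * (\<delta> / 2)" for i
  define B where "B = (\<lambda>(p :: 'a, i). ball (t i *\<^sub>R p) (\<delta> / 8))"
  let ?I = "P \<times> {..m}" and ?S = "W \<inter> sphere 0 1" and ?k = "real (DIM('a) - 1)"
  let ?v = "unit_ball_vol (real DIM('a))"
  have m: "real m \<le> 1 / (2 * \<delta>)" "1 / (2 * \<delta>) \<le> real (Suc m)"
  proof -
    have "0 \<le> \<lfloor>1 / (2 * \<delta>)\<rfloor>" using \<delta> by simp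
    then have "real m = of_int \<lfloor>1 / (2 * \<delta>)\<rfloor>" by (simp add: m_def)
    then show "real m \<le> 1 / (2 * \<delta>)" "1 / (2 * \<delta>) \<le> real (Suc m)" by linarith+
  qed
  have t: "1 / 2 \<le> t i" "i \<le> m \<Longrightarrow> t i \<le> 3 / 4" for i
  proof -
    show "1 / 2 \<le> t i" using \<delta> by (simp add: t_def)
    assume "i \<le> m"
    then have "real i \<le> 1 / (2 * \<delta>)" using m by linarith
    then have "real i * (\<delta> / 2) \<le> 1 / 4" using \<delta> by (simp add: field_simps)
    then show "t i \<le> 3 / 4" by (simp add: t_def)
  qed
  have near: "norm z \<in> {0<..1}" "dist p (z /\<^sub>R norm z) < \<delta>" if "p \<in> P" "i \<le> m" "z \<in> B (p, i)" for p i z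
    using radial_image_ball[OF P(2)[OF that(1)], of "t i" z \<delta>] t[of i] that \<delta> by (auto simp: B_def)
  have disj: "disjoint_family_on B ?I"
  proof (clarsimp simp: disjoint_family_on_def, rule ccontr)
    fix p q i j assume pq: "p \<in> P" "q \<in> P" "i \<le> m" "j \<le> m" "p = q \<longrightarrow> i \<noteq> j" "B (p, i) \<inter> B (q, j) \<noteq> {}"
    then obtain z where z: "z \<in> B (p, i)" "z \<in> B (q, j)" by blast
    have "dist p q < 2 * \<delta>"
      using near(2)[OF pq(1,3) z(1)] near(2)[OF pq(2,4) z(2)] dist_triangle2[of p q "z /\<^sub>R norm z"] by simp
    then have "p = q" using sep pq by force
    with pq have ij: "i \<noteq> j" and np: "norm p = 1" using P by auto
    have "dist (t i *\<^sub>R p) (t j *\<^sub>R p) < \<delta> / 4"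
      using z \<open>p = q\<close> dist_triangle2[of "t i *\<^sub>R p" "t j *\<^sub>R p" z] by (simp add: B_def)
    moreover have "dist (t i *\<^sub>R p) (t j *\<^sub>R p) = \<bar>real i - real j\<bar> * (\<delta> / 2)"
    proof -
      have "t i *\<^sub>R p - t j *\<^sub>R p = ((real i - real j) * (\<delta> / 2)) *\<^sub>R p"
        unfolding scaleR_left_diff_distrib[symmetric] by (simp add: t_def field_simps)
      then show ?thesis using \<delta> np by (simp add: dist_norm abs_mult)
    qed
    moreover have "1 * (\<delta> / 2) \<le> \<bar>real i - real j\<bar> * (\<delta> / 2)"
      using ij \<delta> by (intro mult_right_mono) auto
    ultimately show False using \<delta> by simp
  qed
  have "ennreal (card P * (?v * \<delta> ^ (DIM('a) - 1) / (2 * 8 ^ DIM('a)))) \<le>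
      ennreal (card P * real (Suc m) * (?v * (\<delta> / 8) ^ DIM('a)))"
  proof (intro ennreal_leI)
    have "\<delta> ^ DIM('a) = \<delta> * \<delta> ^ (DIM('a) - 1)" by (simp add: power_eq_if)
    then have "?v * \<delta> ^ (DIM('a) - 1) / (2 * 8 ^ DIM('a)) = 1 / (2 * \<delta>) * (?v * (\<delta> / 8) ^ DIM('a))"
      using \<delta> by (simp add: field_simps power_divide)
    also have "\<dots> \<le> real (Suc m) * (?v * (\<delta> / 8) ^ DIM('a))"
      using m(2) \<delta> by (intro mult_right_mono) auto
    finally show "card P * (?v * \<delta> ^ (DIM('a) - 1) / (2 * 8 ^ DIM('a))) \<le>
        card P * real (Suc m) * (?v * (\<delta> / 8) ^ DIM('a))"
      unfolding mult.assoc by (rule mult_left_mono) simp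
  qed
  also have "\<dots> = (\<Sum>x\<in>?I. ennreal (?v * (\<delta> / 8) ^ DIM('a)))"
  proof -
    have "(\<Sum>x\<in>?I. ennreal (?v * (\<delta> / 8) ^ DIM('a))) = ennreal (real (card ?I)) * ennreal (?v * (\<delta> / 8) ^ DIM('a))"
      by (simp only: sum_constant ennreal_of_nat_eq_real_of_nat)
    also have "\<dots> = ennreal (real (card ?I) * (?v * (\<delta> / 8) ^ DIM('a)))"
      using \<delta> by (intro ennreal_mult[symmetric]) auto
    also have "real (card ?I) = card P * real (Suc m)" by (simp add: card_cartesian_product algebra_simps)
    finally show ?thesis by simp
  qed
  also have "\<dots> = (\<Sum>x\<in>?I. emeasure lborel (B x))"
    using \<delta> by (intro sum.cong) (auto simp: B_def emeasure_ball)
  also have "\<dots> = emeasure lborel (\<Union>x\<in>?I. B x)"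
    using P disj by (intro sum_emeasure) (auto simp: B_def)
  \<comment> \<open>All the balls lie in the cone over the part of \<open>W\<close> on the sphere,
    and \<open>t *\<^sub>R x\<close> parametrises that cone with Lipschitz constant
    \<open>1\<close>.\<close>
  also have "\<dots> \<le> ennreal (2 * ?v * (2 * 1) ^ DIM('a)) * hausdorff_outer ?k ?S"
  proof (rule emeasure_lipschitz_tube_le[OF _ _ n, where G = "\<lambda>t x. t *\<^sub>R x"])
    fix r r' :: real and x x' :: 'a assume h: "r \<in> {0..1}" "r' \<in> {0..1}" "x \<in> ?S" "x' \<in> ?S"
    have "norm (r *\<^sub>R x - r' *\<^sub>R x') \<le> norm ((r - r') *\<^sub>R x) + norm (r' *\<^sub>R (x - x'))"
      using norm_triangle_ineq[of "(r - r') *\<^sub>R x" "r' *\<^sub>R (x - x')"] by (simp add: algebra_simps)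
    also have "\<dots> \<le> \<bar>r - r'\<bar> + 1 * norm (x - x')"
      using h mult_right_mono[of r' 1 "norm (x - x')"] by (intro add_mono) auto
    finally show "dist (r *\<^sub>R x) (r' *\<^sub>R x') \<le> 1 * (\<bar>r - r'\<bar> + dist x x')" by (simp add: dist_norm)
  next
    show "(\<Union>x\<in>?I. B x) \<subseteq> (\<Union>t\<in>{0..1}. (\<lambda>x. t *\<^sub>R x) ` ?S)"
    proof
      fix z assume "z \<in> (\<Union>x\<in>?I. B x)"
      then obtain p i where z: "z \<in> B (p, i)" "p \<in> P" "i \<le> m" by blast
      note nz = near[OF z(2,3,1)]
      have "norm (z /\<^sub>R norm z) = 1" using nz(1) by auto
      then have "z /\<^sub>R norm z \<in> sphere 0 1 \<inter> ball p \<delta>" using nz(2) by (simp del: norm_scaleR)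
      then have "z /\<^sub>R norm z \<in> ?S" using W[OF z(2)] by blast
      moreover have "norm z \<in> {0..1}" "z = norm z *\<^sub>R (z /\<^sub>R norm z)" using nz by auto
      ultimately show "z \<in> (\<Union>t\<in>{0..1}. (\<lambda>x. t *\<^sub>R x) ` ?S)" by blast
    qed
  next
    show "(\<Union>x\<in>?I. B x) \<in> sets borel"
      using P(1) by (intro sets.finite_UN) (auto simp: B_def)
  qed simp
  also have "\<dots> \<le> ennreal (2 * ?v * (2 * 1) ^ DIM('a)) * hausdorff_outer ?k W"
    by (intro mult_left_mono hausdorff_outer_mono) auto
  finally have "ennreal (card P * (?v * \<delta> ^ (DIM('a) - 1) / (2 * 8 ^ DIM('a)))) \<le>
      ennreal (2 * ?v * 2 ^ DIM('a)) * hausdorff_outer ?k W" by simp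
  \<comment> \<open>The constant \<open>1 / (4 * 16 ^ DIM('a))\<close> is the quotient of
    \<open>?v / (2 * 8 ^ DIM('a))\<close>, which comes from the balls, by
    \<open>2 * ?v * 2 ^ DIM('a)\<close>, which comes from the tube bound.\<close>
  moreover have "card P * (?v * \<delta> ^ (DIM('a) - 1) / (2 * 8 ^ DIM('a))) =
      (2 * ?v * 2 ^ DIM('a)) * (1 / (4 * 16 ^ DIM('a)) * \<delta> ^ (DIM('a) - 1) * card P)"
  proof -
    have "(16::real) ^ DIM('a) = 2 ^ DIM('a) * 8 ^ DIM('a)" by (simp flip: power_mult_distrib)
    then show ?thesis by (simp add: field_simps)
  qed
  ultimately have "ennreal (2 * ?v * 2 ^ DIM('a)) * ennreal (1 / (4 * 16 ^ DIM('a)) * \<delta> ^ (DIM('a) - 1) * card P)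
      \<le> ennreal (2 * ?v * 2 ^ DIM('a)) * hausdorff_outer ?k W"
    using \<delta> by (simp add: ennreal_mult[symmetric])
  moreover have "0 < 2 * ?v * 2 ^ DIM('a)" by simp
  ultimately show ?thesis
    by (subst (asm) ennreal_mult_le_mult_iff) (simp_all only: ennreal_eq_0_iff not_le ennreal_neq_top not_False_eq_True)
qed

section \<open>Local structure of hypersurfaces\<close>

text \<open>\<open>Ck_on\<close> provides continuity of the derivative along each fixed vector. The
  finitely many basis vectors make it uniform over all directions, and the mean value inequality for
  \<open>f\<close> minus its linear part at \<open>a\<close> then controls chords.\<close>

lemma C1_strictly_differentiable:
  fixes f :: "'a::euclidean_space \<Rightarrow> 'b::real_normed_vector"
  assumes U: "open U" "a \<in> U" and der: "\<And>x. x \<in> U \<Longrightarrow> (f has_derivative f' x) (at x)"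
    and cont: "\<And>v. continuous_on U (\<lambda>x. f' x v)" and \<epsilon>: "0 < \<epsilon>"
  obtains R where "0 < R" "ball a R \<subseteq> U"
    "\<And>x v. x \<in> ball a R \<Longrightarrow> norm (f' x v - f' a v) \<le> \<epsilon> * norm v"
    "\<And>x y. x \<in> ball a R \<Longrightarrow> y \<in> ball a R \<Longrightarrow> norm (f x - f y - f' a (x - y)) \<le> \<epsilon> * norm (x - y)"
proof -
  let ?e = "\<epsilon> / DIM('a)"
  have e: "0 < ?e" using \<epsilon> by simp
  have "\<forall>\<^sub>F x in nhds a. x \<in> U \<and> (\<forall>b\<in>Basis. dist (f' x b) (f' a b) < ?e)"
  proof (intro eventually_conj eventually_ball_finite ballI)
    show "\<forall>\<^sub>F x in nhds a. x \<in> U" using U by (rule eventually_nhds_in_open)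
    fix b :: 'a
    have "isCont (\<lambda>x. f' x b) a"
      using cont U by (simp add: continuous_on_eq_continuous_at)
    then have "((\<lambda>x. f' x b) \<longlongrightarrow> f' a b) (nhds a)"
      unfolding continuous_at using tendsto_at_iff_tendsto_nhds[of "\<lambda>x. f' x b" a] by simp
    then show "\<forall>\<^sub>F x in nhds a. dist (f' x b) (f' a b) < ?e" using e by (rule tendstoD)
  qed simp
  then obtain R where R: "0 < R" "\<And>x. dist x a < R \<Longrightarrow> x \<in> U \<and> (\<forall>b\<in>Basis. dist (f' x b) (f' a b) < ?e)"
    unfolding eventually_nhds_metric by blast
  have RU: "ball a R \<subseteq> U" using R(2) by (auto simp: dist_commute)
  have lin: "linear (f' x)" if "x \<in> U" for x using der[OF that] has_derivative_linear by blast
  have near: "norm (f' x v - f' a v) \<le> \<epsilon> * norm v" if x: "x \<in> ball a R" for x v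
  proof -
    have exp: "f' y v = (\<Sum>b\<in>Basis. (v \<bullet> b) *\<^sub>R f' y b)" if "y \<in> U" for y
    proof -
      have "f' y v = f' y (\<Sum>b\<in>Basis. (v \<bullet> b) *\<^sub>R b)" by (simp add: euclidean_representation)
      also have "\<dots> = (\<Sum>b\<in>Basis. (v \<bullet> b) *\<^sub>R f' y b)"
        by (simp add: linear_sum[OF lin[OF that]] linear_scale[OF lin[OF that]])
      finally show ?thesis .
    qed
    have xU: "x \<in> U" using x RU by blast
    have "f' x v - f' a v = (\<Sum>b\<in>Basis. (v \<bullet> b) *\<^sub>R (f' x b - f' a b))"
      unfolding exp[OF xU] exp[OF U(2)] by (simp add: sum_subtractf scaleR_diff_right)
    also have "norm \<dots> \<le> (\<Sum>b\<in>(Basis::'a set). norm v * ?e)"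
    proof (rule sum_norm_le)
      fix b :: 'a assume b: "b \<in> Basis"
      have "norm (f' x b - f' a b) \<le> ?e"
      proof -
        have "dist x a < R" using x by (simp add: dist_commute)
        with R(2) b have "dist (f' x b) (f' a b) < ?e" by blast
        then show ?thesis by (simp add: dist_norm)
      qed
      then show "norm ((v \<bullet> b) *\<^sub>R (f' x b - f' a b)) \<le> norm v * ?e"
        unfolding norm_scaleR real_norm_def by (intro mult_mono Basis_le_norm b) auto
    qed
    also have "\<dots> = \<epsilon> * norm v" by simp
    finally show ?thesis .
  qed
  have "norm (f x - f y - f' a (x - y)) \<le> \<epsilon> * norm (x - y)" if "x \<in> ball a R" "y \<in> ball a R" for x y
  proof -
    have bl: "bounded_linear (f' a)" using der[OF U(2)] has_derivative_bounded_linear by blast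
    have "norm ((f x - f' a x) - (f y - f' a y)) \<le> \<epsilon> * norm (x - y)"
    proof (rule differentiable_bound[where S = "ball a R" and f' = "\<lambda>x v. f' x v - f' a v"])
      fix z assume z: "z \<in> ball a R"
      then have "(f has_derivative f' z) (at z within ball a R)"
        using der RU has_derivative_at_withinI by blast
      moreover have "(f' a has_derivative f' a) (at z within ball a R)"
        by (rule bounded_linear_imp_has_derivative[OF bl])
      ultimately show "((\<lambda>x. f x - f' a x) has_derivative (\<lambda>v. f' z v - f' a v)) (at z within ball a R)"
        by (rule has_derivative_diff)
      show "onorm (\<lambda>v. f' z v - f' a v) \<le> \<epsilon>"
        using near[OF z] by (intro onorm_bound) (use \<epsilon> in auto)
    qed (use that in auto)
    then show ?thesis by (simp add: linear_diff[OF lin[OF U(2)]] algebra_simps)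
  qed
  with R(1) RU near show ?thesis by (rule that)
qed

text \<open>For the last claim: differentiating \<open>\<phi> \<circ> g = id\<close> at
  \<open>\<phi> x\<close> shows that the derivative of \<open>g\<close> sends \<open>u\<close> to a
  vector that the derivative of \<open>\<phi>\<close> sends back to \<open>u\<close>. Hence the
  functional whose kernel enters \<open>tangent_space\<close> is nonzero.\<close>

lemma slice_chart_derivative:
  fixes \<phi> :: "'a::euclidean_space \<Rightarrow> 'a"
  assumes "slice_chart S U \<phi> u"
  shows "open U"
    and "x \<in> U \<Longrightarrow> (\<phi> has_derivative frechet_derivative \<phi> (at x)) (at x)"
    and "continuous_on U (\<lambda>x. frechet_derivative \<phi> (at x) v)"
    and "x \<in> S \<Longrightarrow> x \<in> U \<Longrightarrow> \<phi> x \<bullet> u = 0"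
    and "x \<in> U \<Longrightarrow> \<exists>v. frechet_derivative \<phi> (at x) v \<bullet> u = 1"
proof -
  obtain V g where u: "norm u = 1" and diff: "diffeomorphism_on U V \<phi> g"
    and img: "\<phi> ` (S \<inter> U) \<subseteq> {y. y \<bullet> u = 0}"
    using assms unfolding slice_chart_def by blast
  then have U: "open U" and V: "open V" and hom: "homeomorphism U V \<phi> g"
    and C1: "Ck_on 1 U \<phi>" "Ck_on 1 V g"
    unfolding diffeomorphism_on_def smooth_on_def by blast+
  show "open U" by (rule U)
  have der: "(\<phi> has_derivative frechet_derivative \<phi> (at x)) (at x)" if "x \<in> U" for x
    using C1(1) that by (simp add: frechet_derivative_works[symmetric])
  show "x \<in> U \<Longrightarrow> (\<phi> has_derivative frechet_derivative \<phi> (at x)) (at x)" by (rule der)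
  show "continuous_on U (\<lambda>x. frechet_derivative \<phi> (at x) v)"
    using C1(1) by simp
  show "x \<in> S \<Longrightarrow> x \<in> U \<Longrightarrow> \<phi> x \<bullet> u = 0" using img by blast
  assume x: "x \<in> U"
  let ?y = "\<phi> x" and ?g' = "frechet_derivative g (at (\<phi> x))"
  have y: "?y \<in> V" "g ?y = x" using hom x by (auto simp: homeomorphism_def)
  have "(g has_derivative ?g') (at ?y)"
    using C1(2) y by (simp add: frechet_derivative_works[symmetric])
  then have "(\<phi> \<circ> g has_derivative frechet_derivative \<phi> (at x) \<circ> ?g') (at ?y)"
    using der[OF x] y by (intro diff_chain_at) auto
  then have "((\<lambda>z. z) has_derivative frechet_derivative \<phi> (at x) \<circ> ?g') (at ?y)"
  proof (rule has_derivative_transform_within_open[OF _ V y(1)])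
    fix z assume "z \<in> V"
    then show "(\<phi> \<circ> g) z = z" using hom by (auto simp: homeomorphism_def)
  qed
  then have "frechet_derivative \<phi> (at x) \<circ> ?g' = (\<lambda>z. z)"
    by (rule has_derivative_unique) (rule has_derivative_ident)
  then have "frechet_derivative \<phi> (at x) (?g' u) \<bullet> u = 1"
    using u by (simp add: fun_eq_iff norm_eq_1)
  then show "\<exists>v. frechet_derivative \<phi> (at x) v \<bullet> u = 1" by blast
qed

lemma linear_functional_representation:
  fixes l :: "'a::euclidean_space \<Rightarrow> real"
  assumes "linear l"
  obtains G where "\<And>v. l v = G \<bullet> v"
proof
  fix v
  have "l v = adjoint l 1 \<bullet> v"
    using adjoint_works[OF assms, of v 1] by (simp add: inner_commute)
  then show "l v = adjoint l 1 \<bullet> v" .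
qed

text \<open>\<open>N\<close> is the unit normal of \<open>S\<close> at \<open>a\<close>; the last fact says that the distance of \<open>z\<close> from the
  affine tangent plane at a nearby point \<open>x\<close> is nearly bounded by the component of \<open>z - x\<close> along \<open>N\<close>.\<close>

lemma smooth_hypersurface_local_normal:
  fixes S :: "'a::euclidean_space set"
  assumes S: "smooth_hypersurface S" and a: "a \<in> S" and \<epsilon>: "0 < \<epsilon>"
  obtains R N where "0 < R" "norm N = 1"
    "\<And>x y. x \<in> S \<inter> ball a R \<Longrightarrow> y \<in> S \<inter> ball a R \<Longrightarrow> \<bar>N \<bullet> (x - y)\<bar> \<le> \<epsilon> * norm (x - y)"
    "\<And>x z \<eta>. x \<in> S \<inter> ball a R \<Longrightarrow> \<forall>v\<in>tangent_space S x. \<eta> \<le> norm (x + v - z) \<Longrightarrow>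
      \<eta> - \<epsilon> * norm (z - x) \<le> \<bar>N \<bullet> (z - x)\<bar>"
proof -
  obtain U \<phi> u where aU: "a \<in> U" and ch: "slice_chart S U \<phi> u"
    using S a unfolding smooth_hypersurface_def by blast
  note ch' = slice_chart_derivative[OF ch]
  let ?D = "\<lambda>x. frechet_derivative \<phi> (at x)"
  have u: "norm u = 1" using ch by (simp add: slice_chart_def)
  have linD: "linear (\<lambda>v. ?D x v \<bullet> u)" if "x \<in> U" for x
  proof -
    have l: "linear (?D x)" using ch'(2)[OF that] has_derivative_linear by blast
    show ?thesis
      by (rule linearI) (simp_all add: linear_add[OF l] linear_scale[OF l] inner_left_distrib)
  qed
  have "\<forall>x. \<exists>G. x \<in> U \<longrightarrow> (\<forall>v. ?D x v \<bullet> u = G \<bullet> v)"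
    using linear_functional_representation[OF linD] by metis
  \<comment> \<open>\<open>G x\<close> is the gradient at \<open>x\<close> of the local defining
    function \<open>\<phi> \<bullet> u\<close>, hence normal to \<open>S\<close> at points of
    \<open>S\<close>; \<open>N\<close> is its normalisation at \<open>a\<close>.\<close>
  then obtain G where G: "\<And>x v. x \<in> U \<Longrightarrow> ?D x v \<bullet> u = G x \<bullet> v" by metis
  define m where "m = norm (G a)"
  define N where "N = G a /\<^sub>R m"
  have G0: "G x \<noteq> 0" if "x \<in> U" for x
    using ch'(5)[OF that] G[OF that] by force
  then have m: "0 < m" using aU by (simp add: m_def)
  have N: "norm N = 1" using m by (simp add: N_def m_def)
  have Nv: "N \<bullet> v = (?D a v \<bullet> u) / m" for v
    using m by (simp add: N_def G[OF aU] divide_inverse mult.commute)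
  \<comment> \<open>Half of \<open>\<epsilon> * m\<close>, because \<open>plane\<close> pays
    \<open>e\<close> twice: for replacing \<open>G x\<close> by \<open>G a\<close> in the inner
    product and in the norm.\<close>
  define e where "e = \<epsilon> * m / 2"
  have e: "0 < e" using \<epsilon> m by (simp add: e_def)
  obtain R where R: "0 < R" "ball a R \<subseteq> U"
    "\<And>x v. x \<in> ball a R \<Longrightarrow> norm (?D x v - ?D a v) \<le> e * norm v"
    "\<And>x y. x \<in> ball a R \<Longrightarrow> y \<in> ball a R \<Longrightarrow> norm (\<phi> x - \<phi> y - ?D a (x - y)) \<le> e * norm (x - y)"
    by (rule C1_strictly_differentiable[where f' = "\<lambda>x. frechet_derivative \<phi> (at x)", OF ch'(1) aU ch'(2,3) e])
      (assumption, rule that)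
  have chord: "\<bar>N \<bullet> (x - y)\<bar> \<le> \<epsilon> * norm (x - y)" if "x \<in> S \<inter> ball a R" "y \<in> S \<inter> ball a R" for x y
  proof -
    have "\<phi> x \<bullet> u = 0" "\<phi> y \<bullet> u = 0" using that R(2) by (auto intro!: ch'(4))
    then have "\<bar>?D a (x - y) \<bullet> u\<bar> = \<bar>(\<phi> x - \<phi> y - ?D a (x - y)) \<bullet> u\<bar>"
      by (simp add: inner_diff_left)
    also have "\<dots> \<le> norm (\<phi> x - \<phi> y - ?D a (x - y))"
      using Cauchy_Schwarz_ineq2[of "\<phi> x - \<phi> y - ?D a (x - y)" u] u by simp
    also have "\<dots> \<le> e * norm (x - y)" using R(4) that by blast
    also have "\<dots> \<le> \<epsilon> * m * norm (x - y)" using \<epsilon> m by (simp add: e_def)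
    finally show ?thesis using m by (simp add: Nv field_simps)
  qed
  have plane: "\<eta> - \<epsilon> * norm (z - x) \<le> \<bar>N \<bullet> (z - x)\<bar>"
    if x: "x \<in> S \<inter> ball a R" and T: "\<And>v. v \<in> tangent_space S x \<Longrightarrow> \<eta> \<le> norm (x + v - z)" for x z \<eta>
  proof -
    have xU: "x \<in> U" using x R(2) by blast
    have ker: "v \<in> tangent_space S x" if "G x \<bullet> v = 0" for v
    proof -
      have "?D x v \<bullet> u = 0" using that by (simp add: G[OF xU])
      then show ?thesis using ch x xU unfolding tangent_space_def by blast
    qed
    have \<eta>: "\<eta> \<le> norm (z - x)" using T[OF ker[of 0]] by (simp add: norm_minus_commute)
    have Gdiff: "\<bar>(G x - G a) \<bullet> v\<bar> \<le> e * norm v" for v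
    proof -
      have "(G x - G a) \<bullet> v = (?D x v - ?D a v) \<bullet> u" by (simp add: inner_diff_left G[OF aU] G[OF xU])
      also have "\<bar>\<dots>\<bar> \<le> norm (?D x v - ?D a v)"
        using Cauchy_Schwarz_ineq2[of "?D x v - ?D a v" u] u by simp
      also have "\<dots> \<le> e * norm v" using R(3) x by blast
      finally show ?thesis .
    qed
    have "norm (G x - G a) \<le> e"
    proof (cases "G x = G a")
      case False
      have "norm (G x - G a) * norm (G x - G a) \<le> e * norm (G x - G a)"
        using Gdiff[of "G x - G a"] by (simp add: power2_norm_eq_inner[symmetric] power2_eq_square[symmetric])
      then show ?thesis using False by simp
    qed (use e in simp)
    then have Gx: "m - e \<le> norm (G x)"
      unfolding m_def using norm_triangle_ineq3[of "G x" "G a"] by linarith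
    \<comment> \<open>Removing \<open>c *\<^sub>R G x\<close> projects \<open>z - x\<close> onto the
      kernel of \<open>G x\<close>; added to \<open>x\<close>, this is the foot of the perpendicular
      from \<open>z\<close> to the tangent plane at \<open>x\<close>.\<close>
    define c where "c = ((z - x) \<bullet> G x) / (norm (G x))\<^sup>2"
    have n0: "norm (G x) \<noteq> 0" using G0[OF xU] by simp
    have "G x \<bullet> ((z - x) - c *\<^sub>R G x) = 0"
      using n0 by (simp add: inner_diff_right c_def power2_norm_eq_inner inner_commute)
    from T[OF ker[OF this]] have "\<eta> \<le> norm (c *\<^sub>R G x)" by (simp add: algebra_simps)
    also have "\<dots> = \<bar>G x \<bullet> (z - x)\<bar> / norm (G x)"
      using n0 by (simp add: c_def power2_eq_square inner_commute)
    finally have "\<eta> * norm (G x) \<le> \<bar>G x \<bullet> (z - x)\<bar>" using n0 by (simp add: pos_le_divide_eq)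
    also have "\<dots> \<le> \<bar>G a \<bullet> (z - x)\<bar> + e * norm (z - x)"
      using Gdiff[of "z - x"] by (simp add: inner_diff_left)
    finally have 1: "\<eta> * norm (G x) \<le> \<bar>G a \<bullet> (z - x)\<bar> + e * norm (z - x)" .
    have "m * (\<eta> - \<epsilon> * norm (z - x)) \<le> \<bar>G a \<bullet> (z - x)\<bar>"
    proof (cases "0 \<le> \<eta>")
      case True
      then have "\<eta> * (m - e) \<le> \<eta> * norm (G x)" using Gx by (rule mult_left_mono[rotated])
      moreover have "\<eta> * e \<le> norm (z - x) * e" using \<eta> e by (intro mult_right_mono) auto
      moreover have "m * (\<eta> - \<epsilon> * norm (z - x)) = \<eta> * (m - e) + \<eta> * e - 2 * (norm (z - x) * e)"
        by (simp add: e_def algebra_simps)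
      ultimately show ?thesis using 1 by (simp add: mult.commute[of e])
    next
      case False
      then have "m * (\<eta> - \<epsilon> * norm (z - x)) \<le> 0"
        using m \<epsilon> by (intro mult_nonneg_nonpos) (auto intro: order_trans[of _ 0])
      then show ?thesis by simp
    qed
    then show ?thesis
      using m by (simp add: Nv G[OF aU] field_simps)
  qed
  show ?thesis by (rule that[OF R(1) N chord plane]) (assumption | blast)+
qed

text \<open>The chart image of \<open>S\<close> near a point, thickened in the direction
  \<open>u\<close>, contains a ball; the tube bound compares the volume of this ball with the
  measure of \<open>S\<close>.\<close>

lemma smooth_hypersurface_hausdorff_pos:
  fixes S :: "'a::euclidean_space set"
  assumes S: "smooth_hypersurface S" "S \<noteq> {}" and n: "2 \<le> DIM('a)"
  shows "0 < hausdorff_outer (real (DIM('a) - 1)) S"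
proof -
  obtain a where a: "a \<in> S" using S by blast
  obtain U \<phi> u where aU: "a \<in> U" and ch: "slice_chart S U \<phi> u"
    using S a unfolding smooth_hypersurface_def by blast
  note ch' = slice_chart_derivative[OF ch]
  \<comment> \<open>\<open>w = 0\<close> encodes an interior chart, a unit vector \<open>w\<close> a
    boundary chart, so that both cases share one description of the image.\<close>
  obtain V g w where u: "norm u = 1" and diff: "diffeomorphism_on U V \<phi> g"
    and w: "w = 0 \<or> norm w = 1" "w \<bullet> u = 0"
    and img: "\<phi> ` (S \<inter> U) = {y \<in> V. y \<bullet> u = 0 \<and> y \<bullet> w \<ge> 0}"
  proof -
    obtain V g where "norm u = 1" "diffeomorphism_on U V \<phi> g" and
      alt: "\<phi> ` (S \<inter> U) = {y \<in> V. y \<bullet> u = 0} \<or>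
         (\<exists>w. norm w = 1 \<and> w \<bullet> u = 0 \<and> \<phi> ` (S \<inter> U) = {y \<in> V. y \<bullet> u = 0 \<and> y \<bullet> w \<ge> 0})"
      using ch unfolding slice_chart_def by blast
    with alt show ?thesis
      using that[of V g 0] that by (elim disjE) auto
  qed
  have V: "open V" and hom: "homeomorphism U V \<phi> g"
    using diff unfolding diffeomorphism_on_def by blast+
  let ?D = "frechet_derivative \<phi> (at a)"
  obtain R where R: "0 < R" "ball a R \<subseteq> U"
    "\<And>x y. x \<in> ball a R \<Longrightarrow> y \<in> ball a R \<Longrightarrow> norm (\<phi> x - \<phi> y - ?D (x - y)) \<le> 1 * norm (x - y)"
    by (rule C1_strictly_differentiable[where f' = "\<lambda>x. frechet_derivative \<phi> (at x)", OF ch'(1) aU ch'(2,3) zero_less_one])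
      (assumption, rule that)
  have blD: "bounded_linear ?D" using ch'(2)[OF aU] has_derivative_bounded_linear by blast
  define L where "L = onorm ?D + 1"
  have L: "1 \<le> L" using onorm_pos_le[OF blD] by (simp add: L_def)
  have Lip: "norm (\<phi> x - \<phi> y) \<le> L * norm (x - y)" if "x \<in> ball a R" "y \<in> ball a R" for x y
    using R(3)[OF that] onorm[OF blD, of "x - y"] norm_triangle_ineq[of "\<phi> x - \<phi> y - ?D (x - y)" "?D (x - y)"]
    by (simp add: L_def algebra_simps)
  have y0: "\<phi> a \<in> V" "g (\<phi> a) = a" "\<phi> a \<bullet> u = 0" "0 \<le> \<phi> a \<bullet> w"
    using hom aU a img by (auto simp: homeomorphism_def)
  have "isCont g (\<phi> a)"
    using hom V y0(1) by (simp add: homeomorphism_def continuous_on_eq_continuous_at)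
  then have "\<forall>\<^sub>F y in nhds (\<phi> a). dist (g y) (g (\<phi> a)) < R"
    unfolding continuous_at tendsto_at_iff_tendsto_nhds using R(1) by (rule tendstoD)
  moreover have "\<forall>\<^sub>F y in nhds (\<phi> a). y \<in> V" using V y0(1) by (rule eventually_nhds_in_open)
  ultimately have "\<forall>\<^sub>F y in nhds (\<phi> a). dist (g y) (g (\<phi> a)) < R \<and> y \<in> V" by (rule eventually_conj)
  then obtain r0 where r0: "0 < r0" "\<And>y. dist y (\<phi> a) < r0 \<Longrightarrow> dist (g y) a < R \<and> y \<in> V"
    unfolding eventually_nhds_metric y0(2) by blast
  define r where "r = min r0 1"
  have r: "0 < r" "r \<le> 1" "r \<le> r0" using r0(1) by (auto simp: r_def)
  \<comment> \<open>The shift along \<open>w\<close> keeps a ball of radius \<open>r / 8\<close>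
    inside the half-space of a boundary chart. The shift along \<open>u\<close> puts the heights
    \<open>t\<close> between \<open>r / 8\<close> and \<open>3 * r / 8\<close>, inside the parameter
    interval.\<close>
  define c where "c = \<phi> a + (r / 2) *\<^sub>R w + (r / 4) *\<^sub>R u"
  let ?S = "S \<inter> ball a R" and ?k = "real (DIM('a) - 1)"
  have sub: "ball c (r / 8) \<subseteq> (\<Union>t\<in>{0..1}. (\<lambda>x. \<phi> x + t *\<^sub>R u) ` ?S)"
  proof
    fix z assume "z \<in> ball c (r / 8)"
    then have z: "norm (z - c) < r / 8" by (simp add: dist_norm norm_minus_commute)
    define t where "t = (z - \<phi> a) \<bullet> u"
    have uu: "u \<bullet> u = 1" using u by (simp add: norm_eq_1)
    have "t - r / 4 = (z - c) \<bullet> u"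
      by (simp add: t_def c_def inner_diff_left inner_add_left w(2) uu)
    then have t: "\<bar>t - r / 4\<bar> < r / 8"
      using Cauchy_Schwarz_ineq2[of "z - c" u] u z by simp
    define y where "y = z - t *\<^sub>R u"
    have nw: "norm w \<le> 1" using w(1) by auto
    have yeq: "y - \<phi> a = (z - c) + (r / 2) *\<^sub>R w + (r / 4 - t) *\<^sub>R u"
      by (simp add: y_def c_def algebra_simps)
    have "norm (y - \<phi> a) \<le> norm (z - c) + norm ((r / 2) *\<^sub>R w) + norm ((r / 4 - t) *\<^sub>R u)"
      unfolding yeq using norm_triangle_ineq[of "(z - c) + (r / 2) *\<^sub>R w" "(r / 4 - t) *\<^sub>R u"]
        norm_triangle_ineq[of "z - c" "(r / 2) *\<^sub>R w"] by linarith
    also have "\<dots> < r / 8 + r / 2 + r / 8"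
    proof -
      have "norm ((r / 2) *\<^sub>R w) \<le> r / 2"
        using mult_left_mono[OF nw, of "r / 2"] r(1) by simp
      moreover have "norm ((r / 4 - t) *\<^sub>R u) < r / 8" using t u by (simp add: abs_minus_commute)
      ultimately show ?thesis using z by linarith
    qed
    also have "\<dots> < r0" using r by simp
    finally have yV: "dist (g y) a < R" "y \<in> V" using r0(2)[of y] by (auto simp: dist_norm)
    have yu: "y \<bullet> u = 0" using y0(3) by (simp add: y_def t_def inner_diff_left uu)
    have "y \<bullet> w = \<phi> a \<bullet> w + ((z - c) \<bullet> w + (r / 2) * (w \<bullet> w))"
      by (simp add: y_def c_def inner_diff_left inner_add_left inner_commute[of u w] w(2))
    moreover have "0 \<le> (z - c) \<bullet> w + (r / 2) * (w \<bullet> w)"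
    proof (cases "w = 0")
      case False
      then have "norm w = 1" "w \<bullet> w = 1" using w(1) by (auto simp: norm_eq_1)
      then show ?thesis using Cauchy_Schwarz_ineq2[of "z - c" w] z r by simp
    qed simp
    ultimately have "y \<in> \<phi> ` (S \<inter> U)" unfolding img using yV yu y0(4) by simp
    then obtain x where x: "x \<in> S" "x \<in> U" "y = \<phi> x" by blast
    then have "g y = x" using hom by (auto simp: homeomorphism_def)
    then have "x \<in> ?S" using x yV by (simp add: dist_commute)
    moreover have "z = \<phi> x + t *\<^sub>R u" using x by (simp add: y_def algebra_simps)
    moreover have "t \<in> {0..1}" using t r by (auto simp: abs_if split: if_splits)
    ultimately show "z \<in> (\<Union>t\<in>{0..1}. (\<lambda>x. \<phi> x + t *\<^sub>R u) ` ?S)" by blast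
  qed
  have "0 < emeasure lborel (ball c (r / 8))"
    using r by (simp add: emeasure_ball)
  also have "\<dots> \<le> ennreal (2 * unit_ball_vol (real DIM('a)) * (2 * L) ^ DIM('a)) * hausdorff_outer ?k ?S"
  proof (rule emeasure_lipschitz_tube_le[OF _ _ n _ sub])
    fix t t' :: real and x x' assume h: "x \<in> ?S" "x' \<in> ?S"
    have "norm (\<phi> x + t *\<^sub>R u - (\<phi> x' + t' *\<^sub>R u)) \<le> norm (\<phi> x - \<phi> x') + norm ((t - t') *\<^sub>R u)"
      using norm_triangle_ineq[of "\<phi> x - \<phi> x'" "(t - t') *\<^sub>R u"] by (simp add: algebra_simps)
    also have "\<dots> \<le> L * norm (x - x') + L * \<bar>t - t'\<bar>"
      using h L u mult_right_mono[OF L, of "\<bar>t - t'\<bar>"] by (intro add_mono Lip) auto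
    finally show "dist (\<phi> x + t *\<^sub>R u) (\<phi> x' + t' *\<^sub>R u) \<le> L * (\<bar>t - t'\<bar> + dist x x')"
      by (simp add: dist_norm algebra_simps)
  qed (use L in auto)
  finally have "0 < hausdorff_outer ?k ?S" by (simp add: ennreal_zero_less_mult_iff)
  also have "\<dots> \<le> hausdorff_outer ?k S" by (rule hausdorff_outer_mono) auto
  finally show ?thesis .
qed

section \<open>Nearly flat patches of the surface\<close>

lemma hausdorff_gauge_le_power:
  assumes "bounded U" "diameter U \<le> \<eta>" "1 \<le> k"
  shows "hausdorff_gauge (real k) U \<le> ennreal (\<eta> ^ k)"
proof -
  have "diameter U powr real k = diameter U ^ k"
    using assms diameter_ge_0[OF assms(1)] by (intro powr_realpow') auto
  then show ?thesis
    using assms diameter_ge_0[OF assms(1)] by (auto simp: hausdorff_gauge_def intro!: ennreal_leI power_mono)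
qed

text \<open>Every secant of \<open>Q\<close> makes an angle of sine at most
  \<open>\<epsilon>\<close> with the hyperplane orthogonal to \<open>N\<close>. Phrased by chords,
  the condition passes to arbitrary subsets.\<close>

definition flat_in :: "real \<Rightarrow> 'a::real_inner \<Rightarrow> 'a set \<Rightarrow> bool" where
  "flat_in \<epsilon> N Q \<longleftrightarrow> norm N = 1 \<and> (\<forall>x\<in>Q. \<forall>y\<in>Q. \<bar>N \<bullet> (x - y)\<bar> \<le> \<epsilon> * norm (x - y))"

text \<open>A flat set is a Lipschitz graph over the hyperplane of the coordinates other than \<open>b\<close>.\<close>

lemma flat_in_graph:
  fixes N :: "'a::euclidean_space"
  assumes "flat_in \<epsilon> N Q" and \<epsilon>: "0 \<le> \<epsilon>" "\<epsilon> \<le> 1 / (2 * DIM('a))"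
  obtains b where "b \<in> Basis"
    "\<And>x y. x \<in> Q \<Longrightarrow> y \<in> Q \<Longrightarrow> norm (x - y) \<le> 5 * real DIM('a) * (\<Sum>j\<in>Basis - {b}. \<bar>(x - y) \<bullet> j\<bar>)"
proof -
  let ?D = "real DIM('a)"
  have N: "norm N = 1" and flat: "\<And>x y. x \<in> Q \<Longrightarrow> y \<in> Q \<Longrightarrow> \<bar>N \<bullet> (x - y)\<bar> \<le> \<epsilon> * norm (x - y)"
    using assms(1) by (auto simp: flat_in_def)
  have D: "1 \<le> ?D" by (simp add: Suc_leI)
  \<comment> \<open>A unit vector has a coordinate of size at least \<open>1 / DIM('a)\<close>, and
    \<open>Q\<close> is a graph over the others. The bound on \<open>\<epsilon>\<close> leaves half
    of this coordinate once the flatness error is absorbed.\<close>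
  have "\<exists>b\<in>Basis. 1 / ?D \<le> \<bar>N \<bullet> b\<bar>"
  proof (rule ccontr)
    assume "\<not> ?thesis"
    then have "(\<Sum>b\<in>(Basis::'a set). \<bar>N \<bullet> b\<bar>) < (\<Sum>b\<in>(Basis::'a set). 1 / ?D)"
      by (intro sum_strict_mono) (auto simp: not_le)
    then show False using norm_le_l1[of N] N by simp
  qed
  then obtain b where b: "b \<in> Basis" "1 / ?D \<le> \<bar>N \<bullet> b\<bar>" by blast
  have "norm (x - y) \<le> 5 * ?D * (\<Sum>j\<in>Basis - {b}. \<bar>(x - y) \<bullet> j\<bar>)" if xy: "x \<in> Q" "y \<in> Q" for x y
  proof -
    define d where "d = x - y"
    define T where "T = (\<Sum>j\<in>Basis - {b}. \<bar>d \<bullet> j\<bar>)"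
    have T: "0 \<le> T" by (simp add: T_def sum_nonneg)
    have nd: "norm d \<le> \<bar>d \<bullet> b\<bar> + T"
      using norm_le_l1[of d] b(1) by (simp add: T_def sum.remove)
    have "N \<bullet> d = (N \<bullet> b) * (d \<bullet> b) + (\<Sum>j\<in>Basis - {b}. (N \<bullet> j) * (d \<bullet> j))"
      using b(1) by (simp add: euclidean_inner[of N d] sum.remove)
    moreover have "\<bar>\<Sum>j\<in>Basis - {b}. (N \<bullet> j) * (d \<bullet> j)\<bar> \<le> T"
      unfolding T_def
    proof (rule order_trans[OF sum_abs sum_mono])
      fix j assume j: "j \<in> Basis - {b}"
      then have "\<bar>N \<bullet> j\<bar> \<le> 1" using Basis_le_norm[of j N] N by simp
      then show "\<bar>(N \<bullet> j) * (d \<bullet> j)\<bar> \<le> \<bar>d \<bullet> j\<bar>"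
        using mult_right_mono[of "\<bar>N \<bullet> j\<bar>" 1 "\<bar>d \<bullet> j\<bar>"] by (simp add: abs_mult)
    qed
    ultimately have "\<bar>N \<bullet> b\<bar> * \<bar>d \<bullet> b\<bar> \<le> \<bar>N \<bullet> d\<bar> + T" by (simp add: abs_mult[symmetric])
    also have "\<dots> \<le> \<epsilon> * norm d + T" using flat[OF xy] by (simp add: d_def)
    also have "\<epsilon> * norm d \<le> 1 / (2 * ?D) * (\<bar>d \<bullet> b\<bar> + T)"
      using \<epsilon> nd by (intro mult_mono) auto
    finally have "\<bar>N \<bullet> b\<bar> * \<bar>d \<bullet> b\<bar> \<le> 1 / (2 * ?D) * (\<bar>d \<bullet> b\<bar> + T) + T" by simp
    moreover have "1 / ?D * \<bar>d \<bullet> b\<bar> \<le> \<bar>N \<bullet> b\<bar> * \<bar>d \<bullet> b\<bar>" using b(2) by (rule mult_right_mono) simp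
    ultimately have "1 / ?D * \<bar>d \<bullet> b\<bar> \<le> 1 / (2 * ?D) * (\<bar>d \<bullet> b\<bar> + T) + T" by (rule order_trans[rotated])
    then have "?D * (1 / ?D * \<bar>d \<bullet> b\<bar>) \<le> ?D * (1 / (2 * ?D) * (\<bar>d \<bullet> b\<bar> + T) + T)"
      by (rule mult_left_mono) simp
    then have "\<bar>d \<bullet> b\<bar> \<le> (\<bar>d \<bullet> b\<bar> + T) / 2 + ?D * T"
      using D by (simp add: distrib_left add_divide_distrib)
    then have "\<bar>d \<bullet> b\<bar> \<le> T + 2 * (?D * T)" by (simp add: field_simps)
    moreover have "T \<le> ?D * T" using D T mult_right_mono[of 1 ?D T] by simp
    ultimately show ?thesis
      using nd T by (simp add: T_def[symmetric] d_def[symmetric])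
  qed
  with b(1) show ?thesis by (rule that)
qed

text \<open>A grid of mesh \<open>r / m\<close> in the coordinates other than \<open>b\<close> has
  at most \<open>(2 * m + 1) ^ (DIM('a) - 1)\<close> relevant cells, and by the graph property the
  part of \<open>Q\<close> over a cell has diameter of order \<open>r / m\<close>. The resulting
  total is bounded independently of \<open>m\<close>, hence at every covering scale.\<close>

lemma flat_in_hausdorff_le:
  fixes N :: "'a::euclidean_space"
  assumes n: "2 \<le> DIM('a)" and flat: "flat_in \<epsilon> N Q" and \<epsilon>: "0 \<le> \<epsilon>" "\<epsilon> \<le> 1 / (2 * DIM('a))" and r: "0 < r"
  shows "hausdorff_outer (real (DIM('a) - 1)) (Q \<inter> cball c r)
    \<le> ennreal ((15 * real DIM('a) ^ 2 * r) ^ (DIM('a) - 1))"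
  unfolding hausdorff_outer_def
proof (rule SUP_least)
  fix d :: real assume "d \<in> {0<..}"
  then have d: "0 < d" by simp
  let ?D = "real DIM('a)" and ?k = "DIM('a) - 1" and ?Q = "Q \<inter> cball c r"
  obtain b where b: "b \<in> Basis"
    "\<And>x y. x \<in> Q \<Longrightarrow> y \<in> Q \<Longrightarrow> norm (x - y) \<le> 5 * ?D * (\<Sum>j\<in>Basis - {b}. \<bar>(x - y) \<bullet> j\<bar>)"
    by (rule flat_in_graph[OF flat \<epsilon>]) (rule that)
  \<comment> \<open>Fine enough for the pieces over the cells to have diameter at most
    \<open>d\<close>.\<close>
  obtain m where m: "5 * ?D\<^sup>2 * r / d < real m" using reals_Archimedean2 by blast
  moreover have "0 \<le> 5 * ?D\<^sup>2 * r / d" using r d by simp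
  ultimately have m0: "0 < real m" by linarith
  define \<eta> where "\<eta> = r / real m"
  have \<eta>: "0 < \<eta>" using r m0 by (simp add: \<eta>_def)
  have \<eta>d: "5 * ?D\<^sup>2 * \<eta> \<le> d" using m d m0 by (simp add: \<eta>_def field_simps)
  define idx where "idx x = restrict (\<lambda>j. \<lfloor>((x - c) \<bullet> j) / \<eta>\<rfloor>) (Basis - {b})" for x
  define I where "I = Pi\<^sub>E (Basis - {b}) (\<lambda>_. {- int m..int m})"
  let ?C = "\<lambda>z. {x \<in> ?Q. idx x = z}"
  have I: "finite I" "card I = (2 * m + 1) ^ ?k"
  proof -
    have "nat (1 + int m + int m) = 2 * m + 1" by simp
    then show "finite I" "card I = (2 * m + 1) ^ ?k"
      using b(1) by (auto simp: I_def card_PiE algebra_simps intro!: finite_PiE)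
  qed
  have idx: "idx x \<in> I" if "x \<in> ?Q" for x
  proof -
    have "\<lfloor>((x - c) \<bullet> j) / \<eta>\<rfloor> \<in> {- int m..int m}" if j: "j \<in> Basis" for j
    proof -
      have "\<bar>(x - c) \<bullet> j\<bar> \<le> r"
        using Basis_le_norm[OF j, of "x - c"] \<open>x \<in> ?Q\<close> by (simp add: dist_norm norm_minus_commute)
      then have "\<bar>((x - c) \<bullet> j) / \<eta>\<bar> \<le> real m"
        using \<eta> r m0 by (simp add: \<eta>_def field_simps abs_mult)
      then have "- real m \<le> ((x - c) \<bullet> j) / \<eta>" "((x - c) \<bullet> j) / \<eta> < real m + 1" by linarith+
      then show ?thesis by (simp add: le_floor_iff floor_le_iff)
    qed
    then show ?thesis by (auto simp: I_def idx_def)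
  qed
  have diam: "norm (x - y) \<le> 5 * ?D\<^sup>2 * \<eta>" if "x \<in> ?C z" "y \<in> ?C z" for x y z
  proof -
    have "\<bar>(x - y) \<bullet> j\<bar> \<le> \<eta>" if j: "j \<in> Basis - {b}" for j
    proof -
      have "idx x j = idx y j" using \<open>x \<in> ?C z\<close> \<open>y \<in> ?C z\<close> by simp
      then have "\<lfloor>((x - c) \<bullet> j) / \<eta>\<rfloor> = \<lfloor>((y - c) \<bullet> j) / \<eta>\<rfloor>" using j by (simp add: idx_def)
      then have "\<bar>((x - c) \<bullet> j) / \<eta> - ((y - c) \<bullet> j) / \<eta>\<bar> < 1" by linarith
      then have "\<bar>((x - c) \<bullet> j - (y - c) \<bullet> j) / \<eta>\<bar> < 1" by (simp add: diff_divide_distrib)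
      then show ?thesis using \<eta> by (simp add: inner_diff_left field_simps)
    qed
    then have "(\<Sum>j\<in>Basis - {b}. \<bar>(x - y) \<bullet> j\<bar>) \<le> real (card (Basis - {b})) * \<eta>"
      by (intro sum_bounded_above)
    also have "\<dots> \<le> ?D * \<eta>"
      using \<eta> b(1) by (intro mult_right_mono) (auto simp: card_Diff_singleton)
    finally have fin: "5 * ?D * (\<Sum>j\<in>Basis - {b}. \<bar>(x - y) \<bullet> j\<bar>) \<le> 5 * ?D * (?D * \<eta>)"
      by (rule mult_left_mono) simp
    have "norm (x - y) \<le> 5 * ?D * (\<Sum>j\<in>Basis - {b}. \<bar>(x - y) \<bullet> j\<bar>)"
      using b(2) that by blast
    also note fin
    also have "5 * ?D * (?D * \<eta>) = 5 * ?D\<^sup>2 * \<eta>" by (simp add: power2_eq_square)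
    finally show ?thesis .
  qed
  have bC: "bounded (?C z)" for z by (rule bounded_subset[of "cball c r"]) auto
  have dC: "diameter (?C z) \<le> 5 * ?D\<^sup>2 * \<eta>" for z
    by (rule diameter_le) (use diam \<eta> in auto)
  have "hausdorff_content (real ?k) d ?Q \<le> (\<Sum>z\<in>I. hausdorff_gauge (real ?k) (?C z))"
  proof (rule hausdorff_content_le_finite[OF I(1) _ bC])
    show "?Q \<subseteq> (\<Union>z\<in>I. ?C z)" using idx by blast
    show "diameter (?C z) \<le> d" for z using dC[of z] \<eta>d by linarith
  qed (use d in simp)
  also have "\<dots> \<le> (\<Sum>z\<in>I. ennreal ((5 * ?D\<^sup>2 * \<eta>) ^ ?k))"
    using n by (intro sum_mono hausdorff_gauge_le_power bC dC) auto
  also have "\<dots> = ennreal (real (card I)) * ennreal ((5 * ?D\<^sup>2 * \<eta>) ^ ?k)"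
    by (simp only: sum_constant ennreal_of_nat_eq_real_of_nat)
  also have "\<dots> = ennreal (real (card I) * (5 * ?D\<^sup>2 * \<eta>) ^ ?k)"
    using \<eta> by (intro ennreal_mult[symmetric]) auto
  also have "real (card I) * (5 * ?D\<^sup>2 * \<eta>) ^ ?k = ((2 * real m + 1) * (5 * ?D\<^sup>2 * \<eta>)) ^ ?k"
    by (simp add: I(2) power_mult_distrib add.commute)
  \<comment> \<open>\<open>2 * m + 1 \<le> 3 * m\<close> turns the factor \<open>5\<close> of the
    graph estimate into \<open>15\<close>.\<close>
  also have "\<dots> \<le> ((3 * real m) * (5 * ?D\<^sup>2 * \<eta>)) ^ ?k"
    using m0 \<eta> by (intro power_mono mult_right_mono) auto
  also have "(3 * real m) * (5 * ?D\<^sup>2 * \<eta>) = 15 * ?D ^ 2 * r" using m0 by (simp add: \<eta>_def)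
  finally show "hausdorff_content (real ?k) d ?Q \<le> ennreal ((15 * ?D ^ 2 * r) ^ ?k)"
    by (simp add: ennreal_leI)
qed

text \<open>Compactness of the smooth pieces leaves finitely many of the local patches, each with
  one fixed normal. \<open>E\<close> and \<open>\<rho>\<close> are quantified inside because the
  patches depend on \<open>A\<close> and \<open>\<epsilon>\<close> alone. The tangent plane of the
  piece containing the patch is among the \<open>tangent_planes\<close>, so the distance condition
  applies to it.\<close>

lemma piecewise_smooth_surface_patches:
  fixes A :: "'a::euclidean_space set"
  assumes A: "piecewise_smooth_surface A" and \<epsilon>: "0 < \<epsilon>"
  obtains \<Q> where "finite \<Q>" "A = \<Union>\<Q>"
    "\<And>Q. Q \<in> \<Q> \<Longrightarrow> \<exists>N. flat_in \<epsilon> N Q \<and> (\<forall>a\<in>Q. \<forall>E. \<forall>z\<in>E. \<forall>\<rho>.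
      (\<forall>T\<in>tangent_planes A a. \<rho> \<le> setdist T E) \<longrightarrow> \<rho> - \<epsilon> * norm (z - a) \<le> \<bar>N \<bullet> (z - a)\<bar>)"
proof -
  let ?P = "\<lambda>Q. \<exists>N. flat_in \<epsilon> N Q \<and> (\<forall>a\<in>Q. \<forall>E. \<forall>z\<in>E. \<forall>\<rho>.
      (\<forall>T\<in>tangent_planes A a. \<rho> \<le> setdist T E) \<longrightarrow> \<rho> - \<epsilon> * norm (z - a) \<le> \<bar>N \<bullet> (z - a)\<bar>)"
  obtain F where F: "finite F" "A = \<Union>F" "\<And>S. S \<in> F \<Longrightarrow> compact S \<and> smooth_hypersurface S"
    using A unfolding piecewise_smooth_surface_def by blast
  have "\<exists>\<Q>. finite \<Q> \<and> S = \<Union>\<Q> \<and> (\<forall>Q\<in>\<Q>. ?P Q)" if S: "S \<in> F" for S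
  proof -
    have cS: "compact S" and sS: "smooth_hypersurface S" and SA: "S \<subseteq> A" using F S by auto
    have "\<exists>R>0. ?P (S \<inter> ball a R)" if a: "a \<in> S" for a
    proof -
      obtain R N where R: "0 < R" "norm N = 1"
        "\<And>x y. x \<in> S \<inter> ball a R \<Longrightarrow> y \<in> S \<inter> ball a R \<Longrightarrow> \<bar>N \<bullet> (x - y)\<bar> \<le> \<epsilon> * norm (x - y)"
        "\<And>x z \<eta>. x \<in> S \<inter> ball a R \<Longrightarrow> \<forall>v\<in>tangent_space S x. \<eta> \<le> norm (x + v - z) \<Longrightarrow>
          \<eta> - \<epsilon> * norm (z - x) \<le> \<bar>N \<bullet> (z - x)\<bar>"
        by (rule smooth_hypersurface_local_normal[OF sS a \<epsilon>]) (rule that)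
      have "\<rho> - \<epsilon> * norm (z - x) \<le> \<bar>N \<bullet> (z - x)\<bar>"
        if x: "x \<in> S \<inter> ball a R" and z: "z \<in> E" and T: "\<forall>T\<in>tangent_planes A x. \<rho> \<le> setdist T E" for x E z \<rho>
      proof (rule R(4)[OF x], rule ballI)
        fix v assume v: "v \<in> tangent_space S x"
        have "(+) x ` tangent_space S x \<in> tangent_planes A x"
          using cS sS SA x unfolding tangent_planes_def by blast
        with T have "\<rho> \<le> setdist ((+) x ` tangent_space S x) E" by blast
        also have "\<dots> \<le> dist (x + v) z" using v z by (intro setdist_le_dist) auto
        finally show "\<rho> \<le> norm (x + v - z)" by (simp add: dist_norm)
      qed
      moreover have "flat_in \<epsilon> N (S \<inter> ball a R)"
        unfolding flat_in_def using R(2,3) by blast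
      ultimately show ?thesis using R(1) by blast
    qed
    then obtain R where R: "\<And>a. a \<in> S \<Longrightarrow> 0 < R a" "\<And>a. a \<in> S \<Longrightarrow> ?P (S \<inter> ball a (R a))" by metis
    have "S \<subseteq> (\<Union>a\<in>S. ball a (R a))" using R(1) by force
    then obtain C where C: "C \<subseteq> S" "finite C" "S \<subseteq> (\<Union>a\<in>C. ball a (R a))"
      by (rule compactE_image[OF cS, rotated]) auto
    show ?thesis
    proof (intro exI[of _ "(\<lambda>a. S \<inter> ball a (R a)) ` C"] conjI ballI)
      show "S = (\<Union>a\<in>C. S \<inter> ball a (R a))" using C(3) by blast
      fix Q assume "Q \<in> (\<lambda>a. S \<inter> ball a (R a)) ` C"
      then obtain a where "a \<in> C" "Q = S \<inter> ball a (R a)" by blast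
      then show "?P Q" using R(2)[of a] C(1) by (simp only:) blast
    qed (use C in simp)
  qed
  then obtain \<Q> where Q: "\<And>S. S \<in> F \<Longrightarrow> finite (\<Q> S)" "\<And>S. S \<in> F \<Longrightarrow> S = \<Union>(\<Q> S)"
    "\<And>S Q. S \<in> F \<Longrightarrow> Q \<in> \<Q> S \<Longrightarrow> ?P Q" by metis
  show ?thesis
  proof (rule that[of "\<Union>S\<in>F. \<Q> S"])
    show "finite (\<Union>S\<in>F. \<Q> S)" using F(1) Q(1) by blast
    show "A = \<Union>(\<Union>S\<in>F. \<Q> S)" using F(2) Q(2) by blast
    fix Q assume "Q \<in> (\<Union>S\<in>F. \<Q> S)"
    then obtain S where "S \<in> F" "Q \<in> \<Q> S" by blast
    then show "?P Q" by (rule Q(3))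
  qed
qed

lemma compact_piecewise_smooth_surface: "piecewise_smooth_surface A \<Longrightarrow> compact A"
  unfolding piecewise_smooth_surface_def by auto

lemma piecewise_smooth_surface_hausdorff_finite:
  fixes A :: "'a::euclidean_space set"
  assumes n: "2 \<le> DIM('a)" and A: "piecewise_smooth_surface A"
  shows "hausdorff_outer (real (DIM('a) - 1)) A < \<infinity>"
proof -
  let ?k = "real (DIM('a) - 1)" and ?e = "1 / (2 * real DIM('a))"
  obtain r where r: "0 < r" "A \<subseteq> ball 0 r"
    using bounded_subset_ballD[OF compact_imp_bounded[OF compact_piecewise_smooth_surface[OF A]]] by blast
  have e: "0 < ?e" by simp
  obtain \<Q> where Q: "finite \<Q>" "A = \<Union>\<Q>" "\<And>Q. Q \<in> \<Q> \<Longrightarrow> \<exists>N. flat_in ?e N Q"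
    using piecewise_smooth_surface_patches[OF A e] by metis
  have "hausdorff_outer ?k A = hausdorff_outer ?k (\<Union>Q\<in>\<Q>. Q \<inter> cball 0 r)"
    using Q(2) r(2) ball_subset_cball[of 0 r] by (intro arg_cong[of _ _ "hausdorff_outer ?k"]) blast
  also have "\<dots> \<le> (\<Sum>Q\<in>\<Q>. hausdorff_outer ?k (Q \<inter> cball 0 r))"
    by (rule hausdorff_outer_UN_finite[OF Q(1)])
  also have "\<dots> \<le> (\<Sum>Q\<in>\<Q>. ennreal ((15 * real DIM('a) ^ 2 * r) ^ (DIM('a) - 1)))"
  proof (rule sum_mono)
    fix Q assume "Q \<in> \<Q>"
    then obtain N where "flat_in ?e N Q" using Q(3) by blast
    then show "hausdorff_outer ?k (Q \<inter> cball 0 r) \<le> ennreal ((15 * real DIM('a) ^ 2 * r) ^ (DIM('a) - 1))"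
      by (intro flat_in_hausdorff_le[OF n _ _ _ r(1)]) auto
  qed
  also have "\<dots> < \<infinity>" by (simp add: ennreal_mult_less_top of_nat_less_top)
  finally show ?thesis .
qed

lemma piecewise_smooth_surface_hausdorff_pos:
  fixes A :: "'a::euclidean_space set"
  assumes n: "2 \<le> DIM('a)" and A: "piecewise_smooth_surface A"
  shows "0 < hausdorff_outer (real (DIM('a) - 1)) A"
proof -
  obtain S where "S \<subseteq> A" "S \<noteq> {}" "smooth_hypersurface S"
    using A unfolding piecewise_smooth_surface_def by blast
  then show ?thesis
    using smooth_hypersurface_hausdorff_pos[OF _ _ n, of S] hausdorff_outer_mono less_le_trans by blast
qed

section \<open>Transversality\<close>

text \<open>In polar form around \<open>a\<close>, \<open>x\<close> and \<open>y\<close> have radii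
  \<open>s\<close>, \<open>t\<close> and nearly equal directions \<open>p\<close>, \<open>q\<close>.
  As \<open>dist x y\<close> is large compared with \<open>\<delta>\<close>, the radii must differ
  by at least half of it, so the line through \<open>x\<close> and \<open>y\<close> is nearly radial
  and passes close to \<open>a\<close>.\<close>

lemma radial_proj_near_line:
  fixes a x y :: "'a::real_inner"
  assumes xy: "x \<noteq> y" and ax: "x \<noteq> a" "y \<noteq> a" "norm (x - a) \<le> M" "norm (y - a) \<le> M"
    and \<delta>: "dist (radial_proj a x) (radial_proj a y) \<le> \<delta>" "2 * M * \<delta> \<le> dist x y"
  shows "\<exists>\<tau>. norm (a - x - \<tau> *\<^sub>R ((y - x) /\<^sub>R norm (y - x))) \<le> 2 * M\<^sup>2 * (\<delta> / dist x y)"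
proof -
  define s t p q where "s = norm (x - a)" and "t = norm (y - a)"
    and "p = radial_proj a x" and "q = radial_proj a y"
  have s: "0 < s" "s \<le> M" and t: "0 < t" "t \<le> M" using ax by (auto simp: s_def t_def)
  have xp: "x = a + s *\<^sub>R p" and yq: "y = a + t *\<^sub>R q"
    using s t by (simp_all add: p_def q_def radial_proj_def s_def t_def)
  have p: "norm p = 1" using s by (simp add: p_def radial_proj_def s_def)
  have pq: "norm (p - q) \<le> \<delta>" using \<delta>(1) by (simp add: p_def q_def dist_norm)
  have d: "0 < dist x y" using xy by simp
  have "x - y = (s - t) *\<^sub>R p + t *\<^sub>R (p - q)" by (simp add: xp yq algebra_simps)
  then have "dist x y \<le> norm ((s - t) *\<^sub>R p) + norm (t *\<^sub>R (p - q))"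
    by (metis dist_norm norm_triangle_ineq)
  also have "\<dots> \<le> \<bar>s - t\<bar> + M * \<delta>"
    using p t pq by (intro add_mono) (auto intro!: mult_mono)
  finally have st: "dist x y / 2 \<le> \<bar>s - t\<bar>" using \<delta>(2) by simp
  then have st0: "s - t \<noteq> 0" using d by auto
  \<comment> \<open>With this parameter the coefficients of \<open>p\<close> and \<open>q\<close> in
    \<open>a - x - l *\<^sub>R (y - x)\<close> are opposite, so only a multiple of
    \<open>p - q\<close> survives.\<close>
  define l where "l = s / (s - t)"
  have l: "1 - l = - t / (s - t)" using st0 by (simp add: l_def field_simps)
  have "a - x - l *\<^sub>R (y - x) = ((1 - l) * s) *\<^sub>R (- p) + (l * t) *\<^sub>R (- q)"
    by (simp add: xp yq algebra_simps)
  also have "\<dots> = (s * t / (s - t)) *\<^sub>R (p - q)"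
    unfolding l by (simp add: l_def algebra_simps)
  finally have "norm (a - x - l *\<^sub>R (y - x)) = s * t / \<bar>s - t\<bar> * norm (p - q)"
    using s t by simp
  also have "\<dots> \<le> M * M / (dist x y / 2) * \<delta>"
    using s t pq st d by (intro mult_mono frac_le) auto
  also have "\<dots> = 2 * M\<^sup>2 * (\<delta> / dist x y)" by (simp add: power2_eq_square)
  finally have "norm (a - x - (l * norm (y - x)) *\<^sub>R ((y - x) /\<^sub>R norm (y - x))) \<le> 2 * M\<^sup>2 * (\<delta> / dist x y)"
    using xy by (simp add: mult.assoc)
  then show ?thesis by blast
qed

text \<open>A line through \<open>x\<close> leaves a flat set quickly: as \<open>x\<close> keeps distance \<open>\<rho>\<close> from the tangent
  plane at \<open>a\<close>, the direction \<open>e\<close> has a component at least \<open>\<rho>/(8M)\<close> along the normal \<open>N\<close>.\<close>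

lemma flat_in_tube_diameter:
  fixes a b x e N :: "'a::real_inner"
  assumes flat: "flat_in \<epsilon> N Q" and ab: "a \<in> Q" "b \<in> Q" and e: "norm e = 1"
    and w: "norm (a - x - \<tau> *\<^sub>R e) \<le> w" "norm (b - x - \<sigma> *\<^sub>R e) \<le> w" "w \<le> \<rho> / 4"
    and M: "norm (x - a) \<le> M" and \<rho>: "0 < \<rho>" "\<rho> \<le> M" and \<epsilon>: "0 < \<epsilon>" "\<epsilon> \<le> \<rho> / (16 * M)"
    and far: "\<rho> - \<epsilon> * norm (x - a) \<le> \<bar>N \<bullet> (x - a)\<bar>"
  shows "norm (a - b) \<le> (64 * M / \<rho> + 2) * w"
proof -
  have M0: "0 < M" using \<rho> by linarith
  have w0: "0 \<le> w" using w(1) norm_ge_zero order_trans by blast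
  have N: "norm N = 1" and chord: "\<bar>N \<bullet> (a - b)\<bar> \<le> \<epsilon> * norm (a - b)"
    using flat ab by (auto simp: flat_in_def)
  have N1: "\<bar>N \<bullet> v\<bar> \<le> norm v" for v using Cauchy_Schwarz_ineq2[of N v] N by simp
  define h where "h = (a - x - \<tau> *\<^sub>R e) - (b - x - \<sigma> *\<^sub>R e)"
  have h: "norm h \<le> 2 * w" using w(1,2) norm_triangle_ineq4[of "a - x - \<tau> *\<^sub>R e" "b - x - \<sigma> *\<^sub>R e"]
    by (simp add: h_def)
  have eM: "\<epsilon> * M \<le> \<rho> / 16" using \<epsilon> M0 by (simp add: field_simps)
  have "\<epsilon> * norm (x - a) \<le> \<epsilon> * M" using M \<epsilon> by (intro mult_left_mono) auto
  then have "\<rho> / 2 \<le> \<bar>N \<bullet> (x - a)\<bar>" using far eM \<rho>(1) by linarith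
  moreover have "N \<bullet> (x - a) = - (\<tau> * (N \<bullet> e)) - N \<bullet> (a - x - \<tau> *\<^sub>R e)"
    by (simp add: inner_diff_right)
  ultimately have "\<rho> / 4 \<le> \<bar>\<tau> * (N \<bullet> e)\<bar>" using N1[of "a - x - \<tau> *\<^sub>R e"] w(1,3) by linarith
  also have "\<dots> \<le> (2 * M) * \<bar>N \<bullet> e\<bar>"
  proof -
    have "\<bar>\<tau>\<bar> = norm (\<tau> *\<^sub>R e)" using e by simp
    also have "\<dots> \<le> norm (a - x) + norm (a - x - \<tau> *\<^sub>R e)"
      using norm_triangle_ineq4[of "a - x" "a - x - \<tau> *\<^sub>R e"] by simp
    also have "\<dots> \<le> 2 * M" using M w(1,3) \<rho> by (simp add: norm_minus_commute)
    finally show ?thesis unfolding abs_mult by (rule mult_right_mono) simp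
  qed
  finally have Ne: "\<rho> / (8 * M) \<le> \<bar>N \<bullet> e\<bar>" using M0 by (simp add: field_simps)
  \<comment> \<open>\<open>a - b\<close> is \<open>t *\<^sub>R e\<close> up to an error
    \<open>2 * w\<close>. Transversality gives \<open>t *\<^sub>R e\<close> a normal component of at
    least \<open>\<bar>t\<bar> * (\<rho> / (8 * M))\<close>, while flatness allows a chord only the
    slope \<open>\<epsilon>\<close>, at most half as much; so \<open>\<bar>t\<bar>\<close> is
    absorbed up to a multiple of \<open>w\<close>.\<close>
  define t where "t = \<tau> - \<sigma>"
  have abt: "a - b = t *\<^sub>R e + h" by (simp add: t_def h_def algebra_simps)
  have nab: "norm (a - b) \<le> \<bar>t\<bar> + 2 * w"
    unfolding abt using norm_triangle_ineq[of "t *\<^sub>R e" h] e h by simp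
  have "\<bar>t\<bar> * (\<rho> / (8 * M)) \<le> \<bar>t\<bar> * \<bar>N \<bullet> e\<bar>" using Ne by (rule mult_left_mono) simp
  also have "\<dots> = \<bar>N \<bullet> (a - b) - N \<bullet> h\<bar>" by (simp add: abt inner_add_right abs_mult)
  also have "\<dots> \<le> \<epsilon> * norm (a - b) + 2 * w" using chord N1[of h] h by linarith
  also have "\<epsilon> * norm (a - b) \<le> \<rho> / (16 * M) * (\<bar>t\<bar> + 2 * w)"
    using \<epsilon> nab w0 by (intro mult_mono) auto
  finally have "\<bar>t\<bar> * (\<rho> / (8 * M)) \<le> \<rho> / (16 * M) * (\<bar>t\<bar> + 2 * w) + 2 * w" by simp
  then have "(16 * M) * (\<bar>t\<bar> * (\<rho> / (8 * M))) \<le> (16 * M) * (\<rho> / (16 * M) * (\<bar>t\<bar> + 2 * w) + 2 * w)"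
    using M0 by (intro mult_left_mono) auto
  then have "2 * (\<rho> * \<bar>t\<bar>) \<le> \<rho> * \<bar>t\<bar> + 2 * (\<rho> * w) + 32 * (M * w)"
  proof -
    have "(16 * M) * (\<bar>t\<bar> * (\<rho> / (8 * M))) = 2 * (\<rho> * \<bar>t\<bar>)"
      "(16 * M) * (\<rho> / (16 * M) * (\<bar>t\<bar> + 2 * w) + 2 * w) = \<rho> * \<bar>t\<bar> + 2 * (\<rho> * w) + 32 * (M * w)"
      using M0 by (simp_all add: field_simps)
    with \<open>(16 * M) * _ \<le> _\<close> show ?thesis by linarith
  qed
  moreover have "\<rho> * w \<le> M * w" using \<rho> w0 by (intro mult_right_mono) auto
  ultimately have "\<rho> * \<bar>t\<bar> \<le> 64 * M * w" using mult_nonneg_nonneg[OF less_imp_le[OF M0] w0] by linarith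
  then have "\<bar>t\<bar> \<le> 64 * M / \<rho> * w" using \<rho> by (simp add: field_simps)
  then show ?thesis using nab by (simp add: distrib_right)
qed

text \<open>The tube argument covers small ratios \<open>q = \<delta> / dist x y\<close>. Above the
  threshold \<open>\<theta>\<close> the total measure \<open>h\<close> of \<open>A\<close> is at
  most \<open>h / \<theta> ^ k * q ^ k\<close> with \<open>k = DIM('a) - 1\<close>, a bound of the
  same form, so \<open>\<delta>\<close> is unrestricted.\<close>

lemma hausdorff_radial_proj_le:
  fixes A E :: "'a::euclidean_space set"
  assumes n: "2 \<le> DIM('a)" and A: "piecewise_smooth_surface A" and disj: "A \<inter> E = {}"
    and bdd: "\<And>a e. a \<in> A \<Longrightarrow> e \<in> E \<Longrightarrow> norm (a - e) \<le> M"
    and \<rho>: "0 < \<rho>" and nul: "hausdorff_outer (real (DIM('a) - 1)) Z = 0"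
    and tangent: "\<And>a T. a \<in> A - Z \<Longrightarrow> T \<in> tangent_planes A a \<Longrightarrow> \<rho> \<le> setdist T E"
  obtains C where "0 < C" "\<And>x y \<delta>. x \<in> E \<Longrightarrow> y \<in> E \<Longrightarrow> x \<noteq> y \<Longrightarrow> 0 < \<delta> \<Longrightarrow>
    hausdorff_outer (real (DIM('a) - 1)) {a \<in> A. dist (radial_proj a x) (radial_proj a y) \<le> \<delta>}
      \<le> ennreal (C * (\<delta> / dist x y) ^ (DIM('a) - 1))"
proof -
  let ?H = "hausdorff_outer (real (DIM('a) - 1)) :: 'a set \<Rightarrow> ennreal" and ?k = "DIM('a) - 1"
  define M' where "M' = max M \<rho>"
  have M': "0 < M'" "\<rho> \<le> M'" using \<rho> by (auto simp: M'_def)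
  have bdd': "norm (e - a) \<le> M'" "e \<noteq> a" if "a \<in> A" "e \<in> E" for a e
    using bdd[OF that] that disj by (auto simp: M'_def norm_minus_commute)
  define \<epsilon> where "\<epsilon> = min (\<rho> / (16 * M')) (1 / (2 * real DIM('a)))"
  have \<epsilon>: "0 < \<epsilon>" "\<epsilon> \<le> \<rho> / (16 * M')" "\<epsilon> \<le> 1 / (2 * real DIM('a))"
    using \<rho> M' by (auto simp: \<epsilon>_def)
  obtain \<Q> where Q: "finite \<Q>" "A = \<Union>\<Q>" "\<And>Q. Q \<in> \<Q> \<Longrightarrow> \<exists>N. flat_in \<epsilon> N Q \<and> (\<forall>a\<in>Q. \<forall>E. \<forall>z\<in>E. \<forall>\<rho>.
      (\<forall>T\<in>tangent_planes A a. \<rho> \<le> setdist T E) \<longrightarrow> \<rho> - \<epsilon> * norm (z - a) \<le> \<bar>N \<bullet> (z - a)\<bar>)"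
    by (rule piecewise_smooth_surface_patches[OF A \<epsilon>(1)]) (rule that)
  define K where "K = 64 * M' / \<rho> + 2"
  have K: "0 < K" using \<rho> M' by (simp add: K_def add_pos_pos)
  define B where "B = 15 * (real DIM('a))\<^sup>2 * (K * (2 * M'\<^sup>2))"
  have B: "0 < B" using K M' by (simp add: B_def)
  \<comment> \<open>The two bounds make the tube thin (\<open>w \<le> \<rho> / 4\<close>) and the
    points far apart relative to \<open>\<delta>\<close>
    (\<open>2 * M' * \<delta> \<le> dist x y\<close>).\<close>
  define \<theta> where "\<theta> = min (\<rho> / (8 * M'\<^sup>2)) (1 / (2 * M'))"
  have \<theta>: "0 < \<theta>" using \<rho> M' by (simp add: \<theta>_def)
  define h where "h = enn2real (?H A)"
  have h: "?H A = ennreal h" "0 \<le> h"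
    using piecewise_smooth_surface_hausdorff_finite[OF n A] by (simp_all add: h_def)
  define C where "C = real (card \<Q>) * B ^ ?k + h / \<theta> ^ ?k + 1"
  have C: "0 < C" using B h \<theta> by (simp add: C_def add_nonneg_pos)
  show ?thesis
  proof (rule that[OF C])
    fix x y \<delta> assume xy: "x \<in> E" "y \<in> E" "x \<noteq> y" and \<delta>: "0 < (\<delta>::real)"
    let ?X = "{a \<in> A. dist (radial_proj a x) (radial_proj a y) \<le> \<delta>}"
    define q where "q = \<delta> / dist x y"
    have d: "0 < dist x y" and q: "0 < q" using xy \<delta> by (auto simp: q_def)
    show "?H ?X \<le> ennreal (C * (\<delta> / dist x y) ^ ?k)"
      unfolding q_def[symmetric]
    proof (cases "q \<le> \<theta>")
      case True
      define w where "w = 2 * M'\<^sup>2 * q"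
      have w: "0 < w" using q M' by (simp add: w_def)
      have w4: "w \<le> \<rho> / 4"
      proof -
        have "q \<le> \<rho> / (8 * M'\<^sup>2)" using True by (simp add: \<theta>_def)
        then show ?thesis using M' by (simp add: w_def field_simps)
      qed
      have qM: "2 * M' * \<delta> \<le> dist x y"
      proof -
        have "q \<le> 1 / (2 * M')" using True by (simp add: \<theta>_def)
        then show ?thesis using M' d by (simp add: q_def field_simps)
      qed
      define e where "e = (y - x) /\<^sub>R norm (y - x)"
      have e: "norm e = 1" using xy by (simp add: e_def)
      have line: "\<exists>\<tau>. norm (a - x - \<tau> *\<^sub>R e) \<le> w" if "a \<in> ?X" for a
        using radial_proj_near_line[of x y a M' \<delta>] xy bdd'[of a x] bdd'[of a y] that qM
        by (simp add: e_def w_def q_def)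
      \<comment> \<open>The tangent condition fails on the null set \<open>Z\<close> at most. Either
        \<open>Q \<inter> ?X\<close> lies in \<open>Z\<close>, or the condition at a single point
        \<open>a\<close> outside \<open>Z\<close> confines all of \<open>Q \<inter> ?X\<close> to a
        small ball around \<open>a\<close>.\<close>
      have patch: "?H (Q \<inter> ?X) \<le> ennreal ((B * q) ^ ?k)" if QQ: "Q \<in> \<Q>" for Q
      proof (cases "Q \<inter> ?X \<subseteq> Z")
        case True
        then have "?H (Q \<inter> ?X) \<le> 0" using nul hausdorff_outer_mono by metis
        then show ?thesis by simp
      next
        case False
        then obtain a where a: "a \<in> Q" "a \<in> ?X" "a \<notin> Z" by blast
        obtain N where N: "flat_in \<epsilon> N Q" "\<And>z \<rho>. z \<in> E \<Longrightarrow>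
          (\<forall>T\<in>tangent_planes A a. \<rho> \<le> setdist T E) \<Longrightarrow> \<rho> - \<epsilon> * norm (z - a) \<le> \<bar>N \<bullet> (z - a)\<bar>"
          using Q(3)[OF QQ] a(1) by meson
        have far: "\<rho> - \<epsilon> * norm (x - a) \<le> \<bar>N \<bullet> (x - a)\<bar>"
          using N(2)[OF xy(1)] tangent[of a] a by blast
        obtain \<tau> where \<tau>: "norm (a - x - \<tau> *\<^sub>R e) \<le> w" using line[OF a(2)] by blast
        have "b \<in> cball a (K * w)" if b: "b \<in> Q \<inter> ?X" for b
        proof -
          obtain \<sigma> where "norm (b - x - \<sigma> *\<^sub>R e) \<le> w" using line b by blast
          then have "norm (a - b) \<le> (64 * M' / \<rho> + 2) * w"
            using b a bdd'[OF _ xy(1)]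
            by (intro flat_in_tube_diameter[OF N(1) a(1) _ e \<tau> _ w4 _ \<rho> M'(2) \<epsilon>(1,2) far]) auto
          then show ?thesis by (simp add: K_def dist_norm)
        qed
        then have "?H (Q \<inter> ?X) \<le> ?H (Q \<inter> cball a (K * w))" by (intro hausdorff_outer_mono) blast
        also have "\<dots> \<le> ennreal ((15 * real DIM('a) ^ 2 * (K * w)) ^ ?k)"
          using \<epsilon> K w by (intro flat_in_hausdorff_le[OF n N(1)]) auto
        also have "15 * real DIM('a) ^ 2 * (K * w) = B * q" by (simp add: B_def w_def)
        finally show ?thesis .
      qed
      have "?H ?X \<le> ?H (\<Union>Q\<in>\<Q>. Q \<inter> ?X)" using Q(2) by (intro hausdorff_outer_mono) blast
      also have "\<dots> \<le> (\<Sum>Q\<in>\<Q>. ?H (Q \<inter> ?X))" by (rule hausdorff_outer_UN_finite[OF Q(1)])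
      also have "\<dots> \<le> (\<Sum>Q\<in>\<Q>. ennreal ((B * q) ^ ?k))" by (rule sum_mono[OF patch])
      also have "\<dots> = ennreal (real (card \<Q>)) * ennreal ((B * q) ^ ?k)"
        by (simp only: sum_constant ennreal_of_nat_eq_real_of_nat)
      also have "\<dots> = ennreal (real (card \<Q>) * (B * q) ^ ?k)"
        using B q by (intro ennreal_mult[symmetric]) auto
      also have "\<dots> \<le> ennreal (C * q ^ ?k)"
        using h \<theta> q by (intro ennreal_leI) (simp add: C_def distrib_right power_mult_distrib)
      finally show "?H ?X \<le> ennreal (C * q ^ ?k)" .
    next
      case False
      have "?H ?X \<le> ?H A" by (rule hausdorff_outer_mono) auto
      also have "\<dots> = ennreal (h / \<theta> ^ ?k * \<theta> ^ ?k)" using h \<theta> by simp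
      also have "\<dots> \<le> ennreal (C * q ^ ?k)"
        using False h \<theta> B q by (intro ennreal_leI mult_mono power_mono) (auto simp: C_def add_nonneg_nonneg)
      finally show "?H ?X \<le> ennreal (C * q ^ ?k)" .
    qed
  qed
qed

section \<open>A discrete Frostman lemma\<close>

text \<open>Start from masses saturating the finest level and pass to coarser levels, scaling down every
  cell that is too heavy; afterwards that cell is saturated.\<close>

lemma frostman_weights:
  fixes p :: "nat \<Rightarrow> 'x \<Rightarrow> 'c" and b :: "nat \<Rightarrow> real"
  assumes X: "finite X" and b: "\<And>j. 0 < b j"
    and nested: "\<And>i j x y. i \<le> j \<Longrightarrow> p j x = p j y \<Longrightarrow> p i x = p i y"
  shows "i \<le> m \<Longrightarrow> \<exists>\<mu>. (\<forall>x\<in>X. 0 < \<mu> x) \<and>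
    (\<forall>j\<in>{i..m}. \<forall>x\<in>X. sum \<mu> {y\<in>X. p j y = p j x} \<le> b j) \<and>
    (\<forall>x\<in>X. \<exists>j\<in>{i..m}. sum \<mu> {y\<in>X. p j y = p j x} = b j)"
proof (induction rule: inc_induct)
  case base
  let ?c = "\<lambda>x. real (card {y\<in>X. p m y = p m x})"
  have c: "0 < ?c x" if "x \<in> X" for x
    using X that by (auto simp: card_gt_0_iff)
  have "sum (\<lambda>x. b m / ?c x) {y\<in>X. p m y = p m x} = b m" if x: "x \<in> X" for x
  proof -
    have "sum (\<lambda>x. b m / ?c x) {y\<in>X. p m y = p m x} = sum (\<lambda>y. b m / ?c x) {y\<in>X. p m y = p m x}"
      by (rule sum.cong) auto
    also have "\<dots> = b m" using c[OF x] by simp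
    finally show ?thesis .
  qed
  then show ?case using c b[of m] by (intro exI[of _ "\<lambda>x. b m / ?c x"]) auto
next
  case (step i)
  then obtain \<mu> where \<mu>: "\<And>x. x \<in> X \<Longrightarrow> 0 < \<mu> x"
    "\<And>j x. j \<in> {Suc i..m} \<Longrightarrow> x \<in> X \<Longrightarrow> sum \<mu> {y\<in>X. p j y = p j x} \<le> b j"
    "\<And>x. x \<in> X \<Longrightarrow> \<exists>j\<in>{Suc i..m}. sum \<mu> {y\<in>X. p j y = p j x} = b j"
    by blast
  define c where "c x = sum \<mu> {y\<in>X. p i y = p i x}" for x
  \<comment> \<open>\<open>f\<close> is constant on cells of level \<open>i\<close>, hence on all
    finer cells, whose masses are merely multiplied by a factor at most \<open>1\<close>. Where the
    factor is \<open>1\<close>, the finer saturated cell survives; elsewhere the cell of level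
    \<open>i\<close> becomes saturated.\<close>
  define f where "f x = min 1 (b i / c x)" for x
  have c: "0 < c x" if "x \<in> X" for x
    unfolding c_def using that X \<mu>(1) by (intro sum_pos2[of _ x]) (auto intro: less_imp_le)
  have f: "0 < f x" "f x \<le> 1" if "x \<in> X" for x
    using c[OF that] b[of i] by (auto simp: f_def)
  have scaled: "sum (\<lambda>x. \<mu> x * f x) {y\<in>X. p j y = p j x} = f x * sum \<mu> {y\<in>X. p j y = p j x}"
    if "i \<le> j" for j x
  proof -
    have fyx: "f y = f x" if "p j y = p j x" for y
    proof -
      have "p i y = p i x" using nested[OF \<open>i \<le> j\<close> that] .
      then show ?thesis by (simp add: f_def c_def)
    qed
    have "sum (\<lambda>x. \<mu> x * f x) {y\<in>X. p j y = p j x} = sum (\<lambda>y. f x * \<mu> y) {y\<in>X. p j y = p j x}"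
    proof (rule sum.cong)
      fix y assume "y \<in> {y\<in>X. p j y = p j x}"
      then have "f y = f x" by (intro fyx) simp
      then show "\<mu> y * f y = f x * \<mu> y" by simp
    qed simp
    then show ?thesis by (simp only: sum_distrib_left)
  qed
  show ?case
  proof (intro exI[of _ "\<lambda>x. \<mu> x * f x"] conjI ballI)
    show "0 < \<mu> x * f x" if "x \<in> X" for x using \<mu>(1) f that by simp
    fix j x assume j: "j \<in> {i..m}" and x: "x \<in> X"
    show "sum (\<lambda>x. \<mu> x * f x) {y\<in>X. p j y = p j x} \<le> b j"
    proof (cases "j = i")
      case True
      have "f x * c x \<le> b i / c x * c x" using c[OF x] by (intro mult_right_mono) (auto simp: f_def)
      then show ?thesis using c[OF x] by (simp add: True scaled c_def[symmetric])
    next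
      case False
      then have "sum \<mu> {y\<in>X. p j y = p j x} \<le> b j" using j x by (intro \<mu>(2)) auto
      moreover have "0 \<le> sum \<mu> {y\<in>X. p j y = p j x}" using \<mu>(1) by (intro sum_nonneg) (auto intro: less_imp_le)
      ultimately show ?thesis
        using f[OF x] j mult_left_le_one_le[of "sum \<mu> {y\<in>X. p j y = p j x}" "f x"] by (simp add: scaled)
    qed
  next
    fix x assume x: "x \<in> X"
    show "\<exists>j\<in>{i..m}. sum (\<lambda>x. \<mu> x * f x) {y\<in>X. p j y = p j x} = b j"
    proof (cases "b i \<le> c x")
      case True
      then have "f x * c x = b i" using c[OF x] by (simp add: f_def min_def)
      then show ?thesis using step.hyps by (intro bexI[of _ i]) (auto simp: scaled c_def)
    next
      case False
      then have "f x = 1" using c[OF x] by (simp add: f_def)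
      moreover obtain j where "j \<in> {Suc i..m}" "sum \<mu> {y\<in>X. p j y = p j x} = b j"
        using \<mu>(3)[OF x] by blast
      ultimately show ?thesis by (intro bexI[of _ j]) (auto simp: scaled)
    qed
  qed
qed

text \<open>The coarsest saturated cells partition \<open>X\<close>.\<close>

lemma saturated_cells_partition:
  fixes p :: "nat \<Rightarrow> 'x \<Rightarrow> 'c" and b :: "nat \<Rightarrow> real"
  assumes X: "finite X"
    and nested: "\<And>i j x y. i \<le> j \<Longrightarrow> p j x = p j y \<Longrightarrow> p i x = p i y"
    and sat: "\<And>x. x \<in> X \<Longrightarrow> \<exists>j\<le>m. sum \<mu> {y\<in>X. p j y = p j x} = b j"
  shows "\<exists>Y J. Y \<subseteq> X \<and> (\<forall>y\<in>Y. J y \<le> m) \<and> X = (\<Union>y\<in>Y. {x\<in>X. p (J y) x = p (J y) y}) \<and>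
    sum \<mu> X = (\<Sum>y\<in>Y. b (J y))"
proof -
  define S where "S j x \<longleftrightarrow> j \<le> m \<and> sum \<mu> {y\<in>X. p j y = p j x} = b j" for j x
  define J where "J x = (LEAST j. S j x)" for x
  define C where "C x = {y\<in>X. p (J x) y = p (J x) x}" for x
  have J: "S (J x) x" if "x \<in> X" for x
    unfolding J_def using sat[OF that] by (metis LeastI S_def)
  have Jle: "J x \<le> j" if "S j x" for j x
    unfolding J_def using that by (rule Least_le)
  \<comment> \<open>If the cells meet and \<open>J x \<le> J y\<close>, then \<open>y\<close> lies
    in the cell of \<open>x\<close>, which is thus a saturated cell of \<open>y\<close> too;
    minimality of \<open>J y\<close> forces equal levels.\<close>
  have eq: "C x = C y" if "x \<in> X" "y \<in> X" "z \<in> C x" "z \<in> C y" "J x \<le> J y" for x y z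
  proof -
    have zx: "p (J x) z = p (J x) x" and zy: "p (J y) z = p (J y) y" using that by (auto simp: C_def)
    then have "p (J x) y = p (J x) x" using nested[OF that(5) zy] by simp
    then have "S (J x) y" using J[OF that(1)] by (simp add: S_def)
    then have "J x = J y" using Jle that(5) by (simp add: le_antisym)
    then show ?thesis using \<open>p (J x) y = p (J x) x\<close> by (simp add: C_def)
  qed
  have disj: "C x = C y" if "x \<in> X" "y \<in> X" "C x \<inter> C y \<noteq> {}" for x y
    using that eq[of x y] eq[of y x] by (metis IntE ex_in_conv nle_le)
  obtain Y where Y: "Y \<subseteq> X" "inj_on C Y" "C ` X = C ` Y"
  proof -
    have "\<exists>U. U \<subseteq> X \<and> inj_on C U \<and> C ` X = C ` U"
      using subset_image_inj[of "C ` X" C X] by simp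
    then show ?thesis using that by blast
  qed
  have self: "x \<in> C x" if "x \<in> X" for x using that by (simp add: C_def)
  have UX: "X = (\<Union>y\<in>Y. C y)"
  proof
    show "X \<subseteq> (\<Union>y\<in>Y. C y)" using self Y(3) by blast
    show "(\<Union>y\<in>Y. C y) \<subseteq> X" by (auto simp: C_def)
  qed
  have "sum \<mu> X = sum \<mu> (\<Union>y\<in>Y. C y)" using UX by simp
  also have "\<dots> = (\<Sum>y\<in>Y. sum \<mu> (C y))"
  proof (rule sum.UNION_disjoint)
    show "finite Y" using X Y(1) finite_subset by blast
    show "\<forall>y\<in>Y. finite (C y)" using X by (simp add: C_def)
    show "\<forall>x\<in>Y. \<forall>y\<in>Y. x \<noteq> y \<longrightarrow> C x \<inter> C y = {}"
      using disj Y(1,2) by (metis inj_onD subsetD)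
  qed
  also have "\<dots> = (\<Sum>y\<in>Y. b (J y))"
    using J Y(1) by (intro sum.cong) (auto simp: S_def C_def)
  finally have "sum \<mu> X = (\<Sum>y\<in>Y. b (J y))" .
  moreover have "\<forall>y\<in>Y. J y \<le> m" using J Y(1) by (auto simp: S_def)
  ultimately show ?thesis using Y(1) UX[unfolded C_def] by (intro exI[of _ Y] exI[of _ J] conjI)
qed

text \<open>Names the half-open dyadic cube of side \<open>L / 2 ^ j\<close> around
  \<open>x\<close>. The restriction to \<open>Basis\<close> makes equality of functions mean
  equality of cubes and places the indices in finite products that can be counted.\<close>

definition dyadic_index :: "real \<Rightarrow> nat \<Rightarrow> 'a::euclidean_space \<Rightarrow> 'a \<Rightarrow> int" where
  "dyadic_index L j x = restrict (\<lambda>i. \<lfloor>(x \<bullet> i) * 2 ^ j / L\<rfloor>) Basis"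

text \<open>The coarse index is the fine one divided by \<open>2 ^ (j - i)\<close> and rounded
  down.\<close>

lemma dyadic_index_nested:
  assumes "i \<le> j" "dyadic_index L j x = dyadic_index L j y"
  shows "dyadic_index L i x = dyadic_index L i y"
proof -
  have coarse: "\<lfloor>v * 2 ^ i / L\<rfloor> = \<lfloor>v * 2 ^ j / L\<rfloor> div 2 ^ (j - i)" for v :: real
  proof -
    have "(2::real) ^ j = 2 ^ i * 2 ^ (j - i)" using assms(1) by (simp flip: power_add)
    then have "v * 2 ^ i / L = (v * 2 ^ j / L) / real_of_int (2 ^ (j - i))" by simp
    then show ?thesis using floor_divide_real_eq_div[of "2 ^ (j - i)" "v * 2 ^ j / L"] by simp
  qed
  have "\<lfloor>(x \<bullet> b) * 2 ^ j / L\<rfloor> = \<lfloor>(y \<bullet> b) * 2 ^ j / L\<rfloor>" if "b \<in> Basis" for b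
    using fun_cong[OF assms(2), of b] that by (simp add: dyadic_index_def)
  then show ?thesis unfolding dyadic_index_def coarse by (auto intro!: restrict_ext)
qed

lemma dyadic_index_eq_norm_le:
  fixes x y :: "'a::euclidean_space"
  assumes L: "0 < L" and eq: "dyadic_index L j x = dyadic_index L j y"
  shows "norm (x - y) \<le> real DIM('a) * (L / 2 ^ j)"
proof -
  have "norm (x - y) \<le> (\<Sum>b\<in>Basis. \<bar>(x - y) \<bullet> b\<bar>)" by (rule norm_le_l1)
  also have "\<dots> \<le> real DIM('a) * (L / 2 ^ j)"
  proof (rule sum_bounded_above)
    fix b :: 'a assume b: "b \<in> Basis"
    then have "\<lfloor>(x \<bullet> b) * 2 ^ j / L\<rfloor> = \<lfloor>(y \<bullet> b) * 2 ^ j / L\<rfloor>"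
      using fun_cong[OF eq, of b] by (simp add: dyadic_index_def)
    then have "\<bar>(x \<bullet> b) * 2 ^ j / L - (y \<bullet> b) * 2 ^ j / L\<bar> < 1" by linarith
    moreover have "(x \<bullet> b) * 2 ^ j / L - (y \<bullet> b) * 2 ^ j / L = ((x - y) \<bullet> b) / (L / 2 ^ j)"
      by (simp add: inner_diff_left diff_divide_distrib left_diff_distrib)
    ultimately show "\<bar>(x - y) \<bullet> b\<bar> \<le> L / 2 ^ j"
      using L by (simp add: abs_divide abs_mult pos_le_divide_eq)
  qed
  finally show ?thesis .
qed

text \<open>Used with \<open>N = 1\<close>, which gives the \<open>3 ^ DIM('a)\<close> cubes that a
  ball can meet, and with large \<open>N\<close>, which shows that a bounded set meets finitely many
  cubes.\<close>

lemma dyadic_index_near: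
  fixes x y :: "'a::euclidean_space"
  assumes L: "0 < L" and d: "dist x y \<le> real N * (L / 2 ^ j)"
  shows "dyadic_index L j y \<in> Pi\<^sub>E Basis (\<lambda>b. {dyadic_index L j x b - int N..dyadic_index L j x b + int N})"
proof -
  have "\<lfloor>(y \<bullet> b) * 2 ^ j / L\<rfloor> \<in> {\<lfloor>(x \<bullet> b) * 2 ^ j / L\<rfloor> - int N..\<lfloor>(x \<bullet> b) * 2 ^ j / L\<rfloor> + int N}"
    if b: "b \<in> Basis" for b
  proof -
    have "\<bar>(x - y) \<bullet> b\<bar> \<le> real N * (L / 2 ^ j)"
      using Basis_le_norm[OF b, of "x - y"] d by (simp add: dist_norm)
    then have "\<bar>((x - y) \<bullet> b) / (L / 2 ^ j)\<bar> \<le> real N"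
      using L by (simp add: abs_divide abs_mult pos_divide_le_eq pos_le_divide_eq)
    moreover have "(x \<bullet> b) * 2 ^ j / L - (y \<bullet> b) * 2 ^ j / L = ((x - y) \<bullet> b) / (L / 2 ^ j)"
      by (simp add: inner_diff_left diff_divide_distrib left_diff_distrib)
    ultimately have "\<bar>(x \<bullet> b) * 2 ^ j / L - (y \<bullet> b) * 2 ^ j / L\<bar> \<le> real N" by simp
    then have "(y \<bullet> b) * 2 ^ j / L \<le> (x \<bullet> b) * 2 ^ j / L + of_int (int N)"
      "(x \<bullet> b) * 2 ^ j / L + of_int (- int N) \<le> (y \<bullet> b) * 2 ^ j / L" by auto
    from this[THEN floor_mono] show ?thesis unfolding floor_add_int[symmetric] by auto
  qed
  then show ?thesis by (auto simp: dyadic_index_def)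
qed

text \<open>\<open>X\<close> keeps one point of \<open>E\<close> from each occupied cube of the
  finest level. The saturated cells, enlarged to all points of \<open>E\<close> in their cubes,
  cover \<open>E\<close> with total gauge at most \<open>DIM('a) powr s\<close> times the mass,
  which bounds the mass from below; the ball bound counts neighbouring cubes.\<close>

lemma discrete_frostman:
  fixes E :: "'a::euclidean_space set"
  assumes bE: "bounded E" and s: "0 \<le> s" and L: "0 < L"
  obtains X \<mu> where "finite X" "X \<subseteq> E" "\<And>x. x \<in> X \<Longrightarrow> 0 < \<mu> x"
    "hausdorff_content s (real DIM('a) * L) E \<le> ennreal (real DIM('a) powr s * sum \<mu> X)"
    "\<And>x j. j \<le> m \<Longrightarrow> sum \<mu> {y\<in>X. dist x y \<le> L / 2 ^ j} \<le> 3 ^ DIM('a) * (L / 2 ^ j) powr s"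
proof -
  let ?p = "dyadic_index L" and ?b = "\<lambda>j. (L / 2 ^ j) powr s" and ?D = "real DIM('a)"
  have "finite (?p m ` E)"
  proof -
    obtain r where r: "E \<subseteq> ball 0 r" using bounded_subset_ballD[OF bE] by blast
    obtain N :: nat where N: "r / (L / 2 ^ m) \<le> real N" using real_arch_simple by blast
    have "?p m ` E \<subseteq> Pi\<^sub>E Basis (\<lambda>b. {?p m 0 b - int N..?p m 0 b + int N})"
    proof clarify
      fix x assume "x \<in> E"
      then have "dist 0 x \<le> r" using r by auto
      also have "r \<le> real N * (L / 2 ^ m)" using N L by (simp add: pos_divide_le_eq pos_le_divide_eq)
      finally have "dist 0 x \<le> real N * (L / 2 ^ m)" .
      then show "?p m x \<in> Pi\<^sub>E Basis (\<lambda>b. {?p m 0 b - int N..?p m 0 b + int N})"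
        by (rule dyadic_index_near[OF L])
    qed
    then show ?thesis by (rule finite_subset) (auto intro!: finite_PiE)
  qed
  then obtain X where X: "X \<subseteq> E" "finite X" "?p m ` E = ?p m ` X"
    using finite_subset_image[of "?p m ` E" "?p m" E] by blast
  have b: "0 < ?b j" for j using L by simp
  have "\<exists>\<mu>. (\<forall>x\<in>X. 0 < \<mu> x) \<and>
      (\<forall>j\<in>{0..m}. \<forall>x\<in>X. sum \<mu> {y\<in>X. ?p j y = ?p j x} \<le> ?b j) \<and>
      (\<forall>x\<in>X. \<exists>j\<in>{0..m}. sum \<mu> {y\<in>X. ?p j y = ?p j x} = ?b j)"
    using X(2) b by (rule frostman_weights) (auto intro: dyadic_index_nested)
  then obtain \<mu> where \<mu>': "\<forall>x\<in>X. 0 < \<mu> x"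
    "\<forall>j\<in>{0..m}. \<forall>x\<in>X. sum \<mu> {y\<in>X. ?p j y = ?p j x} \<le> ?b j"
    "\<forall>x\<in>X. \<exists>j\<in>{0..m}. sum \<mu> {y\<in>X. ?p j y = ?p j x} = ?b j"
    by blast
  then have \<mu>: "\<And>x. x \<in> X \<Longrightarrow> 0 < \<mu> x"
    "\<And>j x. j \<le> m \<Longrightarrow> x \<in> X \<Longrightarrow> sum \<mu> {y\<in>X. ?p j y = ?p j x} \<le> ?b j"
    "\<And>x. x \<in> X \<Longrightarrow> \<exists>j\<le>m. sum \<mu> {y\<in>X. ?p j y = ?p j x} = ?b j"
    by (simp_all add: Bex_def)
  have "\<exists>Y J. Y \<subseteq> X \<and> (\<forall>y\<in>Y. J y \<le> m) \<and> X = (\<Union>y\<in>Y. {x\<in>X. ?p (J y) x = ?p (J y) y}) \<and>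
      sum \<mu> X = (\<Sum>y\<in>Y. ?b (J y))"
    by (rule saturated_cells_partition[OF X(2)]) (fact dyadic_index_nested, fact \<mu>(3))
  then obtain Y J where Y: "Y \<subseteq> X" "\<forall>y\<in>Y. J y \<le> m"
    "X = (\<Union>y\<in>Y. {x\<in>X. ?p (J y) x = ?p (J y) y})" "sum \<mu> X = (\<Sum>y\<in>Y. ?b (J y))"
    by (elim exE conjE)
  let ?h = "\<lambda>y. {e\<in>E. ?p (J y) e = ?p (J y) y}"
  have bh: "bounded (?h y)" for y by (rule bounded_subset[OF bE]) auto
  have dh: "diameter (?h y) \<le> ?D * (L / 2 ^ J y)" for y
  proof (rule diameter_le)
    show "norm (x - z) \<le> ?D * (L / 2 ^ J y)" if "x \<in> ?h y" "z \<in> ?h y" for x z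
      using that by (intro dyadic_index_eq_norm_le[OF L]) simp
  qed (use L in simp)
  have "hausdorff_content s (?D * L) E \<le> (\<Sum>y\<in>Y. hausdorff_gauge s (?h y))"
  proof (rule hausdorff_content_le_finite[OF _ _ bh])
    show "finite Y" using X(2) Y(1) finite_subset by blast
    show "E \<subseteq> (\<Union>y\<in>Y. ?h y)"
    proof
      fix e assume e: "e \<in> E"
      then obtain x where x: "x \<in> X" "?p m e = ?p m x" using X(3) by (metis imageE imageI)
      then obtain y where y: "y \<in> Y" "?p (J y) x = ?p (J y) y" using Y(3) by blast
      have "?p (J y) e = ?p (J y) x" by (rule dyadic_index_nested[OF _ x(2)]) (use Y(2) y in simp)
      then show "e \<in> (\<Union>y\<in>Y. ?h y)" using e y by auto
    qed
    show "diameter (?h y) \<le> ?D * L" for y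
    proof -
      have "L / 2 ^ J y \<le> L" using L by (simp add: divide_le_eq)
      then have "?D * (L / 2 ^ J y) \<le> ?D * L" by (rule mult_left_mono) simp
      then show ?thesis using dh[of y] by linarith
    qed
    show "0 \<le> ?D * L" using L by simp
  qed
  also have "\<dots> \<le> (\<Sum>y\<in>Y. ennreal (?D powr s * ?b (J y)))"
  proof (rule sum_mono)
    fix y
    have "diameter (?h y) powr s \<le> (?D * (L / 2 ^ J y)) powr s"
      using dh[of y] diameter_ge_0[OF bh[of y]] s by (intro powr_mono2)
    also have "\<dots> = ?D powr s * ?b (J y)" using L by (intro powr_mult)
    finally show "hausdorff_gauge s (?h y) \<le> ennreal (?D powr s * ?b (J y))"
      using L by (auto simp: hausdorff_gauge_def ennreal_leI)
  qed
  also have "\<dots> = ennreal (?D powr s * sum \<mu> X)"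
    by (simp add: sum_ennreal Y(4) sum_distrib_left)
  finally have mass: "hausdorff_content s (?D * L) E \<le> ennreal (?D powr s * sum \<mu> X)" .
  have ball: "sum \<mu> {y\<in>X. dist x y \<le> L / 2 ^ j} \<le> 3 ^ DIM('a) * ?b j" if j: "j \<le> m" for x j
  proof -
    let ?I = "Pi\<^sub>E Basis (\<lambda>b. {?p j x b - 1..?p j x b + 1})"
    have I: "finite ?I" "card ?I = 3 ^ DIM('a)" by (auto simp: card_PiE intro!: finite_PiE)
    have "{y\<in>X. dist x y \<le> L / 2 ^ j} \<subseteq> (\<Union>q\<in>?I. {y\<in>X. ?p j y = q})"
      using dyadic_index_near[OF L, of x _ 1 j] by auto
    then have "sum \<mu> {y\<in>X. dist x y \<le> L / 2 ^ j} \<le> sum \<mu> (\<Union>q\<in>?I. {y\<in>X. ?p j y = q})"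
      using X(2) I(1) \<mu>(1) by (intro sum_mono2) (auto intro: less_imp_le)
    also have "\<dots> = (\<Sum>q\<in>?I. sum \<mu> {y\<in>X. ?p j y = q})"
      using X(2) I(1) by (intro sum.UNION_disjoint) auto
    also have "\<dots> \<le> (\<Sum>q\<in>?I. ?b j)"
    proof (rule sum_mono)
      fix q
      show "sum \<mu> {y\<in>X. ?p j y = q} \<le> ?b j"
      proof (cases "{y\<in>X. ?p j y = q} = {}")
        case False
        then obtain z where "z \<in> X" "?p j z = q" by blast
        then show ?thesis using \<mu>(2)[OF j, of z] by simp
      next
        case True
        then show ?thesis by (simp only: sum.empty) (rule powr_ge_zero)
      qed
    qed
    also have "\<dots> = 3 ^ DIM('a) * ?b j" using I(2) by simp
    finally show ?thesis .
  qed
  show ?thesis by (rule that[OF X(2,1) \<mu>(1) mass ball])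
qed

text \<open>Links the hypothesis on the measure to the content at a coarse scale in
  \<open>discrete_frostman\<close>. A cover of tiny total gauge consists of tiny sets, so content
  that vanishes at one scale vanishes at all.\<close>

lemma hausdorff_content_pos:
  assumes s: "0 \<le> s" and pos: "0 < hausdorff_outer s E" and d: "0 < d"
  shows "0 < hausdorff_content s d E"
proof (rule ccontr)
  assume "\<not> ?thesis"
  then have 0: "hausdorff_content s d E = 0" by simp
  have "hausdorff_content s d' E \<le> 0 + ennreal \<eta>" if d': "0 < d'" and \<eta>: "0 < \<eta>" for d' \<eta>
  proof -
    \<comment> \<open>The bound \<open>d' powr s\<close> forces every covering set to have diameter
      at most \<open>d'\<close>. For \<open>s = 0\<close> a nonempty set has gauge
      \<open>1 = d' powr 0\<close>, so all covering sets are empty.\<close>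
    define \<epsilon> where "\<epsilon> = min \<eta> (d' powr s)"
    have \<epsilon>: "0 < \<epsilon>" using d' \<eta> by (simp add: \<epsilon>_def)
    then have "hausdorff_content s d E < ennreal \<epsilon>" by (simp add: 0)
    then obtain C where C: "E \<subseteq> (\<Union>i. C i)" "\<And>i. bounded (C i)" "\<And>i. diameter (C i) \<le> d"
      "(\<Sum>i. hausdorff_gauge s (C i)) < ennreal \<epsilon>"
      by (rule hausdorff_content_less) blast
    have g: "hausdorff_gauge s (C i) < ennreal \<epsilon>" for i
      using C(4) by (rule le_less_trans[rotated])
        (use sum_le_suminf[of "\<lambda>i. hausdorff_gauge s (C i)" "{i}"] in simp)
    have "diameter (C i) \<le> d'" for i
    proof (cases "C i = {}")
      case False
      have "ennreal \<epsilon> \<le> ennreal (d' powr s)" by (simp add: \<epsilon>_def ennreal_leI)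
      with g[of i] have g': "hausdorff_gauge s (C i) < ennreal (d' powr s)" by (rule less_le_trans)
      show ?thesis
      proof (cases "s = 0")
        case True
        then show ?thesis using g' False d' by (simp add: hausdorff_gauge_def)
      next
        case sn: False
        then have "diameter (C i) powr s < d' powr s"
          using g' False by (simp add: hausdorff_gauge_def ennreal_less_iff)
        then show ?thesis using s sn d' by (meson linorder_not_less powr_mono2 less_imp_le)
      qed
    qed (use d' in simp)
    then have "hausdorff_content s d' E \<le> (\<Sum>i. hausdorff_gauge s (C i))"
      by (rule hausdorff_content_le[OF C(1,2)])
    also have "\<dots> \<le> ennreal \<epsilon>" using C(4) by simp
    also have "\<dots> \<le> 0 + ennreal \<eta>" by (simp add: \<epsilon>_def ennreal_leI)
    finally show ?thesis .
  qed
  note le = this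
  have "hausdorff_content s d' E \<le> 0" if "0 < d'" for d'
  proof (rule ennreal_le_epsilon)
    fix e :: real assume "0 < e"
    with that show "hausdorff_content s d' E \<le> 0 + ennreal e" by (rule le)
  qed
  then have "hausdorff_outer s E \<le> 0"
    unfolding hausdorff_outer_def by (intro SUP_least) auto
  with pos show False by simp
qed

text \<open>A maximal separated \<open>Y\<close> is a net, so each \<open>x\<close> is assigned a
  nearby \<open>g x\<close> in \<open>Y\<close>. Cauchy--Schwarz over the groups with common
  \<open>g x\<close> bounds the squared mass, and two members of a group have images within
  \<open>2 * \<eta>\<close>.\<close>

lemma weighted_separated_subset:
  fixes f :: "'x \<Rightarrow> 'b::metric_space" and \<mu> :: "'x \<Rightarrow> real"
  assumes X: "finite X" and \<mu>: "\<And>x. x \<in> X \<Longrightarrow> 0 \<le> \<mu> x" and \<eta>: "0 < \<eta>"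
  obtains Y where "Y \<subseteq> X" "\<And>x y. x \<in> Y \<Longrightarrow> y \<in> Y \<Longrightarrow> x \<noteq> y \<Longrightarrow> \<eta> \<le> dist (f x) (f y)"
    "(sum \<mu> X)\<^sup>2 \<le> real (card Y) * (\<Sum>x\<in>X. \<Sum>y\<in>X. \<mu> x * \<mu> y * of_bool (dist (f x) (f y) \<le> 2 * \<eta>))"
proof -
  define sep where "sep Y \<longleftrightarrow> (\<forall>x\<in>Y. \<forall>y\<in>Y. x \<noteq> y \<longrightarrow> \<eta> \<le> dist (f x) (f y))" for Y
  define F where "F = {Y. Y \<subseteq> X \<and> sep Y}"
  have "finite F" using X by (simp add: F_def)
  moreover have "F \<noteq> {}" by (auto simp: F_def sep_def)
  ultimately have "\<exists>Y\<in>F. \<forall>Y'\<in>F. Y \<subseteq> Y' \<longrightarrow> Y = Y'" by (rule finite_has_maximal)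
  then obtain Y where Y: "Y \<in> F" "\<forall>Y'\<in>F. Y \<subseteq> Y' \<longrightarrow> Y = Y'" by blast
  have YX: "Y \<subseteq> X" and sepY: "sep Y" using Y(1) by (auto simp: F_def)
  have fY: "finite Y" using X YX finite_subset by blast
  have "\<exists>y\<in>Y. dist (f x) (f y) < \<eta>" if x: "x \<in> X" for x
  proof (rule ccontr)
    assume neg: "\<not> ?thesis"
    then have "sep (insert x Y)" using sepY by (auto simp: sep_def dist_commute not_less)
    then have "insert x Y = Y" using Y(2) x YX unfolding F_def by blast
    with neg \<eta> show False by (metis dist_self insertI1)
  qed
  then obtain g where g: "\<And>x. x \<in> X \<Longrightarrow> g x \<in> Y" "\<And>x. x \<in> X \<Longrightarrow> dist (f x) (f (g x)) < \<eta>"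
    by metis
  define S where "S y = sum \<mu> {x\<in>X. g x = y}" for y
  have grp: "(\<Sum>y\<in>Y. sum h {x\<in>X. g x = y}) = sum h X" for h :: "'x \<Rightarrow> real"
    using X fY g(1) by (intro sum.group) auto
  have "sum \<mu> X = (\<Sum>y\<in>Y. 1 * S y)" by (simp add: S_def grp)
  then have "(sum \<mu> X)\<^sup>2 = (\<Sum>y\<in>Y. 1 * S y)\<^sup>2" by simp
  also have "\<dots> \<le> (\<Sum>y\<in>Y. 1\<^sup>2) * (\<Sum>y\<in>Y. (S y)\<^sup>2)" by (rule Cauchy_Schwarz_ineq_sum)
  also have "\<dots> = real (card Y) * (\<Sum>y\<in>Y. (S y)\<^sup>2)" by simp
  also have "(\<Sum>y\<in>Y. (S y)\<^sup>2) = (\<Sum>y\<in>Y. sum (\<lambda>x. \<mu> x * S (g x)) {x\<in>X. g x = y})"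
    by (intro sum.cong) (auto simp: power2_eq_square S_def sum_distrib_right)
  also have "\<dots> = (\<Sum>x\<in>X. \<mu> x * S (g x))" by (rule grp)
  also have "\<dots> \<le> (\<Sum>x\<in>X. \<Sum>y\<in>X. \<mu> x * \<mu> y * of_bool (dist (f x) (f y) \<le> 2 * \<eta>))"
  proof (rule sum_mono)
    fix x assume x: "x \<in> X"
    have "S (g x) = (\<Sum>y\<in>X. \<mu> y * of_bool (g y = g x))"
      unfolding S_def using X by (intro sum.mono_neutral_cong_left) auto
    also have "\<dots> \<le> (\<Sum>y\<in>X. \<mu> y * of_bool (dist (f x) (f y) \<le> 2 * \<eta>))"
    proof (intro sum_mono mult_left_mono \<mu>)
      fix y assume y: "y \<in> X"
      have "dist (f x) (f y) \<le> 2 * \<eta>" if "g y = g x"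
        using g(2)[OF x] g(2)[OF y] dist_triangle2[of "f x" "f y" "f (g x)"] that by simp
      then show "of_bool (g y = g x) \<le> (of_bool (dist (f x) (f y) \<le> 2 * \<eta>) :: real)" by auto
    qed
    finally have "\<mu> x * S (g x) \<le> \<mu> x * (\<Sum>y\<in>X. \<mu> y * of_bool (dist (f x) (f y) \<le> 2 * \<eta>))"
      using \<mu>[OF x] by (rule mult_left_mono)
    then show "\<mu> x * S (g x) \<le> (\<Sum>y\<in>X. \<mu> x * \<mu> y * of_bool (dist (f x) (f y) \<le> 2 * \<eta>))"
      by (simp add: sum_distrib_left mult.assoc)
  qed
  finally have "(sum \<mu> X)\<^sup>2 \<le> real (card Y) * (\<Sum>x\<in>X. \<Sum>y\<in>X. \<mu> x * \<mu> y * of_bool (dist (f x) (f y) \<le> 2 * \<eta>))"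
    by (simp add: mult_left_mono)
  then show ?thesis using that[OF YX] sepY unfolding sep_def by blast
qed

section \<open>Visibility\<close>

text \<open>The point at distance \<open>norm (x - a)\<close> from \<open>a\<close> in the direction
  \<open>\<theta>\<close> is displaced from \<open>x\<close> by at most \<open>M\<close> times the
  difference of the directions.\<close>

lemma cap_subset_radial_proj_nbhd:
  fixes x a :: "'a::real_normed_vector"
  assumes x: "x \<in> E" "x \<noteq> a" "norm (x - a) \<le> M" and r: "0 < r"
  shows "sphere 0 1 \<inter> ball (radial_proj a x) (r / M) \<subseteq> radial_proj a ` (nbhd E r - {a})"
proof
  fix \<theta> assume \<theta>: "\<theta> \<in> sphere 0 1 \<inter> ball (radial_proj a x) (r / M)"
  define t where "t = norm (x - a)"
  have t: "0 < t" "t \<le> M" using x by (auto simp: t_def)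
  define z where "z = a + t *\<^sub>R \<theta>"
  have n\<theta>: "norm \<theta> = 1" using \<theta> by simp
  have nz: "norm (z - a) = t" using n\<theta> t by (simp add: z_def)
  have "z - x = t *\<^sub>R (\<theta> - radial_proj a x)"
    using t by (simp add: z_def radial_proj_def t_def[symmetric] algebra_simps)
  then have "dist z x = t * dist (radial_proj a x) \<theta>" using t by (simp add: dist_norm norm_minus_commute)
  also have "\<dots> < t * (r / M)" using \<theta> t by (intro mult_strict_left_mono) auto
  also have "\<dots> \<le> M * (r / M)" using t r by (intro mult_right_mono) auto
  also have "\<dots> = r" using t by simp
  finally have "z \<in> nbhd E r" using infdist_le[OF x(1), of z] by (simp add: nbhd_def)
  moreover have "z \<noteq> a" using nz t by auto
  moreover have "radial_proj a z = \<theta>" unfolding radial_proj_def nz using t by (simp add: z_def)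
  ultimately show "\<theta> \<in> radial_proj a ` (nbhd E r - {a})" by blast
qed

text \<open>Directions separated by \<open>2 * r / M\<close> carry disjoint caps of radius
  \<open>r / M\<close> inside the projection of \<open>nbhd E r\<close>. Choosing them by
  \<open>weighted_separated_subset\<close> involves the pairs within twice that separation, whence
  \<open>4 * r / M\<close>.\<close>

lemma vis_nbhd_lower:
  fixes a :: "'a::euclidean_space" and X :: "'a set"
  assumes n: "2 \<le> DIM('a)" and X: "finite X" "X \<subseteq> E" "\<And>x. x \<in> X \<Longrightarrow> 0 < \<mu> x"
    and a: "a \<notin> E" "\<And>x. x \<in> E \<Longrightarrow> norm (x - a) \<le> M" and r: "0 < r" "r / M \<le> 1 / 2" and M: "0 < M"
    and q: "0 < q" "(\<Sum>x\<in>X. \<Sum>y\<in>X. \<mu> x * \<mu> y * of_bool (dist (radial_proj a x) (radial_proj a y) \<le> 4 * r / M)) \<le> q"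
  shows "ennreal (1 / (4 * 16 ^ DIM('a)) * (r / M) ^ (DIM('a) - 1) * ((sum \<mu> X)\<^sup>2 / q)) \<le> vis a (nbhd E r)"
proof -
  let ?f = "radial_proj a" and ?\<delta> = "r / M"
  have \<delta>: "0 < ?\<delta>" using r M by simp
  have \<mu>: "0 \<le> \<mu> x" if "x \<in> X" for x using X(3)[OF that] by simp
  have \<eta>: "0 < 2 * ?\<delta>" using \<delta> by simp
  obtain Y where Y: "Y \<subseteq> X" "\<And>x y. x \<in> Y \<Longrightarrow> y \<in> Y \<Longrightarrow> x \<noteq> y \<Longrightarrow> 2 * ?\<delta> \<le> dist (?f x) (?f y)"
    "(sum \<mu> X)\<^sup>2 \<le> real (card Y) * (\<Sum>x\<in>X. \<Sum>y\<in>X. \<mu> x * \<mu> y * of_bool (dist (?f x) (?f y) \<le> 2 * (2 * ?\<delta>)))"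
    by (rule weighted_separated_subset[where \<mu> = \<mu> and f = ?f, OF X(1) \<mu> \<eta>]) (assumption | rule that)+
  have inj: "inj_on ?f Y"
  proof (rule inj_onI, rule ccontr)
    fix x y assume "x \<in> Y" "y \<in> Y" "?f x = ?f y" "x \<noteq> y"
    with Y(2)[of x y] \<delta> show False by simp
  qed
  have xa: "x \<in> E" "x \<noteq> a" if "x \<in> Y" for x using that Y(1) X(2) a(1) by auto
  have "(sum \<mu> X)\<^sup>2 \<le> real (card Y) * q"
    using Y(3) mult_left_mono[OF q(2), of "real (card Y)"] by simp
  then have "(sum \<mu> X)\<^sup>2 / q \<le> real (card (?f ` Y))"
    using q(1) by (simp add: pos_divide_le_eq card_image[OF inj])
  then have "ennreal (1 / (4 * 16 ^ DIM('a)) * ?\<delta> ^ (DIM('a) - 1) * ((sum \<mu> X)\<^sup>2 / q)) \<le>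
      ennreal (1 / (4 * 16 ^ DIM('a)) * ?\<delta> ^ (DIM('a) - 1) * card (?f ` Y))"
    using \<delta> by (intro ennreal_leI mult_left_mono) auto
  also have "\<dots> \<le> hausdorff_outer (real (DIM('a) - 1)) (?f ` (nbhd E r - {a}))"
  proof (rule hausdorff_outer_caps_lower[OF n \<delta> r(2)])
    show "finite (?f ` Y)" using X(1) Y(1) finite_subset by blast
    show "norm p = 1" if "p \<in> ?f ` Y" for p
      using that xa by (auto simp: radial_proj_def)
    show "2 * ?\<delta> \<le> dist p q" if "p \<in> ?f ` Y" "q \<in> ?f ` Y" "p \<noteq> q" for p q
      using that Y(2) by blast
    show "sphere 0 1 \<inter> ball p ?\<delta> \<subseteq> ?f ` (nbhd E r - {a})" if "p \<in> ?f ` Y" for p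
      using that xa a(2) r(1) cap_subset_radial_proj_nbhd by blast
  qed
  finally show ?thesis by (simp add: vis_def)
qed

section \<open>Energy of the discrete measure and averaging over the surface\<close>

lemma closed_radial_proj_close:
  assumes "closed A" "x \<notin> A" "y \<notin> A"
  shows "closed {a \<in> A. dist (radial_proj a x) (radial_proj a y) \<le> \<delta>}"
proof (rule continuous_on_closed_Collect_le[OF _ continuous_on_const assms(1)])
  show "continuous_on A (\<lambda>a. dist (radial_proj a x) (radial_proj a y))"
    unfolding radial_proj_def using assms(2,3) by (intro continuous_intros) auto
qed

text \<open>\<open>g\<close> stands for the measure of the vantage points that see two points at
  distance \<open>d\<close> within \<open>\<delta>\<close>. It is dominated by a step function
  because the mass of balls is controlled only at the radii \<open>L / 2 ^ j\<close> with
  \<open>j \<le> m\<close>.\<close>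

lemma dyadic_kernel_le:
  fixes d L \<delta> g :: real
  assumes L: "0 < L" and d: "0 \<le> d" "d \<le> L" and \<delta>: "0 < \<delta>" and g: "0 \<le> h" "0 \<le> C" "g \<le> h" "0 < d \<Longrightarrow> g \<le> C * (\<delta> / d) ^ k"
  shows "g \<le> (\<Sum>j\<le>m. (h + C * (2 * \<delta> * 2 ^ m / L) ^ k) * (2 ^ j / 2 ^ m) ^ k * of_bool (d \<le> L / 2 ^ j))"
proof -
  let ?C = "h + C * (2 * \<delta> * 2 ^ m / L) ^ k"
  let ?t = "\<lambda>j. ?C * (2 ^ j / 2 ^ m) ^ k * of_bool (d \<le> L / 2 ^ j)"
  have C: "0 \<le> ?C" using g L \<delta> by simp
  have "\<exists>j\<le>m. g \<le> ?t j"
  proof (cases "d \<le> L / 2 ^ m")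
    case True
    then have "g \<le> ?t m" using g L \<delta> by (simp add: add_increasing2)
    then show ?thesis by blast
  next
    case False
    \<comment> \<open>The first level whose scale is below \<open>d\<close>; it is positive because
      \<open>d \<le> L\<close>. Its predecessor \<open>i\<close> satisfies
      \<open>L / 2 ^ Suc i < d\<close> and \<open>d \<le> L / 2 ^ i\<close>, and the term of
      \<open>i\<close> alone dominates \<open>g\<close>.\<close>
    define j where "j = (LEAST j. \<not> d \<le> L / 2 ^ j)"
    have j: "\<not> d \<le> L / 2 ^ j" "j \<le> m"
      unfolding j_def
      by (rule LeastI[of "\<lambda>j. \<not> d \<le> L / 2 ^ j", OF False])
        (rule Least_le[of "\<lambda>j. \<not> d \<le> L / 2 ^ j", OF False])
    then have "j \<noteq> 0" using d by (intro notI) simp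
    then obtain i where i: "j = Suc i" by (cases j) auto
    then have di: "d \<le> L / 2 ^ i" using not_less_Least[of i "\<lambda>j. \<not> d \<le> L / 2 ^ j"] by (simp add: j_def)
    have dj: "L / 2 ^ Suc i < d" using j i by simp
    then have d0: "0 < d" using L by (meson divide_pos_pos less_trans zero_less_numeral zero_less_power)
    have "\<delta> / d \<le> \<delta> / (L / 2 ^ Suc i)"
      using dj \<delta> L d0 by (intro divide_left_mono) auto
    also have "\<dots> = (2 * \<delta> * 2 ^ m / L) * (2 ^ i / 2 ^ m)" using L by simp
    finally have "(\<delta> / d) ^ k \<le> ((2 * \<delta> * 2 ^ m / L) * (2 ^ i / 2 ^ m)) ^ k"
      using \<delta> d0 by (intro power_mono) auto
    then have "C * (\<delta> / d) ^ k \<le> C * ((2 * \<delta> * 2 ^ m / L) ^ k * (2 ^ i / 2 ^ m) ^ k)"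
      using g(2) unfolding power_mult_distrib by (rule mult_left_mono)
    also have "\<dots> \<le> ?C * (2 ^ i / 2 ^ m) ^ k"
      using g(1) unfolding mult.assoc[symmetric] by (intro mult_right_mono) auto
    finally have "g \<le> ?t i" using g(4)[OF d0] di by simp
    then show ?thesis using j i by (intro exI[of _ i]) simp
  qed
  then obtain j where j: "j \<le> m" "g \<le> ?t j" by blast
  have "?t j \<le> (\<Sum>j\<le>m. ?t j)"
    using j C by (intro member_le_sum) auto
  with j show ?thesis by linarith
qed

text \<open>Exchanging the sums over points and scales leaves one ball mass per scale; multiplying
  \<open>(2 ^ j / 2 ^ m) ^ k\<close> by \<open>(L / 2 ^ j) powr s\<close> produces the exponent
  \<open>real k - s\<close>.\<close>

lemma frostman_energy_le:
  fixes X :: "'a::euclidean_space set"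
  assumes X: "finite X" "\<And>x. x \<in> X \<Longrightarrow> 0 < \<mu> x" and L: "0 < L" and s: "0 \<le> s" and C: "0 \<le> C"
    and ball: "\<And>x j. j \<le> m \<Longrightarrow> sum \<mu> {y\<in>X. dist x y \<le> L / 2 ^ j} \<le> B * (L / 2 ^ j) powr s"
    and g: "\<And>x y. x \<in> X \<Longrightarrow> y \<in> X \<Longrightarrow> g x y \<le> (\<Sum>j\<le>m. C * (2 ^ j / 2 ^ m) ^ k * of_bool (dist x y \<le> L / 2 ^ j))"
  shows "(\<Sum>x\<in>X. \<Sum>y\<in>X. \<mu> x * \<mu> y * g x y) \<le>
    sum \<mu> X * (C * B * L powr s / (2 ^ m) ^ k * (\<Sum>j\<le>m. (2 ^ j) powr (real k - s)))"
  unfolding sum_distrib_right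
proof (rule sum_mono)
  fix x assume x: "x \<in> X"
  have "(\<Sum>y\<in>X. \<mu> y * g x y) \<le>
      (\<Sum>y\<in>X. \<mu> y * (\<Sum>j\<le>m. C * (2 ^ j / 2 ^ m) ^ k * of_bool (dist x y \<le> L / 2 ^ j)))"
    using g[OF x] X(2) by (intro sum_mono mult_left_mono) (auto intro: less_imp_le)
  also have "\<dots> = (\<Sum>y\<in>X. \<Sum>j\<le>m. C * (2 ^ j / 2 ^ m) ^ k * (\<mu> y * of_bool (dist x y \<le> L / 2 ^ j)))"
    by (simp add: sum_distrib_left mult_ac)
  also have "\<dots> = (\<Sum>j\<le>m. \<Sum>y\<in>X. C * (2 ^ j / 2 ^ m) ^ k * (\<mu> y * of_bool (dist x y \<le> L / 2 ^ j)))"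
    by (rule sum.swap)
  also have "\<dots> = (\<Sum>j\<le>m. C * (2 ^ j / 2 ^ m) ^ k * sum \<mu> {y\<in>X. dist x y \<le> L / 2 ^ j})"
  proof (rule sum.cong)
    fix j
    have "(\<Sum>y\<in>X. \<mu> y * of_bool (dist x y \<le> L / 2 ^ j)) = sum \<mu> {y\<in>X. dist x y \<le> L / 2 ^ j}"
      using X(1) by (intro sum.mono_neutral_cong_right) auto
    then show "(\<Sum>y\<in>X. C * (2 ^ j / 2 ^ m) ^ k * (\<mu> y * of_bool (dist x y \<le> L / 2 ^ j))) =
      C * (2 ^ j / 2 ^ m) ^ k * sum \<mu> {y\<in>X. dist x y \<le> L / 2 ^ j}"
      by (simp only: sum_distrib_left[symmetric])
  qed simp
  also have "\<dots> \<le> (\<Sum>j\<le>m. C * (2 ^ j / 2 ^ m) ^ k * (B * (L / 2 ^ j) powr s))"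
    using C by (intro sum_mono mult_left_mono ball) auto
  also have "\<dots> = (\<Sum>j\<le>m. C * B * L powr s / (2 ^ m) ^ k * (2 ^ j) powr (real k - s))"
  proof (rule sum.cong)
    fix j
    have "(L / 2 ^ j) powr s = L powr s / (2 ^ j) powr s" using L by (simp add: powr_divide)
    moreover have "((2::real) ^ j) powr (real k - s) = (2 ^ j) ^ k / (2 ^ j) powr s"
      by (simp add: powr_diff powr_realpow)
    ultimately show "C * (2 ^ j / 2 ^ m) ^ k * (B * (L / 2 ^ j) powr s) =
        C * B * L powr s / (2 ^ m) ^ k * (2 ^ j) powr (real k - s)"
      by (simp add: power_divide)
  qed simp
  also have "\<dots> = C * B * L powr s / (2 ^ m) ^ k * (\<Sum>j\<le>m. (2 ^ j) powr (real k - s))"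
    by (simp only: sum_distrib_left)
  finally have "\<mu> x * (\<Sum>y\<in>X. \<mu> y * g x y) \<le>
      \<mu> x * (C * B * L powr s / (2 ^ m) ^ k * (\<Sum>j\<le>m. (2 ^ j) powr (real k - s)))"
    using X(2)[OF x] by (intro mult_left_mono) auto
  then show "(\<Sum>y\<in>X. \<mu> x * \<mu> y * g x y) \<le>
      \<mu> x * (C * B * L powr s / (2 ^ m) ^ k * (\<Sum>j\<le>m. (2 ^ j) powr (real k - s)))"
    by (simp add: sum_distrib_left mult.assoc)
qed

text \<open>The threshold is twice the bound \<open>K / h\<close> for the average, so at most half
  of \<open>A\<close> exceeds it.\<close>

lemma markov_half:
  fixes Q :: "'b \<Rightarrow> real"
  assumes A: "A \<in> sets M" "emeasure M A = ennreal h" "0 < h" and K: "0 < K"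
    and Q: "{a \<in> A. Q a \<le> 2 * K / h} \<in> sets M"
    and int: "(\<integral>\<^sup>+a\<in>A. ennreal (Q a) \<partial>M) \<le> ennreal K"
  shows "ennreal (h / 2) \<le> emeasure M {a \<in> A. Q a \<le> 2 * K / h}"
proof -
  let ?G = "{a \<in> A. Q a \<le> 2 * K / h}"
  have "ennreal (2 * K / h) * emeasure M (A - ?G) = (\<integral>\<^sup>+a. ennreal (2 * K / h) * indicator (A - ?G) a \<partial>M)"
    using A Q by (subst nn_integral_cmult_indicator) auto
  also have "\<dots> \<le> (\<integral>\<^sup>+a\<in>A. ennreal (Q a) \<partial>M)"
    by (intro nn_integral_mono) (auto simp: indicator_def intro!: ennreal_leI)
  also have "\<dots> \<le> ennreal K" by (rule int)
  also have "ennreal K = ennreal (2 * K / h) * ennreal (h / 2)"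
    using A K by (simp add: ennreal_mult[symmetric])
  finally have "emeasure M (A - ?G) \<le> ennreal (h / 2)"
    using A K by (subst (asm) ennreal_mult_le_mult_iff) auto
  then have "ennreal h \<le> ennreal (h / 2) + emeasure M ?G"
  proof -
    have "ennreal h = emeasure M (?G \<union> (A - ?G))" using A(2) by (simp add: Un_absorb1)
    also have "\<dots> \<le> emeasure M ?G + emeasure M (A - ?G)"
      using A(1) Q by (intro emeasure_subadditive) auto
    also have "\<dots> \<le> emeasure M ?G + ennreal (h / 2)"
      using \<open>emeasure M (A - ?G) \<le> _\<close> by (rule add_left_mono)
    finally show ?thesis by (simp add: add.commute)
  qed
  moreover have "ennreal h = ennreal (h / 2) + ennreal (h / 2)" using A by (simp flip: ennreal_plus)
  ultimately show ?thesis by (simp add: ennreal_add_left_cancel_le)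
qed

text \<open>The condition on \<open>r * 2 ^ m\<close> ties the finest dyadic level to
  \<open>r\<close>, which makes \<open>\<kappa>\<close> independent of both. The sum in the
  denominator is left open so that the two ranges of \<open>s\<close> can share the
  argument.\<close>

lemma visibility_integral_lower:
  fixes A E :: "'a::euclidean_space set"
  defines "k \<equiv> DIM('a) - 1" and "H \<equiv> (hausdorff_measure (real (DIM('a) - 1)) :: 'a measure)"
  assumes n: "2 \<le> DIM('a)" and A: "piecewise_smooth_surface A" and disj: "A \<inter> E = {}"
    and bdd: "\<And>a e. a \<in> A \<Longrightarrow> e \<in> E \<Longrightarrow> norm (a - e) \<le> M"
    and s: "0 \<le> s" and E: "0 < hausdorff_outer s E"
    and C: "0 < C" and trans: "\<And>x y \<delta>. x \<in> E \<Longrightarrow> y \<in> E \<Longrightarrow> x \<noteq> y \<Longrightarrow> 0 < \<delta> \<Longrightarrow>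
      hausdorff_outer (real k) {a \<in> A. dist (radial_proj a x) (radial_proj a y) \<le> \<delta>}
        \<le> ennreal (C * (\<delta> / dist x y) ^ k)"
  obtains \<kappa> where "0 < \<kappa>" "\<And>r m. 0 < r \<Longrightarrow> r < 1 / 2 \<Longrightarrow> 1 \<le> r * 2 ^ m \<Longrightarrow> r * 2 ^ m \<le> 2 \<Longrightarrow>
    ennreal (\<kappa> / (\<Sum>j\<le>m. (2 ^ j) powr (real k - s))) \<le> (\<integral>\<^sup>+a\<in>A. vis a (nbhd E r) \<partial>H)"
proof -
  define M' where "M' = max M 1"
  have M': "1 \<le> M'" by (simp add: M'_def)
  have bdd': "norm (e - a) \<le> M'" if "a \<in> A" "e \<in> E" for a e
    using bdd[OF that] by (simp add: M'_def norm_minus_commute)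
  define L where "L = 2 * M'"
  have L: "0 < L" using M' by (simp add: L_def)
  obtain a0 where a0: "a0 \<in> A" using A by (auto simp: piecewise_smooth_surface_def)
  have bE: "bounded E"
    by (rule bounded_subset[of "cball a0 M'"]) (use bdd'[OF a0] in \<open>auto simp: dist_norm norm_minus_commute\<close>)
  have dE: "dist x y \<le> L" if "x \<in> E" "y \<in> E" for x y
    using bdd'[OF a0 that(1)] bdd'[OF a0 that(2)] dist_triangle2[of x y a0]
    by (simp add: L_def dist_norm)
  have clA: "closed A" using compact_piecewise_smooth_surface[OF A] compact_imp_closed by blast
  have AH: "A \<in> sets H" using clA by (simp add: H_def)
  have emH: "emeasure H B = hausdorff_outer (real k) B" if "B \<in> sets borel" for B
    unfolding H_def k_def by (rule emeasure_hausdorff_measure) (use that in auto)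
  define h where "h = enn2real (hausdorff_outer (real k) A)"
  have hfin: "hausdorff_outer (real k) A = ennreal h" and h: "0 < h"
    using piecewise_smooth_surface_hausdorff_finite[OF n A] piecewise_smooth_surface_hausdorff_pos[OF n A]
    by (auto simp: h_def k_def enn2real_positive_iff)
  have HA: "emeasure H A = ennreal h" using emH[of A] clA hfin by simp
  define D where "D = real DIM('a)"
  have D: "0 < D" by (simp add: D_def)
  have "0 < hausdorff_content s (D * L) E"
    using D L by (intro hausdorff_content_pos[OF s E]) simp
  then obtain z where "0 < z" "z < hausdorff_content s (D * L) E" using dense by blast
  then obtain c0 where c0: "0 < c0" "ennreal c0 \<le> hausdorff_content s (D * L) E"
    by (cases z) (auto simp: less_imp_le)
  define B where "B = (3::real) ^ DIM('a)"
  \<comment> \<open>A bound for \<open>C2\<close> below that is uniform in \<open>r\<close>: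
    \<open>2 * \<delta> * 2 ^ m / L\<close> equals \<open>8 * (r * 2 ^ m) / (M' * L)\<close>, and
    \<open>r * 2 ^ m \<le> 2\<close>.\<close>
  define C1 where "C1 = h + C * (16 / (M' * L)) ^ k"
  have C1: "0 < C1" using h C M' L by (simp add: C1_def add_pos_nonneg)
  define cc where "cc = 1 / (4 * 16 ^ DIM('a) :: real)"
  have cc: "0 < cc" by (simp add: cc_def)
  define F where "F = C1 * B * L powr s"
  have F: "0 < F" using C1 L by (simp add: F_def B_def)
  \<comment> \<open>This is \<open>W * v * (h / 2)\<close> for the \<open>v\<close> and
    \<open>W\<close> below, with \<open>T\<close> replaced by its lower bound
    \<open>c0 / D powr s\<close> and \<open>r * 2 ^ m\<close> by \<open>1\<close>.\<close>
  define \<kappa> where "\<kappa> = cc * h\<^sup>2 * (c0 / D powr s) / (4 * M' ^ k * F)"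
  have \<kappa>: "0 < \<kappa>" using cc h c0 D F M' by (simp add: \<kappa>_def)
  show ?thesis
  proof (rule that[OF \<kappa>])
    fix r :: real and m :: nat
    assume r: "0 < r" "r < 1 / 2" and rm: "1 \<le> r * 2 ^ m" "r * 2 ^ m \<le> 2"
    define W where "W = (\<Sum>j\<le>m. (2 ^ j) powr (real k - s))"
    have W: "0 < W" unfolding W_def by (intro sum_pos) auto
    obtain X \<mu> where X: "finite X" "X \<subseteq> E" "\<And>x. x \<in> X \<Longrightarrow> 0 < \<mu> x"
      "hausdorff_content s (real DIM('a) * L) E \<le> ennreal (real DIM('a) powr s * sum \<mu> X)"
      "\<And>x j. j \<le> m \<Longrightarrow> sum \<mu> {y\<in>X. dist x y \<le> L / 2 ^ j} \<le> 3 ^ DIM('a) * (L / 2 ^ j) powr s"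
      by (rule discrete_frostman[OF bE s L, where m = m]) (rule that)
    define T where "T = sum \<mu> X"
    have "ennreal c0 \<le> ennreal (D powr s * T)" using c0(2) X(4) by (simp add: D_def T_def)
    then have c0T: "c0 \<le> D powr s * T" using c0(1) by (simp add: ennreal_le_iff2)
    then have T0: "c0 / D powr s \<le> T" using D by (simp add: field_simps)
    have "0 < c0 / D powr s" using c0(1) D by simp
    then have T: "0 < T" using T0 by linarith
    define \<delta> where "\<delta> = 4 * r / M'"
    have \<delta>: "0 < \<delta>" using r M' by (simp add: \<delta>_def)
    define S where "S x y = {a \<in> A. dist (radial_proj a x) (radial_proj a y) \<le> \<delta>}" for x y
    have S: "S x y \<in> sets borel" if "x \<in> X" "y \<in> X" for x y
      unfolding S_def using that X(2) disj
      by (intro borel_closed closed_radial_proj_close[OF clA]) auto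
    define g where "g x y = enn2real (hausdorff_outer (real k) (S x y))" for x y
    have SA: "hausdorff_outer (real k) (S x y) \<le> ennreal h" for x y
      unfolding hfin[symmetric] by (rule hausdorff_outer_mono) (auto simp: S_def)
    have emS: "emeasure H (S x y) = ennreal (g x y)" if "x \<in> X" "y \<in> X" for x y
      unfolding emH[OF S[OF that]] g_def
      using le_less_trans[OF SA ennreal_less_top, of x y] by simp
    have gh: "g x y \<le> h" for x y
      unfolding g_def using h SA[of x y] by (intro enn2real_leI) auto
    define C2 where "C2 = h + C * (2 * \<delta> * 2 ^ m / L) ^ k"
    have gk: "g x y \<le> (\<Sum>j\<le>m. C2 * (2 ^ j / 2 ^ m) ^ k * of_bool (dist x y \<le> L / 2 ^ j))"
      if "x \<in> X" "y \<in> X" for x y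
      unfolding C2_def
    proof (rule dyadic_kernel_le[OF L _ dE \<delta> _ _ gh])
      assume "0 < dist x y"
      then have "hausdorff_outer (real k) (S x y) \<le> ennreal (C * (\<delta> / dist x y) ^ k)"
        unfolding S_def using that X(2) \<delta> by (intro trans) auto
      then show "g x y \<le> C * (\<delta> / dist x y) ^ k"
        unfolding g_def using C \<delta> by (intro enn2real_leI) auto
    qed (use that X(2) h C in auto)
    have C2: "0 \<le> C2" "C2 \<le> C1"
    proof -
      show "0 \<le> C2" using h C \<delta> L by (simp add: C2_def)
      have "2 * \<delta> * 2 ^ m / L = 8 * (r * 2 ^ m) / (M' * L)" by (simp add: \<delta>_def)
      also have "\<dots> \<le> 8 * 2 / (M' * L)"
        using rm M' L by (intro divide_right_mono mult_left_mono) auto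
      finally show "C2 \<le> C1"
        unfolding C1_def C2_def using C \<delta> L by (intro add_left_mono mult_left_mono power_mono) auto
    qed
    define K where "K = T * (F / (2 ^ m) ^ k * W)"
    have K: "0 < K" using T F W by (simp add: K_def)
    have energy: "(\<Sum>x\<in>X. \<Sum>y\<in>X. \<mu> x * \<mu> y * g x y) \<le> K"
    proof -
      have "(\<Sum>x\<in>X. \<Sum>y\<in>X. \<mu> x * \<mu> y * g x y) \<le>
          sum \<mu> X * (C2 * B * L powr s / (2 ^ m) ^ k * (\<Sum>j\<le>m. (2 ^ j) powr (real k - s)))"
        by (rule frostman_energy_le[OF X(1,3) L s C2(1) X(5)[folded B_def] gk])
      also have "\<dots> \<le> K"
        unfolding K_def F_def W_def[symmetric] T_def[symmetric]
        using T C2 L W by (intro mult_left_mono mult_right_mono divide_right_mono) (auto simp: B_def)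
      finally show ?thesis .
    qed
    define Q where "Q a = (\<Sum>x\<in>X. \<Sum>y\<in>X. \<mu> x * \<mu> y * of_bool (dist (radial_proj a x) (radial_proj a y) \<le> \<delta>))" for a
    \<comment> \<open>Agrees with \<open>Q\<close> on \<open>A\<close> and vanishes elsewhere; as a
      finite combination of indicators of Borel sets it is measurable on the whole space and can be
      integrated termwise.\<close>
    define Q' where "Q' a = (\<Sum>x\<in>X. \<Sum>y\<in>X. ennreal (\<mu> x * \<mu> y) * indicator (S x y) a)" for a
    have \<mu>0: "0 \<le> \<mu> x * \<mu> y" if "x \<in> X" "y \<in> X" for x y using X(3) that by (simp add: less_imp_le)
    have Q0: "0 \<le> Q a" for a unfolding Q_def using \<mu>0 by (intro sum_nonneg) (auto simp: of_bool_def)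
    have QQ': "Q' a = ennreal (Q a)" if "a \<in> A" for a
    proof -
      have "ennreal (\<mu> x * \<mu> y) * indicator (S x y) a =
          ennreal (\<mu> x * \<mu> y * of_bool (dist (radial_proj a x) (radial_proj a y) \<le> \<delta>))" for x y
        using that by (auto simp: S_def indicator_def)
      then show ?thesis unfolding Q'_def Q_def using \<mu>0
        by (simp add: sum_ennreal sum_nonneg del: of_bool_eq_1_iff)
    qed
    have Q'A: "Q' a = 0" if "a \<notin> A" for a
      unfolding Q'_def using that by (simp add: S_def)
    have indm: "indicator (S x y) \<in> borel_measurable H" if "x \<in> X" "y \<in> X" for x y
      using S[OF that] by (intro borel_measurable_indicator) (simp add: H_def)
    have tm: "(\<lambda>a. ennreal (\<mu> x * \<mu> y) * indicator (S x y) a) \<in> borel_measurable H"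
      if "x \<in> X" "y \<in> X" for x y
      using indm[OF that] by measurable
    have Q'm: "Q' \<in> borel_measurable H"
      unfolding Q'_def by (intro borel_measurable_sum tm)
    have "(\<integral>\<^sup>+a\<in>A. ennreal (Q a) \<partial>H) = (\<integral>\<^sup>+a. Q' a \<partial>H)"
      using QQ' Q'A by (intro nn_integral_cong) (auto simp: indicator_def)
    also have "\<dots> = (\<Sum>x\<in>X. \<integral>\<^sup>+a. (\<Sum>y\<in>X. ennreal (\<mu> x * \<mu> y) * indicator (S x y) a) \<partial>H)"
      unfolding Q'_def by (intro nn_integral_sum borel_measurable_sum tm)
    also have "\<dots> = (\<Sum>x\<in>X. \<Sum>y\<in>X. \<integral>\<^sup>+a. ennreal (\<mu> x * \<mu> y) * indicator (S x y) a \<partial>H)"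
      by (intro sum.cong refl nn_integral_sum tm)
    also have "\<dots> = (\<Sum>x\<in>X. \<Sum>y\<in>X. ennreal (\<mu> x * \<mu> y * g x y))"
    proof (intro sum.cong refl)
      fix x y assume xy: "x \<in> X" "y \<in> X"
      have "(\<integral>\<^sup>+a. ennreal (\<mu> x * \<mu> y) * indicator (S x y) a \<partial>H) = ennreal (\<mu> x * \<mu> y) * emeasure H (S x y)"
        using S[OF xy] by (intro nn_integral_cmult_indicator) (simp add: H_def)
      also have "\<dots> = ennreal (\<mu> x * \<mu> y * g x y)"
        unfolding emS[OF xy] using \<mu>0[OF xy] by (intro ennreal_mult[symmetric]) (auto simp: g_def)
      finally show "(\<integral>\<^sup>+a. ennreal (\<mu> x * \<mu> y) * indicator (S x y) a \<partial>H) = ennreal (\<mu> x * \<mu> y * g x y)" .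
    qed
    also have "\<dots> = ennreal (\<Sum>x\<in>X. \<Sum>y\<in>X. \<mu> x * \<mu> y * g x y)"
      using \<mu>0 by (simp add: sum_ennreal sum_nonneg g_def)
    also have "\<dots> \<le> ennreal K" using energy by (rule ennreal_leI)
    finally have int: "(\<integral>\<^sup>+a\<in>A. ennreal (Q a) \<partial>H) \<le> ennreal K" .
    let ?q = "2 * K / h"
    have q: "0 < ?q" using K h by simp
    let ?G = "{a \<in> A. Q a \<le> ?q}"
    have G: "?G \<in> sets H"
    proof -
      have "?G = A \<inter> {a \<in> space H. Q' a \<le> ennreal ?q}"
        using QQ' Q0 q by (auto simp: H_def ennreal_le_iff)
      moreover have "{a \<in> space H. Q' a \<le> ennreal ?q} \<in> sets H" using Q'm by measurable
      ultimately show ?thesis using AH by simp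
    qed
    have Gh: "ennreal (h / 2) \<le> emeasure H ?G" by (rule markov_half[OF AH HA h K G int])
    define v where "v = cc * (r / M') ^ k * (T\<^sup>2 / ?q)"
    have v0: "0 \<le> v" using cc r M' K h by (simp add: v_def)
    have vis: "ennreal v \<le> vis a (nbhd E r)" if "a \<in> ?G" for a
      unfolding v_def cc_def T_def k_def
    proof (rule vis_nbhd_lower[OF n X(1-3)])
      show "a \<notin> E" using that disj by blast
      show "norm (x - a) \<le> M'" if "x \<in> E" for x using bdd' that \<open>a \<in> ?G\<close> by blast
      show "r / M' \<le> 1 / 2" using r M' by (simp add: field_simps)
      show "(\<Sum>x\<in>X. \<Sum>y\<in>X. \<mu> x * \<mu> y * of_bool (dist (radial_proj a x) (radial_proj a y) \<le> 4 * r / M')) \<le> ?q"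
        using that by (simp add: Q_def \<delta>_def)
    qed (use r M' q in auto)
    have "\<kappa> / W \<le> v * (h / 2)"
    proof -
      have eq: "v * (h / 2) = cc * h\<^sup>2 * T * (r * 2 ^ m) ^ k / (4 * M' ^ k * F) / W"
        using T h F W M' by (simp add: v_def K_def power_divide power_mult_distrib power2_eq_square field_simps)
      have "\<kappa> \<le> cc * h\<^sup>2 * T * (r * 2 ^ m) ^ k / (4 * M' ^ k * F)"
        unfolding \<kappa>_def
      proof (rule divide_right_mono)
        have "(c0 / D powr s) * 1 \<le> T * (r * 2 ^ m) ^ k"
          using T0 T rm by (intro mult_mono one_le_power) auto
        then have "cc * h\<^sup>2 * ((c0 / D powr s) * 1) \<le> cc * h\<^sup>2 * (T * (r * 2 ^ m) ^ k)"
          using cc by (intro mult_left_mono) auto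
        then show "cc * h\<^sup>2 * (c0 / D powr s) \<le> cc * h\<^sup>2 * T * (r * 2 ^ m) ^ k"
          by (simp add: mult.assoc)
      qed (use F M' in simp)
      then show ?thesis unfolding eq using W by (intro divide_right_mono) auto
    qed
    then have "ennreal (\<kappa> / W) \<le> ennreal v * ennreal (h / 2)"
      using v0 h by (simp add: ennreal_mult[symmetric] ennreal_leI)
    also have "\<dots> \<le> ennreal v * emeasure H ?G" using Gh by (rule mult_left_mono) simp
    also have "\<dots> = (\<integral>\<^sup>+a. ennreal v * indicator ?G a \<partial>H)"
      by (rule nn_integral_cmult_indicator[OF G, symmetric])
    also have "\<dots> \<le> (\<integral>\<^sup>+a\<in>A. vis a (nbhd E r) \<partial>H)"
      using vis by (intro nn_integral_mono) (auto simp: indicator_def)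
    finally show "ennreal (\<kappa> / (\<Sum>j\<le>m. (2 ^ j) powr (real k - s))) \<le> (\<integral>\<^sup>+a\<in>A. vis a (nbhd E r) \<partial>H)"
      by (simp add: W_def)
  qed
qed

section \<open>Evaluation of the dyadic sum and the final statement\<close>

lemma dyadic_scale:
  assumes r: "0 < r" "r < 1"
  obtains m where "1 \<le> r * 2 ^ m" "r * 2 ^ m \<le> (2::real)"
proof -
  define m where "m = (LEAST m. 1 \<le> r * 2 ^ m)"
  obtain i where "1 / r < 2 ^ i" using real_arch_pow[of 2 "1 / r"] by auto
  then have "1 \<le> r * 2 ^ i" using r by (simp add: field_simps)
  then have m: "1 \<le> r * 2 ^ m" unfolding m_def by (rule LeastI)
  then have "m \<noteq> 0" using r by (intro notI) simp
  then obtain i where i: "m = Suc i" by (cases m) auto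
  then have "\<not> 1 \<le> r * 2 ^ i" using not_less_Least[of i "\<lambda>m. 1 \<le> r * 2 ^ m"] by (simp add: m_def)
  then have "r * 2 ^ m \<le> 2" using i by simp
  with m show ?thesis by (rule that)
qed

text \<open>A geometric sum of ratio \<open>2 powr \<alpha>\<close>, dominated by its last term. One
  factor \<open>2 powr \<alpha>\<close> of the constant comes from the exponent
  \<open>Suc m\<close>, the other from \<open>2 ^ m \<le> 2 / r\<close>.\<close>

lemma sum_dyadic_powr_le:
  fixes \<alpha> r :: real
  assumes \<alpha>: "0 < \<alpha>" and r: "0 < r" "r * 2 ^ m \<le> 2"
  shows "(\<Sum>j\<le>m. (2 ^ j) powr \<alpha>) \<le> (2 powr \<alpha>)\<^sup>2 / (2 powr \<alpha> - 1) * r powr (- \<alpha>)"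
proof -
  define q where "q = (2::real) powr \<alpha>"
  have q: "1 < q" using \<alpha> by (simp add: q_def)
  have qj: "(2 ^ j) powr \<alpha> = q ^ j" for j
    by (simp add: q_def powr_powr powr_realpow[symmetric] mult.commute)
  have "(\<Sum>j\<le>m. (2 ^ j) powr \<alpha>) = (q ^ Suc m - 1) / (q - 1)"
    unfolding qj using q geometric_sum[of q "Suc m"] by (simp add: lessThan_Suc_atMost)
  also have "\<dots> \<le> q * q ^ m / (q - 1)" using q by (intro divide_right_mono) auto
  also have "q ^ m \<le> (2 / r) powr \<alpha>"
    unfolding qj[symmetric] using r \<alpha> by (intro powr_mono2) (auto simp: field_simps)
  then have "q * q ^ m / (q - 1) \<le> q * (2 / r) powr \<alpha> / (q - 1)"
    using q by (intro divide_right_mono mult_left_mono) auto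
  also have "(2 / r) powr \<alpha> = q * r powr (- \<alpha>)"
    using r by (simp add: q_def powr_divide powr_minus_divide)
  finally show ?thesis by (simp add: q_def power2_eq_square mult_ac)
qed

theorem theorem1p6:
  fixes E A :: "(real ^ 'n) set" and s M \<rho> :: real
  defines "H \<equiv> (hausdorff_measure (real (CARD('n) - 1)) :: (real ^ 'n) measure)"
  assumes n: "CARD('n) \<ge> 2"
    and s: "0 \<le> s"
    and E: "0 < hausdorff_outer s E" "hausdorff_outer s E < \<infinity>"
    and A: "piecewise_smooth_surface A"
    and disj: "A \<inter> E = {}"
    and bdd: "\<And>a e. a \<in> A \<Longrightarrow> e \<in> E \<Longrightarrow> norm (a - e) \<le> M"
    and \<rho>: "0 < \<rho>"
    and tangent: "AE a in H. a \<in> A \<longrightarrow> (\<forall>T \<in> tangent_planes A a. \<rho> \<le> setdist T E)"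
  shows "transversal (CARD('n) - 1) (uniform_measure H A) A E radial_proj \<and>
    (s < real (CARD('n)) - 1 \<longrightarrow>
      (\<exists>c>0. \<forall>\<^sub>F r in at_right 0.
        ennreal (c * r powr (real (CARD('n)) - 1 - s)) \<le> (\<integral>\<^sup>+a\<in>A. vis a (nbhd E r) \<partial>H))) \<and>
    (s = real (CARD('n)) - 1 \<longrightarrow>
      (\<exists>c>0. \<forall>\<^sub>F r in at_right 0.
        ennreal (c * inverse (ln (inverse r))) \<le> (\<integral>\<^sup>+a\<in>A. vis a (nbhd E r) \<partial>H)))"
proof -
  let ?k = "CARD('n) - 1"
  have dim: "DIM(real ^ 'n) = CARD('n)" by simp
  have n': "2 \<le> DIM(real ^ 'n)" using n by simp
  have H: "H = hausdorff_measure (real (DIM(real ^ 'n) - 1))" by (simp add: H_def)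
  have k: "real ?k = real CARD('n) - 1" using n by (simp add: of_nat_diff)
  have emH: "emeasure H B = hausdorff_outer (real ?k) B" if "B \<in> sets borel" for B
    unfolding H_def by (rule emeasure_hausdorff_measure) (use that in auto)
  \<comment> \<open>The exceptional set is enlarged to a Borel null set, on which the measure and
    the outer measure agree.\<close>
  obtain Z where Z: "{a \<in> space H. \<not> (a \<in> A \<longrightarrow> (\<forall>T \<in> tangent_planes A a. \<rho> \<le> setdist T E))} \<subseteq> Z"
    "emeasure H Z = 0" "Z \<in> sets H"
    using tangent by (rule AE_E)
  have Z0: "hausdorff_outer (real (DIM(real ^ 'n) - 1)) Z = 0"
    using emH[of Z] Z(2,3) by (simp add: H_def)
  have good: "\<rho> \<le> setdist T E" if "a \<in> A - Z" "T \<in> tangent_planes A a" for a T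
    using that Z(1) by (auto simp: H_def)
  obtain C where C: "0 < C" "\<And>x y \<delta>. x \<in> E \<Longrightarrow> y \<in> E \<Longrightarrow> x \<noteq> y \<Longrightarrow> 0 < \<delta> \<Longrightarrow>
    hausdorff_outer (real (DIM(real ^ 'n) - 1)) {a \<in> A. dist (radial_proj a x) (radial_proj a y) \<le> \<delta>}
      \<le> ennreal (C * (\<delta> / dist x y) ^ (DIM(real ^ 'n) - 1))"
    by (rule hausdorff_radial_proj_le[OF n' A disj bdd \<rho> Z0 good]) (assumption | rule that)+
  have clA: "closed A" using compact_piecewise_smooth_surface[OF A] compact_imp_closed by blast
  define h where "h = enn2real (hausdorff_outer (real ?k) A)"
  have hA: "emeasure H A = ennreal h" and h: "0 < h"
    using piecewise_smooth_surface_hausdorff_finite[OF n' A] piecewise_smooth_surface_hausdorff_pos[OF n' A]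
      emH[of A] clA by (auto simp: h_def enn2real_positive_iff)
  \<comment> \<open>Division by \<open>h\<close> accounts for the normalisation of the measure, and
    the added \<open>1\<close> makes the inequality strict. The bound holds for every positive
    \<open>\<delta>\<close>, so \<open>1\<close> serves as \<open>\<delta>\<^sub>0\<close>.\<close>
  have "transversal ?k (uniform_measure H A) A E radial_proj"
    unfolding transversal_def
  proof (rule exI[of _ "C / h + 1"], rule conjI, goal_cases)
    case 1
    show "0 < C / h + 1" using C(1) h by (simp add: add_pos_pos)
  next
    case 2
    show ?case
    proof (rule exI[of _ "1::real"], rule conjI, simp, intro ballI impI allI)
      fix x y \<delta> assume xy: "x \<in> E" "y \<in> E" "x \<noteq> y" and "0 < \<delta> \<and> \<delta> \<le> (1::real)"
      then have \<delta>: "0 < \<delta>" by simp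
      let ?S = "{a \<in> A. dist (radial_proj a x) (radial_proj a y) \<le> \<delta>}"
      let ?q = "\<delta> ^ ?k / dist x y ^ ?k"
      have q: "0 < ?q" using \<delta> xy by simp
      have S: "?S \<in> sets borel"
        using xy disj by (intro borel_closed closed_radial_proj_close[OF clA]) auto
      have "emeasure (uniform_measure H A) ?S = emeasure H (A \<inter> ?S) / emeasure H A"
        by (rule emeasure_uniform_measure) (use S clA in \<open>auto simp: H_def\<close>)
      also have "A \<inter> ?S = ?S" by blast
      also have "emeasure H ?S / emeasure H A \<le> ennreal (C * ?q) / ennreal h"
        unfolding emH[OF S] hA using C(2)[OF xy \<delta>] by (intro divide_right_mono_ennreal) (simp add: power_divide)
      also have "\<dots> = ennreal (C * ?q / h)"
        by (rule divide_ennreal[OF mult_nonneg_nonneg[OF less_imp_le[OF C(1)] less_imp_le[OF q]] h])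
      also have "\<dots> < ennreal ((C / h + 1) * ?q)"
      proof (rule ennreal_lessI)
        have *: "C * p / h < (C / h + 1) * p" if "0 < p" for p using that by (simp add: distrib_right)
        show "C * ?q / h < (C / h + 1) * ?q" by (rule *[OF q])
        show "0 < (C / h + 1) * ?q" by (rule mult_pos_pos[OF _ q]) (use C(1) h in \<open>simp add: add_pos_pos\<close>)
      qed
      finally show "emeasure (uniform_measure H A) ?S < ennreal ((C / h + 1) * ?q)" .
    qed
  qed
  moreover obtain \<kappa> where \<kappa>: "0 < \<kappa>"
    "\<And>r m. 0 < r \<Longrightarrow> r < 1 / 2 \<Longrightarrow> 1 \<le> r * 2 ^ m \<Longrightarrow> r * 2 ^ m \<le> 2 \<Longrightarrow>
      ennreal (\<kappa> / (\<Sum>j\<le>m. (2 ^ j) powr (real (DIM(real ^ 'n) - 1) - s))) \<le> (\<integral>\<^sup>+a\<in>A. vis a (nbhd E r) \<partial>H)"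
    by (rule visibility_integral_lower[OF n' A disj bdd s E(1) C, folded H]) (assumption | rule that)+
  have small: "\<forall>\<^sub>F r in at_right (0::real). 0 < r \<and> r < b" if "0 < b" for b
    using eventually_at_right_real[OF that] by eventually_elim auto
  have "\<exists>c>0. \<forall>\<^sub>F r in at_right 0.
      ennreal (c * r powr (real (CARD('n)) - 1 - s)) \<le> (\<integral>\<^sup>+a\<in>A. vis a (nbhd E r) \<partial>H)"
    if lt: "s < real (CARD('n)) - 1"
  proof -
    let ?a = "real ?k - s"
    define G where "G = (2 powr ?a)\<^sup>2 / (2 powr ?a - 1)"
    have a: "0 < ?a" using lt k by simp
    have G: "0 < G" using a by (simp add: G_def)
    have "\<forall>\<^sub>F r in at_right 0. ennreal (\<kappa> / G * r powr (real (CARD('n)) - 1 - s)) \<le> (\<integral>\<^sup>+a\<in>A. vis a (nbhd E r) \<partial>H)"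
      using small[of "1 / 2", simplified]
    proof eventually_elim
      case (elim r)
      then have r: "0 < r" "r < 1" "r < 1 / 2" by auto
      obtain m where m: "1 \<le> r * 2 ^ m" "r * 2 ^ m \<le> 2" using dyadic_scale[OF r(1,2)] by blast
      let ?W = "\<Sum>j\<le>m. (2 ^ j) powr ?a"
      have W: "0 < ?W" by (intro sum_pos) auto
      have "?W \<le> G * r powr (- ?a)" unfolding G_def by (rule sum_dyadic_powr_le[OF a r(1) m(2)])
      then have "\<kappa> / (G * r powr (- ?a)) \<le> \<kappa> / ?W"
        using \<kappa>(1) W by (intro divide_left_mono) (auto intro: less_le_trans)
      also have "\<kappa> / (G * r powr (- ?a)) = \<kappa> / G * r powr (real (CARD('n)) - 1 - s)"
        unfolding k by (simp only: powr_minus) (simp add: field_simps)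
      finally have "ennreal (\<kappa> / G * r powr (real (CARD('n)) - 1 - s)) \<le> ennreal (\<kappa> / ?W)"
        by (rule ennreal_leI)
      also have "\<dots> \<le> (\<integral>\<^sup>+a\<in>A. vis a (nbhd E r) \<partial>H)"
        using \<kappa>(2)[OF r(1,3) m] by simp
      finally show ?case .
    qed
    then show ?thesis using \<kappa>(1) G by (intro exI[of _ "\<kappa> / G"]) simp
  qed
  moreover have "\<exists>c>0. \<forall>\<^sub>F r in at_right 0.
      ennreal (c * inverse (ln (inverse r))) \<le> (\<integral>\<^sup>+a\<in>A. vis a (nbhd E r) \<partial>H)"
    if eq: "s = real (CARD('n)) - 1"
  proof -
    have a: "real ?k - s = 0" using eq k by simp
    \<comment> \<open>Below this bound both \<open>r < 1 / 2\<close> and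
      \<open>ln (inverse r) \<ge> 1\<close> hold.\<close>
    have e: "0 < exp (- 1) / (2::real)" by simp
    have "\<forall>\<^sub>F r in at_right 0. ennreal (\<kappa> / 4 * inverse (ln (inverse r))) \<le> (\<integral>\<^sup>+a\<in>A. vis a (nbhd E r) \<partial>H)"
      using small[OF e]
    proof eventually_elim
      case (elim r)
      have "exp (- 1) \<le> (1::real)" by simp
      then have r: "0 < r" "r < 1" "r < 1 / 2" "r < exp (- 1)" using elim by linarith+
      obtain m where m: "1 \<le> r * 2 ^ m" "r * 2 ^ m \<le> 2" using dyadic_scale[OF r(1,2)] by blast
      let ?l = "ln (inverse r)"
      have l: "1 \<le> ?l"
      proof -
        have "ln r < ln (exp (- 1))" using r by (subst ln_less_cancel_iff) auto
        then show ?thesis using r(1) by (simp add: ln_inverse)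
      qed
      \<comment> \<open>From \<open>2 ^ m \<le> 2 / r\<close> and \<open>ln 2 \<ge> 1 / 2\<close>.
        With exponent \<open>0\<close> every term of the sum is \<open>1\<close>, so the sum is
        \<open>m + 1\<close>, at most \<open>2 + 2 * ?l\<close> and hence at most
        \<open>4 * ?l\<close>.\<close>
      have "real m \<le> 1 + 2 * ?l"
      proof -
        have "ln (r * 2 ^ m) \<le> ln 2" using m r(1) by (subst ln_le_cancel_iff) auto
        then have "real m * ln 2 \<le> ln 2 + ?l" using r(1) by (simp add: ln_mult ln_realpow ln_inverse)
        then have "(real m - 1) * ln 2 \<le> ?l" by (simp add: algebra_simps)
        moreover have "1 / 2 \<le> ln (2::real)" using ln_le_minus_one[of "1 / 2 :: real"] by (simp add: ln_div)
        ultimately show ?thesis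
          using l mult_left_mono[of "1/2" "ln 2" "real m - 1"] by (cases "1 \<le> real m") auto
      qed
      then have W: "(\<Sum>j\<le>m. (2 ^ j) powr (real ?k - s)) \<le> 4 * ?l"
        using l unfolding a by simp
      have "\<kappa> / 4 * inverse ?l = \<kappa> / (4 * ?l)" by (simp add: field_simps)
      also have "\<dots> \<le> \<kappa> / (\<Sum>j\<le>m. (2 ^ j) powr (real ?k - s))"
        using \<kappa>(1) W l by (intro divide_left_mono mult_pos_pos) (auto intro!: sum_pos)
      finally have "ennreal (\<kappa> / 4 * inverse ?l) \<le> ennreal (\<kappa> / (\<Sum>j\<le>m. (2 ^ j) powr (real ?k - s)))"
        by (rule ennreal_leI)
      also have "\<dots> \<le> (\<integral>\<^sup>+a\<in>A. vis a (nbhd E r) \<partial>H)"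
        using \<kappa>(2)[OF r(1,3) m] by simp
      finally show ?case .
    qed
    then show ?thesis using \<kappa>(1) by (intro exI[of _ "\<kappa> / 4"]) simp
  qed
  ultimately show ?thesis by blast
qed

end
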